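(* Let $f\in\mathbb{C}[T]$ be monic of degree $d\ge2$, hyperbolic, and postcritically finite. There exists a constant $c(f)>0$, depending only on $f$, with the following property. Let $D\ge1$ be an integer and let $z_1,\ldots,z_D\in\mathbb{C}$ satisfy $$\max_{1\le j\le D}\lambda_f(z_j)<\frac{c(f)}{D}.$$ Then there exists a finite topological tree $\mathcal{T}\subset\mathbb{C}$ such that (i) $\{z_1,\ldots,z_D\}\subset\mathcal{T}$, and (ii) $\mathsf{d}_\infty(\mathcal{T})\le-c(f)/D$.
   Context: $f^{(n)}$ is the $n$-th iterate of $f$. $f$ is postcritically finite if every root of $f'$ has finite forward orbit under $f$. $f$ is hyperbolic if there exist $m\in\mathbb{N}$ and $\lambda>1$ with $|(f^{(m)})'(z)|\ge\lambda$ for all $z$ in the Julia set $J_f\subset\mathbb{C}$. The local canonical height is $\lambda_f(z)=\lim_{n\to\infty}d^{-n}\log^+|f^{(n)}(z)|$, with $\log^+t=\log\max\{1,t\}$. A finite topological tree is a finite tree (connected finite graph without cycles) embedded in $\mathbb{C}$, regarded as a compact subset. For a non-empty compact $K\subset\mathbb{C}$ and $N\ge2$, $\mathsf{d}_N(K)=\frac{2}{N(N-1)}\max_{z_1,\ldots,z_N\in K}\log\prod_{1\le i<j\le N}|z_j-z_i|\in\{-\infty\}\cup\mathbb{R}$, and the logarithmic transfinite diameter is $\mathsf{d}_\infty(K)=\lim_{N\to\infty}\mathsf{d}_N(K)\in\{-\infty\}\cup\mathbb{R}$ (the sequence is non-increasing). *)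

theory Defs
  imports "HOL-Analysis.Analysis" "HOL-Computational_Algebra.Polynomial"
begin

section \<open>Dynamics of a complex polynomial\<close>

definition filled_julia_set :: "complex poly \<Rightarrow> complex set" where
  "filled_julia_set f = {z. bounded (range (\<lambda>n. (poly f ^^ n) z))}"

text \<open>The Julia set in the complex plane; for a polynomial of degree at least 2 it is the boundary
  of the filled Julia set.\<close>

definition julia_set :: "complex poly \<Rightarrow> complex set" where
  "julia_set f = frontier (filled_julia_set f)"

definition hyperbolic_poly :: "complex poly \<Rightarrow> bool" where
  "hyperbolic_poly f \<longleftrightarrow>
     (\<exists>(m::nat) (l::real). l > 1 \<and> (\<forall>z\<in>julia_set f. norm (deriv (poly f ^^ m) z) \<ge> l))"

definition postcritically_finite :: "complex poly \<Rightarrow> bool" where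
  "postcritically_finite f \<longleftrightarrow>
     (\<forall>c. poly (pderiv f) c = 0 \<longrightarrow> finite (range (\<lambda>n. (poly f ^^ n) c)))"

definition log_plus :: "real \<Rightarrow> real" where
  "log_plus t = ln (max 1 t)"

definition local_height :: "complex poly \<Rightarrow> complex \<Rightarrow> real" where
  "local_height f z =
     lim (\<lambda>n. log_plus (norm ((poly f ^^ n) z)) / real (degree f) ^ n)"


section \<open>Finite topological trees\<close>

definition graph_connected :: "'v set \<Rightarrow> 'v set set \<Rightarrow> bool" where
  "graph_connected V E \<longleftrightarrow> (\<forall>u\<in>V. \<forall>v\<in>V. (u, v) \<in> {(x, y). {x, y} \<in> E}\<^sup>*)"

definition graph_cycle :: "'v set set \<Rightarrow> 'v list \<Rightarrow> bool" where
  "graph_cycle E vs \<longleftrightarrow> length vs \<ge> 3 \<and> distinct vs \<and>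
     (\<forall>i<length vs. {vs ! i, vs ! (Suc i mod length vs)} \<in> E)"

definition finite_tree :: "'v set \<Rightarrow> 'v set set \<Rightarrow> bool" where
  "finite_tree V E \<longleftrightarrow> finite V \<and> V \<noteq> {} \<and> (\<forall>e\<in>E. e \<subseteq> V \<and> card e = 2) \<and>
     graph_connected V E \<and> (\<nexists>vs. graph_cycle E vs)"

text \<open>An embedding of a graph in the plane: the vertices are points of the plane, and each edge is
  realised by an arc joining its two endpoints. The arcs meet the vertices, and each other, only at
  the endpoints they have as edges of the graph.\<close>

definition finite_topological_tree :: "complex set \<Rightarrow> bool" where
  "finite_topological_tree T \<longleftrightarrow>
     (\<exists>(V :: complex set) (E :: complex set set) (\<gamma> :: complex set \<Rightarrow> real \<Rightarrow> complex).
        finite_tree V E \<and>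
        (\<forall>e\<in>E. arc (\<gamma> e) \<and> {pathstart (\<gamma> e), pathfinish (\<gamma> e)} = e \<and>
                path_image (\<gamma> e) \<inter> V = e) \<and>
        (\<forall>e\<in>E. \<forall>e'\<in>E. e \<noteq> e' \<longrightarrow> path_image (\<gamma> e) \<inter> path_image (\<gamma> e') = e \<inter> e') \<and>
        T = V \<union> (\<Union>e\<in>E. path_image (\<gamma> e)))"


section \<open>Logarithmic transfinite diameter\<close>

text \<open>Logarithm of a nonnegative real with value minus infinity at 0, unlike \<^term>\<open>ln\<close>, for which
  \<^prop>\<open>ln (0::real) = 0\<close>.\<close>

definition elog :: "real \<Rightarrow> ereal" where
  "elog x = (if x = 0 then - \<infinity> else ereal (ln x))"

text \<open>For compact nonempty \<open>K\<close> and \<open>N \<ge> 2\<close> the supremum is a maximum, possibly minus infinity.\<close>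

definition log_diam :: "nat \<Rightarrow> complex set \<Rightarrow> ereal" where
  "log_diam N K =
     ereal (2 / (real N * (real N - 1))) *
     (SUP z\<in>{1..N} \<rightarrow> K. elog (\<Prod>(i, j)\<in>{(i, j). 1 \<le> i \<and> i < j \<and> j \<le> N}. norm (z j - z i)))"

definition log_transfinite_diam :: "complex set \<Rightarrow> ereal" where
  "log_transfinite_diam K = lim (\<lambda>N. log_diam N K)"

end

theory Submission
  imports Defs "HOL-Complex_Analysis.Complex_Analysis"
    "HOL-Computational_Algebra.Fundamental_Theorem_Algebra" "HOL-Real_Asymp.Real_Asymp"
begin

text \<open>An arc is found that passes through the points \<open>z\<^sub>j\<close> but avoids many preimages of a fixed disc,
  and missing those preimages makes its transfinite diameter small.

  By hyperbolicity the Julia set is a continuous image of an interval (the limit of lifted loops near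
  infinity). Hence it contains a point \<open>w\<close> whose removal still lets the finite
  postcritical set be joined to a further point of the Julia set by a continuum \<open>H\<close> inside the
  filled Julia set. All inverse branches of iterates exist on a disc around \<open>w\<close>. A slit
  neighbourhood of \<open>H\<close> missing this disc has connected preimages under every iterate, and every
  point of small height is joined to such a preimage by a connected set meeting at most \<open>q\<close> of the
  \<open>d ^ n\<close> preimages of the disc. With \<open>d ^ n\<close> comparable to \<open>D\<close>, at least half of the preimages are
  avoided altogether.

  The transfinite diameter is bounded with Cauchy's double alternant: for sets \<open>X\<close>, \<open>Y\<close> of equal size
  the product of the Vandermonde products of \<open>X\<close> and \<open>Y\<close> is controlled by the product of all mutual
  distances. Taking for \<open>Y\<close> a fibre of a high iterate gives the bound zero; moving the
  points of \<open>Y\<close> inside an avoided preimage to its boundary gains a fixed amount per preimage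
  by the maximum principle, since a holomorphic function with zeros near the centre of a disc is much
  smaller there than on the boundary circle.\<close>

section \<open>Vandermonde products and the Cauchy inequality\<close>

text \<open>The estimate balances two terms of order \<open>1 / d ^ n\<close>. For
  \<open>d ^ k\<close> points on the arc, each avoided preimage holds at least
  \<open>m = d ^ (k - n - l)\<close> points of the comparison fibre, and moving \<open>m\<close>
  points to the boundary gains a factor \<open>3 ^ (m * (m - 1))\<close>. Half of the
  \<open>d ^ n\<close> cells thus gain a constant times \<open>(d ^ k)^2 / d ^ n\<close> in the
  exponent, the constant depending on \<open>d\<close> and \<open>l\<close> only. The loss arises
  because the arc lies in a neighbourhood of the filled Julia set and not inside it: its points are
  only known to be in the disc of radius \<open>R0\<close> up to time \<open>n + N0\<close>, which
  costs a constant times \<open>(d ^ k)^2 / d ^ (n + N0)\<close>. Hence \<open>N0\<close> is fixed,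
  depending on \<open>f\<close> alone, so that the loss is at most half of the gain; all else is of
  lower order. The obstacle is topological: points of small height must be joined inside this thin
  neighbourhood, so the connecting set is taken as a preimage under the \<open>n\<close>-th iterate.
  Preimages of the chosen domain stay connected for every \<open>n\<close> because it contains all
  critical values of the iterates, which is why \<open>H\<close> must reach every postcritical point
  without meeting \<open>w\<close>.\<close>

text \<open>The product runs over ordered pairs, so it is the square of the product in the transfinite diameter.\<close>

definition vdm :: "complex set \<Rightarrow> real" where
  "vdm X = (\<Prod>x\<in>X. \<Prod>x'\<in>X - {x}. norm (x - x'))"

definition cross :: "complex set \<Rightarrow> complex set \<Rightarrow> real" where
  "cross X Y = (\<Prod>x\<in>X. \<Prod>y\<in>Y. norm (x - y))"

lemma vdm_nonneg: "vdm X \<ge> 0"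
  unfolding vdm_def by (intro prod_nonneg) auto

lemma vdm_pos: "finite X \<Longrightarrow> vdm X > 0"
  unfolding vdm_def by (intro prod_pos) auto

lemma cross_nonneg: "cross X Y \<ge> 0"
  unfolding cross_def by (intro prod_nonneg) auto

lemma vdm_insert:
  assumes "finite X" "x \<notin> X"
  shows "vdm (insert x X) = vdm X * (\<Prod>x'\<in>X. norm (x - x'))^2"
proof -
  have "(\<Prod>x'\<in>insert x X - {y}. norm (y - x')) = norm (x - y) * (\<Prod>x'\<in>X - {y}. norm (y - x'))"
    if "y \<in> X" for y
  proof -
    have "insert x X - {y} = insert x (X - {y})" using that assms by auto
    then show ?thesis using assms by (simp add: norm_minus_commute)
  qed
  then have "(\<Prod>y\<in>X. \<Prod>x'\<in>insert x X - {y}. norm (y - x'))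
      = (\<Prod>y\<in>X. norm (x - y)) * vdm X"
    by (simp add: vdm_def prod.distrib)
  moreover have "insert x X - {x} = X" using assms by auto
  ultimately show ?thesis
    using assms by (simp add: vdm_def power2_eq_square)
qed

text \<open>Both sides are polynomials in \<open>x\<close> of degree below \<open>card Y\<close>
  that agree on \<open>Y\<close>.\<close>

lemma lagrange_interpolation_poly:
  fixes p :: "'a::field poly"
  assumes "finite Y" "degree p < card Y"
  shows "poly p x = (\<Sum>y\<in>Y. poly p y * (\<Prod>y'\<in>Y - {y}. (x - y') / (y - y')))"
proof -
  define q where "q = (\<Sum>y\<in>Y. smult (poly p y * (\<Prod>y'\<in>Y - {y}. inverse (y - y')))
                        (\<Prod>y'\<in>Y - {y}. [:- y', 1:]))"
  have q: "poly q x = (\<Sum>y\<in>Y. poly p y * (\<Prod>y'\<in>Y - {y}. (x - y') / (y - y')))" for x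
    unfolding q_def poly_sum
  proof (intro sum.cong refl)
    fix y assume "y \<in> Y"
    have "(\<Prod>y'\<in>Y - {y}. (x - y') / (y - y'))
        = (\<Prod>y'\<in>Y - {y}. inverse (y - y')) * (\<Prod>y'\<in>Y - {y}. x - y')"
      by (simp add: prod.distrib[symmetric] divide_inverse mult.commute)
    then show "poly (smult (poly p y * (\<Prod>y'\<in>Y - {y}. inverse (y - y'))) (\<Prod>y'\<in>Y - {y}. [:- y', 1:])) x
        = poly p y * (\<Prod>y'\<in>Y - {y}. (x - y') / (y - y'))"
      by (simp add: poly_prod)
  qed
  have "degree q < card Y"
    unfolding q_def
  proof (rule degree_sum_less)
    fix y assume "y \<in> Y"
    have "degree (\<Prod>y'\<in>Y - {y}. [:- y', 1:]) \<le> card (Y - {y})"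
      using degree_prod_sum_le[of "Y - {y}" "\<lambda>y'. [:- y', 1:]"] assms by (simp add: o_def)
    also have "\<dots> < card Y" using \<open>y \<in> Y\<close> assms by (simp add: card_gt_0_iff)
    finally show "degree (smult (poly p y * (\<Prod>y'\<in>Y - {y}. inverse (y - y')))
                        (\<Prod>y'\<in>Y - {y}. [:- y', 1:])) < card Y"
      by (rule le_less_trans[OF degree_smult_le])
  qed (use assms in auto)
  then have deg: "degree (p - q) < card Y"
    using assms by (intro degree_diff_less)
  have "poly (p - q) y = 0" if "y \<in> Y" for y
  proof -
    have "poly q y = (\<Sum>z\<in>Y. if z = y then poly p y else 0)"
      unfolding q
    proof (intro sum.cong refl)
      fix z assume "z \<in> Y"
      show "poly p z * (\<Prod>y'\<in>Y - {z}. (y - y') / (z - y')) = (if z = y then poly p y else 0)"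
      proof (cases "z = y")
        case False
        then have "(\<Prod>y'\<in>Y - {z}. (y - y') / (z - y')) = 0"
          using assms that by (intro prod_zero) auto
        then show ?thesis using False by simp
      next
        case True
        have "(\<Prod>y'\<in>Y - {z}. (y - y') / (z - y')) = 1"
          using True by (intro prod.neutral) auto
        then show ?thesis using True by simp
      qed
    qed
    then show ?thesis using assms that by simp
  qed
  then have sub: "Y \<subseteq> {x. poly (p - q) x = 0}" by blast
  have "p - q = 0"
  proof (rule ccontr)
    assume ne: "p - q \<noteq> 0"
    then have "card Y \<le> card {x. poly (p - q) x = 0}"
      using sub poly_roots_finite card_mono by blast
    then show False using card_poly_roots_bound[OF ne] deg by linarith
  qed
  then have "poly p x = poly q x" by simp
  then show ?thesis by (simp only: q)
qed

text \<open>Interpolate the monic polynomial with root set \<open>X\<close> at the nodes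
  \<open>Y\<close> and keep the largest of the \<open>card Y\<close> terms; its node is
  \<open>y\<close>. The factor \<open>1 / \<delta>\<close> pays for completing the product over
  \<open>Y - {y}\<close> by \<open>norm (x - y)\<close>. Pairing \<open>x\<close> with
  \<open>y\<close> and removing both is the induction step of the Cauchy inequality.\<close>

lemma cauchy_step:
  fixes x :: complex
  assumes "finite X" "finite Y" "card Y = Suc (card X)" "\<delta> > 0" "\<And>y. y \<in> Y \<Longrightarrow> \<delta> \<le> norm (x - y)"
  shows "\<exists>y\<in>Y. (\<Prod>x'\<in>X. norm (x - x')) * (\<Prod>y'\<in>Y - {y}. norm (y - y'))
     \<le> real (card Y) / \<delta> * ((\<Prod>y'\<in>Y. norm (x - y')) * (\<Prod>x'\<in>X. norm (x' - y)))"
proof -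
  define p where "p = (\<Prod>x'\<in>X. [:- x', 1:])"
  have pp: "norm (poly p z) = (\<Prod>x'\<in>X. norm (z - x'))" for z
    by (simp add: p_def poly_prod prod_norm)
  have "degree p \<le> card X"
    using degree_prod_sum_le[of X "\<lambda>x'. [:- x', 1:]"] assms(1) by (simp add: p_def o_def)
  then have "degree p < card Y" using assms(3) by simp
  define t where "t y = norm (poly p y) * (\<Prod>y'\<in>Y - {y}. norm (x - y') / norm (y - y'))" for y
  have "norm (poly p x) \<le> (\<Sum>y\<in>Y. t y)"
    unfolding lagrange_interpolation_poly[OF \<open>finite Y\<close> \<open>degree p < card Y\<close>, of x] t_def
    by (intro order.trans[OF norm_sum] sum_mono) (simp only: norm_mult norm_divide order.refl flip: prod_norm)
  have "Y \<noteq> {}" using assms(3) by auto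
  then obtain y where y: "y \<in> Y" "\<forall>z\<in>Y. t z \<le> t y"
  proof -
    have "Max (t ` Y) \<in> t ` Y" using \<open>Y \<noteq> {}\<close> assms(2) by (intro Max_in) auto
    then obtain y where "y \<in> Y" "t y = Max (t ` Y)" by auto
    then show ?thesis using assms(2) that by simp
  qed
  then have "(\<Sum>y\<in>Y. t y) \<le> real (card Y) * t y"
    using sum_bounded_above[of Y t "t y"] by simp
  then have 1: "norm (poly p x) \<le> real (card Y) * t y"
    using \<open>norm (poly p x) \<le> (\<Sum>y\<in>Y. t y)\<close> by linarith
  define B where "B = (\<Prod>y'\<in>Y - {y}. norm (y - y'))"
  have "B > 0" unfolding B_def by (intro prod_pos) auto
  define C where "C = (\<Prod>y'\<in>Y - {y}. norm (x - y'))"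
  have "C \<ge> 0" unfolding C_def by (intro prod_nonneg) auto
  have t: "t y = norm (poly p y) * (C / B)"
    by (simp add: t_def B_def C_def prod_dividef)
  have "norm (poly p x) * B \<le> real (card Y) * norm (poly p y) * C"
    using 1 \<open>B > 0\<close> by (simp add: t field_simps)
  also have "C \<le> (\<Prod>y'\<in>Y. norm (x - y')) / \<delta>"
  proof -
    have "(\<Prod>y'\<in>Y. norm (x - y')) = norm (x - y) * C"
      unfolding C_def using y(1) assms(2) by (simp add: prod.remove)
    then show ?thesis
      using assms(4) assms(5)[OF y(1)] \<open>C \<ge> 0\<close> by (simp add: pos_le_divide_eq mult.commute mult_left_mono)
  qed
  finally have "norm (poly p x) * B \<le> real (card Y) * norm (poly p y) * ((\<Prod>y'\<in>Y. norm (x - y')) / \<delta>)"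
    by (simp add: mult_left_mono)
  then show ?thesis
    using y(1) unfolding pp B_def
    by (intro bexI[of _ y]) (simp_all add: mult_ac norm_minus_commute)
qed

text \<open>The classical argument bounds the Cauchy determinant \<open>det (1 / (x - y))\<close> by its Leibniz
  expansion; removing one well-chosen pair of points at a time avoids determinants.\<close>

lemma vdm_mult_le_cross:
  assumes "finite X" "finite Y" "card X = card Y" "\<delta> > 0" "\<And>x y. x \<in> X \<Longrightarrow> y \<in> Y \<Longrightarrow> \<delta> \<le> norm (x - y)"
  shows "vdm X * vdm Y \<le> (fact (card X) / \<delta> ^ card X)^2 * (cross X Y)^2"
  using assms
proof (induction X arbitrary: Y rule: finite_induct)
  case empty
  then show ?case by (simp add: vdm_def cross_def)
next
  case (insert x X)
  have cY: "card Y = Suc (card X)" using insert by simp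
  obtain y where y: "y \<in> Y" and le: "(\<Prod>x'\<in>X. norm (x - x')) * (\<Prod>y'\<in>Y - {y}. norm (y - y'))
     \<le> real (card Y) / \<delta> * ((\<Prod>y'\<in>Y. norm (x - y')) * (\<Prod>x'\<in>X. norm (x' - y)))"
    using cauchy_step[OF insert.hyps(1) insert.prems(1) cY insert.prems(3)] insert.prems(4) by blast
  define Y' where "Y' = Y - {y}"
  have Y': "Y = insert y Y'" "y \<notin> Y'" "finite Y'" "card X = card Y'"
    using y insert cY by (auto simp: Y'_def)
  have IH: "vdm X * vdm Y' \<le> (fact (card X) / \<delta> ^ card X)^2 * (cross X Y')^2"
    using insert.IH[of Y'] Y' insert.prems by auto
  define A where "A = (\<Prod>x'\<in>X. norm (x - x'))"
  define B where "B = (\<Prod>y'\<in>Y'. norm (y - y'))"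
  define C where "C = (\<Prod>y'\<in>Y. norm (x - y')) * (\<Prod>x'\<in>X. norm (x' - y))"
  have nn: "A \<ge> 0" "B \<ge> 0" "C \<ge> 0" unfolding A_def B_def C_def by (auto intro!: prod_nonneg mult_nonneg_nonneg)
  have le': "A * B \<le> real (card Y) / \<delta> * C"
    using le by (simp add: A_def B_def C_def Y'_def)
  have v: "vdm (insert x X) * vdm Y = (vdm X * vdm Y') * (A * B)^2"
    using vdm_insert[OF insert.hyps(1,2)] vdm_insert[OF Y'(3,2)] Y'(1)
    by (simp add: A_def B_def power_mult_distrib)
  have c: "cross (insert x X) Y = cross X Y' * C"
    using insert.hyps Y' by (simp add: cross_def C_def prod.distrib mult_ac)
  have "vdm (insert x X) * vdm Y \<le> ((fact (card X) / \<delta> ^ card X)^2 * (cross X Y')^2) * (real (card Y) / \<delta> * C)^2"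
    unfolding v
  proof (rule mult_mono[OF IH])
    show "(A * B)^2 \<le> (real (card Y) / \<delta> * C)^2"
      using le' nn by (intro power_mono) auto
  qed auto
  also have "\<dots> = ((fact (card X) / \<delta> ^ card X) * (real (card Y) / \<delta>))^2 * (cross X Y' * C)^2"
    by (simp only: power_mult_distrib mult_ac)
  also have "(fact (card X) / \<delta> ^ card X) * (real (card Y) / \<delta>) = fact (card (insert x X)) / \<delta> ^ card (insert x X)"
    using insert.hyps cY by (simp add: mult.commute)
  finally show ?case by (simp only: c)
qed

section \<open>Zeros near the centre of a disc, and moving points to its boundary\<close>

lemma holomorphic_factor_zeros:
  assumes "finite Z" "F holomorphic_on S" "open S" "Z \<subseteq> S" "\<And>z. z \<in> Z \<Longrightarrow> F z = 0"
  shows "\<exists>G. G holomorphic_on S \<and> (\<forall>x\<in>S. F x = (\<Prod>z\<in>Z. x - z) * G x)"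
  using assms
proof (induction Z rule: finite_induct)
  case empty
  then show ?case by auto
next
  case (insert z Z)
  then obtain G where G: "G holomorphic_on S" "\<And>x. x \<in> S \<Longrightarrow> F x = (\<Prod>z\<in>Z. x - z) * G x" by auto
  have "G z = 0"
    using G(2)[of z] insert by auto
  define G' where "G' x = (if x = z then deriv G z else (G x - G z) / (x - z))" for x
  have "G' holomorphic_on S"
    unfolding G'_def[abs_def] by (rule pole_lemma_open[OF G(1) insert.prems(2)])
  moreover have "G x = (x - z) * G' x" for x
    using \<open>G z = 0\<close> by (simp add: G'_def)
  ultimately show ?case
    using insert.hyps G(2) by (intro exI[of _ G']) (auto simp: mult_ac)
qed

text \<open>After division by the zeros the maximum principle applies to the quotient. Each factor
  \<open>x - z\<close> has modulus at most \<open>r / 4\<close> at \<open>\<eta>\<close> and at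
  least \<open>7 * r / 8\<close> on the circle, and the ratio \<open>7 / 2\<close> exceeds
  3.\<close>

lemma zeros_gain:
  assumes F: "F holomorphic_on ball w R" and r: "0 < r" "r < R"
    and Z: "finite Z" "Z \<subseteq> ball w (r / 8)" "\<And>z. z \<in> Z \<Longrightarrow> F z = 0"
    and \<eta>: "\<eta> \<in> ball w (r / 8)"
  shows "\<exists>\<xi>\<in>sphere w r. 3 ^ card Z * norm (F \<eta>) \<le> norm (F \<xi>)"
proof -
  have "Z \<subseteq> ball w R" using Z(2) r by force
  then obtain G where G: "G holomorphic_on ball w R"
      "\<And>x. x \<in> ball w R \<Longrightarrow> F x = (\<Prod>z\<in>Z. x - z) * G x"
    using holomorphic_factor_zeros[OF Z(1) F open_ball] Z(3) by auto
  have sub: "cball w r \<subseteq> ball w R" using r by auto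
  have contG: "continuous_on (cball w r) G"
    using G(1) sub holomorphic_on_imp_continuous_on continuous_on_subset by blast
  have "sphere w r \<noteq> {}" using r by simp
  moreover have "continuous_on (sphere w r) (\<lambda>x. norm (G x))"
    by (intro continuous_on_norm continuous_on_subset[OF contG]) auto
  ultimately obtain \<xi> where \<xi>: "\<xi> \<in> sphere w r" "\<forall>x\<in>sphere w r. norm (G x) \<le> norm (G \<xi>)"
    using continuous_attains_sup[OF compact_sphere] by blast
  have GG: "norm (G \<eta>) \<le> norm (G \<xi>)"
  proof (rule maximum_modulus_frontier[of G "cball w r"])
    show "G holomorphic_on interior (cball w r)"
      using G(1) sub interior_subset holomorphic_on_subset by blast
    show "continuous_on (closure (cball w r)) G" using contG by simp
    show "\<eta> \<in> cball w r" using \<eta> r by auto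
  qed (use \<xi> r in auto)
  have 1: "norm (\<Prod>z\<in>Z. \<eta> - z) \<le> (r / 4) ^ card Z"
  proof -
    have "norm (\<eta> - z) \<le> r / 4" if "z \<in> Z" for z
    proof -
      have "dist w z < r / 8" "dist w \<eta> < r / 8" using that Z(2) \<eta> by auto
      moreover have "dist \<eta> z \<le> dist w \<eta> + dist w z" by (metis dist_commute dist_triangle)
      ultimately show ?thesis by (simp add: dist_norm)
    qed
    then have "(\<Prod>z\<in>Z. norm (\<eta> - z)) \<le> (\<Prod>z\<in>Z. r / 4)"
      by (intro prod_mono) auto
    then show ?thesis by (simp add: prod_norm)
  qed
  have 2: "norm (\<Prod>z\<in>Z. \<xi> - z) \<ge> (7 * r / 8) ^ card Z"
  proof -
    have "norm (\<xi> - z) \<ge> 7 * r / 8" if "z \<in> Z" for z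
    proof -
      have "dist w z < r / 8" "dist w \<xi> = r" using that Z(2) \<xi> by auto
      moreover have "dist w \<xi> \<le> dist w z + dist \<xi> z" by (metis dist_commute dist_triangle)
      ultimately show ?thesis by (simp add: dist_norm)
    qed
    then have "(\<Prod>z\<in>Z. norm (\<xi> - z)) \<ge> (\<Prod>z\<in>Z. 7 * r / 8)"
      using r by (intro prod_mono) auto
    then show ?thesis by (simp add: prod_norm)
  qed
  have "3 ^ card Z * norm (F \<eta>) = 3 ^ card Z * (norm (\<Prod>z\<in>Z. \<eta> - z) * norm (G \<eta>))"
    using G(2)[of \<eta>] \<eta> r by (simp add: norm_mult)
  also have "\<dots> \<le> 3 ^ card Z * ((r / 4) ^ card Z * norm (G \<xi>))"
    using 1 GG r by (intro mult_left_mono mult_mono) auto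
  also have "\<dots> = (3 * (r / 4)) ^ card Z * norm (G \<xi>)"
    by (simp only: power_mult_distrib mult.assoc)
  also have "\<dots> \<le> (7 * r / 8) ^ card Z * norm (G \<xi>)"
    using r by (intro mult_right_mono power_mono) auto
  also have "\<dots> \<le> norm (\<Prod>z\<in>Z. \<xi> - z) * norm (G \<xi>)"
    using 2 by (intro mult_right_mono) auto
  also have "\<dots> = norm (F \<xi>)"
    using G(2)[of \<xi>] \<xi> r by (simp add: norm_mult)
  finally show ?thesis using \<xi>(1) by blast
qed

text \<open>The part of the Cauchy inequality that depends on \<open>Y\<close>: multiplied by
  \<open>vdm X\<close> it stays below \<open>(fact (card X) / \<delta> ^ card X)^2\<close> for
  separated sets of equal size. Enlarging it by moving points of \<open>Y\<close> therefore improves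
  the bound on \<open>vdm X\<close>.\<close>

definition energy_ratio :: "complex set \<Rightarrow> complex set \<Rightarrow> real" where
  "energy_ratio X Y = vdm Y / (cross X Y)^2"

text \<open>The increment is the squared modulus of a function of \<open>y\<close> that is
  holomorphic away from \<open>X\<close>, as the maximum principle needs.\<close>

lemma energy_ratio_insert:
  assumes "finite X" "finite Y" "y \<notin> Y"
  shows "energy_ratio X (insert y Y)
      = energy_ratio X Y * (norm ((\<Prod>y'\<in>Y. y - y') / (\<Prod>x\<in>X. y - x)))^2"
proof -
  have "cross X (insert y Y) = cross X Y * norm (\<Prod>x\<in>X. y - x)"
    using assms by (simp add: cross_def prod.distrib norm_minus_commute mult.commute flip: prod_norm)
  then show ?thesis
    using assms by (simp add: energy_ratio_def vdm_insert norm_divide power_mult_distrib power_divide flip: prod_norm)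
qed

text \<open>The points of one cell are moved to the boundary one at a time; each move is an application of
  the maximum principle to the product of all factors containing that point, and every point of the
  cell that has not been moved yet contributes a zero of that product.\<close>

lemma move_cell:
  assumes s: "s holomorphic_on ball w R" "inj_on s (ball w R)" and r: "0 < r" "r < R"
    and X: "finite X" "X \<inter> s ` ball w R = {}"
    and H: "finite H" "H \<subseteq> ball w (r / 8)" and Y: "finite Y" "s ` H \<inter> Y = {}"
  shows "\<exists>Y'. finite Y' \<and> card Y' = card Y + card H \<and> Y \<subseteq> Y' \<and> Y' \<subseteq> Y \<union> s ` sphere w r \<and>
     3 ^ (card H * (card H - 1)) * energy_ratio X (Y \<union> s ` H) \<le> energy_ratio X Y'"
  using H Y
proof (induction H arbitrary: Y rule: finite_induct)
  case empty
  then show ?case by (intro exI[of _ Y]) auto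
next
  case (insert \<eta> H)
  define Y1 where "Y1 = Y \<union> s ` H"
  \<comment> \<open>All factors of the energy ratio that contain the moving point, up to the square.
    \<open>X\<close> misses the cell, so there are no poles, and the unmoved points of
    \<open>H\<close> are zeros.\<close>
  define F where "F \<xi> = (\<Prod>y\<in>Y1. s \<xi> - y) / (\<Prod>x\<in>X. s \<xi> - x)" for \<xi>
  have finY1: "finite Y1" using insert by (simp add: Y1_def)
  have subR: "insert \<eta> H \<subseteq> ball w R" "sphere w r \<subseteq> ball w R" using insert.prems(1) r by force+
  have "F holomorphic_on ball w R"
    unfolding F_def using X s(1) by (intro holomorphic_intros) auto
  moreover have "F z = 0" if "z \<in> H" for z
    using that finY1 by (force simp: F_def Y1_def)
  ultimately obtain \<xi> where \<xi>: "\<xi> \<in> sphere w r" "3 ^ card H * norm (F \<eta>) \<le> norm (F \<xi>)"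
    using zeros_gain[of F w R r H \<eta>] r insert.prems(1) insert.hyps(1) by auto
  have \<eta>Y1: "s \<eta> \<notin> Y1"
    using insert.prems(3) insert.hyps(2) subR s(2) by (force simp: Y1_def inj_on_def)
  have "(\<Prod>x\<in>X. s \<eta> - x) \<noteq> 0" using X subR by auto
  moreover have "(\<Prod>y\<in>Y1. s \<eta> - y) \<noteq> 0" using finY1 \<eta>Y1 by auto
  ultimately have "F \<eta> \<noteq> 0" by (simp add: F_def)
  then have "norm (F \<xi>) > 0" using \<xi>(2) by (smt (verit) mult_pos_pos zero_less_norm_iff zero_less_power)
  then have \<xi>Y1: "s \<xi> \<notin> Y1" using finY1 by (auto simp: F_def)
  have sq: "9 ^ card H * (norm (F \<eta>))^2 \<le> (norm (F \<xi>))^2"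
  proof -
    have "(3 ^ card H * norm (F \<eta>))^2 \<le> (norm (F \<xi>))^2" using \<xi>(2) by (intro power_mono) auto
    moreover have "((3::real) ^ card H)^2 = 9 ^ card H"
      by (simp add: power2_eq_square flip: power_mult_distrib)
    ultimately show ?thesis by (simp add: power_mult_distrib)
  qed
  have er: "9 ^ card H * energy_ratio X (insert (s \<eta>) Y1) \<le> energy_ratio X (insert (s \<xi>) Y1)"
  proof -
    have "energy_ratio X Y1 \<ge> 0" by (simp add: energy_ratio_def vdm_nonneg)
    from mult_left_mono[OF sq this] show ?thesis
      by (simp only: energy_ratio_insert[OF X(1) finY1 \<eta>Y1] energy_ratio_insert[OF X(1) finY1 \<xi>Y1]
          F_def[symmetric] mult_ac)
  qed
  define Y2 where "Y2 = insert (s \<xi>) Y"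
  have "s ` H \<inter> Y2 = {}" using insert.prems(3) \<xi>Y1 by (auto simp: Y1_def Y2_def)
  then obtain Y' where Y': "finite Y'" "card Y' = card Y2 + card H" "Y2 \<subseteq> Y'" "Y' \<subseteq> Y2 \<union> s ` sphere w r"
      "3 ^ (card H * (card H - 1)) * energy_ratio X (Y2 \<union> s ` H) \<le> energy_ratio X Y'"
    using insert.IH[of Y2] insert.prems by (auto simp: Y2_def)
  have "card Y2 = Suc (card Y)" using \<xi>Y1 insert.prems by (simp add: Y2_def Y1_def)
  \<comment> \<open>The point moved here passes \<open>card H\<close> zeros and gains
    \<open>9 ^ card H\<close>, the square of \<open>3 ^ card H\<close>; adding the exponents over
    all points gives \<open>h * (h - 1)\<close> for \<open>h\<close> points.\<close>
  have pw: "(3::real) ^ (card (insert \<eta> H) * (card (insert \<eta> H) - 1)) = 3 ^ (card H * (card H - 1)) * 9 ^ card H"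
  proof -
    have "Suc (card H) * card H = card H * (card H - 1) + 2 * card H" by (cases "card H") auto
    then have "(3::real) ^ (Suc (card H) * card H) = 3 ^ (card H * (card H - 1)) * (3 ^ 2) ^ card H"
      by (simp only: power_add power_mult)
    then show ?thesis using insert.hyps by simp
  qed
  have "3 ^ (card (insert \<eta> H) * (card (insert \<eta> H) - 1)) * energy_ratio X (Y \<union> s ` insert \<eta> H)
      = 3 ^ (card H * (card H - 1)) * (9 ^ card H * energy_ratio X (insert (s \<eta>) Y1))"
    unfolding pw by (simp add: Y1_def)
  also have "\<dots> \<le> 3 ^ (card H * (card H - 1)) * energy_ratio X (insert (s \<xi>) Y1)"
    using er by (intro mult_left_mono) auto
  also have "insert (s \<xi>) Y1 = Y2 \<union> s ` H" by (auto simp: Y1_def Y2_def)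
  finally have "3 ^ (card (insert \<eta> H) * (card (insert \<eta> H) - 1)) * energy_ratio X (Y \<union> s ` insert \<eta> H)
      \<le> energy_ratio X Y'" using Y'(5) by linarith
  then show ?case
    using Y' \<xi>(1) \<open>card Y2 = Suc (card Y)\<close> insert.hyps
    by (intro exI[of _ Y']) (auto simp: Y2_def)
qed

text \<open>Cells are treated one after another. The clause that \<open>Y\<close> minus the treated
  points survives in \<open>Y'\<close> ensures, by disjointness, that the points of an untreated
  cell are still in place when its turn comes.\<close>

lemma move_cells:
  assumes I: "finite I" and s: "\<And>i. i \<in> I \<Longrightarrow> s i holomorphic_on ball w R" "\<And>i. i \<in> I \<Longrightarrow> inj_on (s i) (ball w R)"
    and disj: "\<And>i j. i \<in> I \<Longrightarrow> j \<in> I \<Longrightarrow> i \<noteq> j \<Longrightarrow> s i ` ball w R \<inter> s j ` ball w R = {}"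
    and r: "0 < r" "r < R"
    and X: "finite X" "\<And>i. i \<in> I \<Longrightarrow> X \<inter> s i ` ball w R = {}"
    and H: "finite H" "H \<subseteq> ball w (r / 8)" and Y: "finite Y" "\<And>i. i \<in> I \<Longrightarrow> s i ` H \<subseteq> Y"
  shows "\<exists>Y'. finite Y' \<and> card Y' = card Y \<and> Y - (\<Union>i\<in>I. s i ` H) \<subseteq> Y' \<and>
     Y' \<subseteq> Y \<union> (\<Union>i\<in>I. s i ` sphere w r) \<and>
     3 ^ (card I * (card H * (card H - 1))) * energy_ratio X Y \<le> energy_ratio X Y'"
  using I s disj X(2) Y(2)
proof (induction I rule: finite_induct)
  case empty
  then show ?case using Y by (intro exI[of _ Y]) auto
next
  case (insert j I)
  obtain Y1 where Y1: "finite Y1" "card Y1 = card Y" "Y - (\<Union>i\<in>I. s i ` H) \<subseteq> Y1"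
      "Y1 \<subseteq> Y \<union> (\<Union>i\<in>I. s i ` sphere w r)"
      "3 ^ (card I * (card H * (card H - 1))) * energy_ratio X Y \<le> energy_ratio X Y1"
  proof -
    have "\<exists>Y'. finite Y' \<and> card Y' = card Y \<and> Y - (\<Union>i\<in>I. s i ` H) \<subseteq> Y' \<and>
       Y' \<subseteq> Y \<union> (\<Union>i\<in>I. s i ` sphere w r) \<and>
       3 ^ (card I * (card H * (card H - 1))) * energy_ratio X Y \<le> energy_ratio X Y'"
      by (rule insert.IH; rule insert.prems; (assumption | rule insertI2)+)
    then show ?thesis by (elim exE conjE) (rule that)
  qed
  have HR: "H \<subseteq> ball w R" using H(2) r by force
  have "s j ` H \<subseteq> s j ` ball w R" "\<And>i. i \<in> I \<Longrightarrow> s i ` H \<subseteq> s i ` ball w R" using HR by auto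
  moreover have "s i ` ball w R \<inter> s j ` ball w R = {}" if "i \<in> I" for i
    using insert.prems(3)[of i j] insert.hyps(2) that by auto
  ultimately have dj: "s j ` H \<inter> (\<Union>i\<in>I. s i ` H) = {}" by blast
  have sjY: "s j ` H \<subseteq> Y" using insert.prems(5) by auto
  then have sjY1: "s j ` H \<subseteq> Y1" using Y1(3) dj by blast
  have injH: "inj_on (s j) H" using insert.prems(2)[of j] HR inj_on_subset by blast
  obtain Y' where Y': "finite Y'" "card Y' = card (Y1 - s j ` H) + card H" "Y1 - s j ` H \<subseteq> Y'"
      "Y' \<subseteq> (Y1 - s j ` H) \<union> s j ` sphere w r"
      "3 ^ (card H * (card H - 1)) * energy_ratio X ((Y1 - s j ` H) \<union> s j ` H) \<le> energy_ratio X Y'"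
    using move_cell[of "s j" w R r X H "Y1 - s j ` H"] insert.prems(1,2,4) r X(1) H Y1(1) by auto
  have "card (Y1 - s j ` H) + card H = card Y1"
    using sjY1 Y1(1) injH by (metis card_Diff_subset card_image card_mono finite_imageI H(1) le_add_diff_inverse2)
  moreover have "(Y1 - s j ` H) \<union> s j ` H = Y1" using sjY1 by auto
  moreover have "3 ^ (card (insert j I) * (card H * (card H - 1))) * energy_ratio X Y \<le> energy_ratio X Y'"
  proof -
    have "3 ^ (card (insert j I) * (card H * (card H - 1))) * energy_ratio X Y
       = 3 ^ (card H * (card H - 1)) * (3 ^ (card I * (card H * (card H - 1))) * energy_ratio X Y)"
      using insert.hyps by (simp add: power_add)
    also have "\<dots> \<le> 3 ^ (card H * (card H - 1)) * energy_ratio X Y1"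
      using Y1(5) by (intro mult_left_mono) auto
    also have "\<dots> \<le> energy_ratio X Y'" using Y'(5) \<open>(Y1 - s j ` H) \<union> s j ` H = Y1\<close> by simp
    finally show ?thesis .
  qed
  ultimately show ?case
    using Y' Y1 by (intro exI[of _ Y']) auto
qed

text \<open>Cauchy's inequality is applied to the displaced set, and the gain is then expressed
  through the original \<open>Y\<close>. The separation \<open>\<delta>\<close> is demanded on the
  circles as well because the displaced points land there.\<close>

lemma vdm_bound_cells:
  assumes I: "finite I" and s: "\<And>i. i \<in> I \<Longrightarrow> s i holomorphic_on ball w R" "\<And>i. i \<in> I \<Longrightarrow> inj_on (s i) (ball w R)"
    and disj: "\<And>i j. i \<in> I \<Longrightarrow> j \<in> I \<Longrightarrow> i \<noteq> j \<Longrightarrow> s i ` ball w R \<inter> s j ` ball w R = {}"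
    and r: "0 < r" "r < R"
    and X: "finite X" "\<And>i. i \<in> I \<Longrightarrow> X \<inter> s i ` ball w R = {}"
    and H: "finite H" "H \<subseteq> ball w (r / 8)" and Y: "finite Y" "\<And>i. i \<in> I \<Longrightarrow> s i ` H \<subseteq> Y"
    and card: "card X = card Y" and \<delta>: "\<delta> > 0" "\<And>x y. x \<in> X \<Longrightarrow> y \<in> Y \<Longrightarrow> \<delta> \<le> norm (x - y)"
      "\<And>x i \<xi>. x \<in> X \<Longrightarrow> i \<in> I \<Longrightarrow> \<xi> \<in> sphere w r \<Longrightarrow> \<delta> \<le> norm (x - s i \<xi>)"
  shows "vdm X * 3 ^ (card I * (card H * (card H - 1))) * vdm Y
     \<le> (fact (card X) / \<delta> ^ card X)^2 * (cross X Y)^2"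
proof -
  obtain Y' where Y': "finite Y'" "card Y' = card Y" "Y' \<subseteq> Y \<union> (\<Union>i\<in>I. s i ` sphere w r)"
     "3 ^ (card I * (card H * (card H - 1))) * energy_ratio X Y \<le> energy_ratio X Y'"
    using move_cells[of I s w R r X H Y] assms by blast
  have "\<delta> \<le> norm (x - y)" if "x \<in> X" "y \<in> Y'" for x y
    using that Y'(3) \<delta> by blast
  then have le: "vdm X * vdm Y' \<le> (fact (card X) / \<delta> ^ card X)^2 * (cross X Y')^2"
    using vdm_mult_le_cross[of X Y' \<delta>] X(1) Y' card \<delta>(1) by simp
  have pos: "cross X Z > 0" if "\<And>x z. x \<in> X \<Longrightarrow> z \<in> Z \<Longrightarrow> \<delta> \<le> norm (x - z)" for Z
    unfolding cross_def using that \<delta>(1) by (intro prod_pos) (smt (verit))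
  have p1: "cross X Y' > 0" "cross X Y > 0"
    using pos \<delta>(2) \<open>\<And>y x. x \<in> X \<Longrightarrow> y \<in> Y' \<Longrightarrow> \<delta> \<le> norm (x - y)\<close> by blast+
  have "vdm X * (3 ^ (card I * (card H * (card H - 1))) * energy_ratio X Y) \<le> vdm X * energy_ratio X Y'"
    using Y'(4) vdm_nonneg by (intro mult_left_mono) auto
  also have "\<dots> \<le> (fact (card X) / \<delta> ^ card X)^2"
    using le p1 by (simp add: energy_ratio_def field_simps)
  finally have "vdm X * 3 ^ (card I * (card H * (card H - 1))) * vdm Y / (cross X Y)^2
      \<le> (fact (card X) / \<delta> ^ card X)^2"
    by (simp add: energy_ratio_def mult.assoc)
  then show ?thesis using p1 by (simp add: pos_divide_le_eq)
qed

section \<open>Polynomials as coverings\<close>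

lemma card_simple_fibre:
  fixes g :: "complex poly"
  assumes "degree g > 0" "\<And>z. poly g z = u \<Longrightarrow> poly (pderiv g) z \<noteq> 0"
  shows "finite {z. poly g z = u}" "card {z. poly g z = u} = degree g"
    "smult (lead_coeff g) (\<Prod>z | poly g z = u. [:- z, 1:]) = g - [:u:]"
proof -
  define p where "p = g - [:u:]"
  have dp: "degree p = degree g"
    unfolding p_def using assms(1) by (metis degree_add_eq_left degree_pCons_0 diff_conv_add_uminus degree_minus)
  have lp: "lead_coeff p = lead_coeff g"
    using dp assms(1) unfolding p_def by (auto simp: coeff_pCons split: nat.splits)
  have roots: "{z. poly p z = 0} = {z. poly g z = u}" by (auto simp: p_def)
  have p0: "p \<noteq> 0" using dp assms(1) by auto
  show fin: "finite {z. poly g z = u}" using poly_roots_finite[OF p0] roots by simp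
  have pd: "pderiv p = pderiv g" by (simp add: p_def pderiv_diff pderiv_pCons)
  have "rsquarefree p" using assms(2) unfolding rsquarefree_roots pd by (auto simp: p_def)
  then have dec: "smult (lead_coeff p) (\<Prod>z | poly g z = u. [:- z, 1:]) = p"
    using complex_poly_decompose_rsquarefree roots by metis
  then show "smult (lead_coeff g) (\<Prod>z | poly g z = u. [:- z, 1:]) = g - [:u:]"
    using lp by (simp add: p_def)
  have "degree p = degree (\<Prod>z | poly g z = u. [:- z, 1:])"
    by (subst dec[symmetric]) (use p0 in simp)
  also have "\<dots> = card {z. poly g z = u}"
    by (subst degree_prod_sum_eq) auto
  finally show "card {z. poly g z = u} = degree g" using dp by simp
qed

lemma poly_surj:
  fixes g :: "complex poly"
  assumes "degree g > 0"
  shows "\<exists>z. poly g z = u"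
proof -
  have "degree (g - [:u:]) = degree g"
    using assms by (metis degree_add_eq_left degree_pCons_0 diff_conv_add_uminus degree_minus)
  then have "\<not> constant (poly (g - [:u:]))" using assms by (simp add: constant_degree)
  then obtain z where "poly (g - [:u:]) z = 0" using fundamental_theorem_of_algebra by blast
  then show ?thesis by (intro exI[of _ z]) simp
qed

lemma finite_fibre:
  fixes g :: "complex poly"
  assumes "degree g > 0"
  shows "finite {z. poly g z = u}" "card {z. poly g z = u} \<le> degree g"
proof -
  have *: "g - [:u:] \<noteq> 0" using assms by auto
  have "degree (g - [:u:]) \<le> degree g" by (rule degree_diff_le) auto
  moreover have "{z. poly (g - [:u:]) z = 0} = {z. poly g z = u}" by auto
  ultimately show "finite {z. poly g z = u}" "card {z. poly g z = u} \<le> degree g"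
    using poly_roots_finite[OF *] card_poly_roots_bound[OF *] by auto
qed

lemma open_poly_vimage: "open U \<Longrightarrow> open (poly g -` U)" for g :: "complex poly"
  by (intro open_vimage) (auto intro!: continuous_intros)

lemma poly_holomorphic: "poly g holomorphic_on S" for g :: "complex poly"
  unfolding holomorphic_on_def field_differentiable_def
  by (meson has_field_derivative_at_within poly_DERIV)

lemma deriv_poly: "deriv (poly g) z = poly (pderiv g) z" for g :: "complex poly"
  by (simp add: DERIV_imp_deriv poly_DERIV)

text \<open>Around the \<open>degree g\<close> preimages of \<open>u\<close> choose disjoint balls
  on which \<open>g\<close> is injective. A value in all their images has one preimage in each ball
  and, by the degree bound, no others, so the balls exhaust its fibre.\<close>

lemma poly_covering_space:
  fixes g :: "complex poly"
  assumes deg: "degree g > 0" and U: "open U" and nc: "\<And>z. poly g z \<in> U \<Longrightarrow> poly (pderiv g) z \<noteq> 0"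
  shows "covering_space (poly g -` U) (poly g) U"
proof
  show "continuous_on (poly g -` U) (poly g)" by (intro continuous_intros)
  show "poly g ` (poly g -` U) = U" using poly_surj[OF deg] by (auto simp: image_iff) metis
  fix u assume u: "u \<in> U"
  define Z where "Z = {z. poly g z = u}"
  have Z: "finite Z" "card Z = degree g"
    using card_simple_fibre[OF deg] nc u unfolding Z_def by auto
  have "\<forall>z\<in>Z. \<exists>r>0. inj_on (poly g) (ball z r)"
  proof
    fix z assume "z \<in> Z"
    then have "deriv (poly g) z \<noteq> 0" using nc u by (simp add: deriv_poly Z_def)
    then obtain r where "r > 0" "inj_on (poly g) (ball z r)"
      using has_complex_derivative_locally_injective[OF poly_holomorphic UNIV_I open_UNIV] by blast
    then show "\<exists>r>0. inj_on (poly g) (ball z r)" by blast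
  qed
  then obtain r where r: "\<And>z. z \<in> Z \<Longrightarrow> r z > 0" "\<And>z. z \<in> Z \<Longrightarrow> inj_on (poly g) (ball z (r z))" by metis
  \<comment> \<open>The element 1 keeps the minimum defined when the fibre is a single
    point.\<close>
  define e0 where "e0 = Min (insert 1 ((\<lambda>(z, z'). dist z z') ` {(z, z') \<in> Z \<times> Z. z \<noteq> z'}))"
  have "finite {(z, z') \<in> Z \<times> Z. z \<noteq> z'}" using Z(1) by (auto intro: finite_subset[of _ "Z \<times> Z"])
  then have e0: "e0 > 0" "\<And>z z'. z \<in> Z \<Longrightarrow> z' \<in> Z \<Longrightarrow> z \<noteq> z' \<Longrightarrow> e0 \<le> dist z z'"
    unfolding e0_def by (auto intro!: Min_le image_eqI[where x="(_, _)"])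
  have ne: "Z \<noteq> {}" using Z deg by auto
  define e where "e = Min (insert (e0 / 2) (r ` Z))"
  have e: "e > 0" "\<And>z. z \<in> Z \<Longrightarrow> e \<le> r z"
    using e0(1) r(1) Z(1) unfolding e_def by auto
  have ee: "e \<le> e0 / 2"
    using Z(1) unfolding e_def by (intro Min_le) auto
  have inj: "inj_on (poly g) (ball z e)" if "z \<in> Z" for z
    using r(2)[OF that] e(2)[OF that] by (meson inj_on_subset subset_ball)
  have disj: "ball z e \<inter> ball z' e = {}" if "z \<in> Z" "z' \<in> Z" "z \<noteq> z'" for z z'
    using e0(2)[OF that] ee by (intro disjoint_ballI) auto
  define T where "T = U \<inter> (\<Inter>z\<in>Z. poly g ` ball z e)"
  have opT: "open T"
    unfolding T_def using U Z(1) inj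
    by (intro open_Int open_INT ballI open_mapping_thm3) (auto intro!: holomorphic_intros)
  define v where "v = (\<lambda>z. ball z e \<inter> poly g -` T) ` Z"
  have un: "\<Union>v = poly g -` T"
  proof
    show "poly g -` T \<subseteq> \<Union>v"
    proof
      fix x assume x: "x \<in> poly g -` T"
      have "\<forall>z\<in>Z. \<exists>y\<in>ball z e. poly g y = poly g x"
      proof
        fix z assume "z \<in> Z"
        then have "poly g x \<in> poly g ` ball z e" using x unfolding T_def by blast
        then show "\<exists>y\<in>ball z e. poly g y = poly g x" by (metis imageE)
      qed
      then obtain y where y: "\<And>z. z \<in> Z \<Longrightarrow> y z \<in> ball z e" "\<And>z. z \<in> Z \<Longrightarrow> poly g (y z) = poly g x" by metis
      have "inj_on y Z" using y(1) disj by (fastforce simp: inj_on_def)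
      then have "card (y ` Z) = degree g" using Z by (simp add: card_image)
      moreover have "y ` Z \<subseteq> {z. poly g z = poly g x}" using y(2) by auto
      ultimately have "y ` Z = {z. poly g z = poly g x}"
        using finite_fibre[OF deg, of "poly g x"] by (intro card_seteq) auto
      then have "x \<in> y ` Z" by simp
      then obtain z where "z \<in> Z" "y z = x" by blast
      then show "x \<in> \<Union>v" using y(1) x by (auto simp: v_def)
    qed
  qed (auto simp: v_def)
  show "\<exists>T. u \<in> T \<and> openin (top_of_set U) T \<and>
          (\<exists>v. \<Union>v = (poly g -` U) \<inter> poly g -` T \<and> (\<forall>w\<in>v. openin (top_of_set (poly g -` U)) w) \<and>
             pairwise disjnt v \<and> (\<forall>w\<in>v. \<exists>q. homeomorphism w T (poly g) q))"
  proof (intro exI[of _ T] conjI exI[of _ v])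
    show "u \<in> T" using u e(1) by (auto simp: T_def Z_def image_iff intro!: bexI)
    show "openin (top_of_set U) T" using opT by (simp add: T_def openin_open_eq U)
    show "\<Union>v = (poly g -` U) \<inter> poly g -` T" unfolding un by (auto simp: T_def)
    show "\<forall>w\<in>v. openin (top_of_set (poly g -` U)) w"
    proof
      fix w assume "w \<in> v"
      then have "open w" using open_poly_vimage[OF opT, of g] by (auto simp: v_def)
      moreover have "w \<subseteq> poly g -` U" using \<open>w \<in> v\<close> by (auto simp: v_def T_def)
      ultimately show "openin (top_of_set (poly g -` U)) w"
        by (simp add: openin_open_eq U open_poly_vimage)
    qed
    show "pairwise disjnt v" using disj by (fastforce simp: v_def pairwise_def disjnt_def)
    show "\<forall>w\<in>v. \<exists>q. homeomorphism w T (poly g) q"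
    proof
      fix w assume "w \<in> v"
      then obtain z where z: "z \<in> Z" "w = ball z e \<inter> poly g -` T" by (auto simp: v_def)
      have opw: "open w" using open_poly_vimage[OF opT, of g] z(2) by auto
      have injw: "inj_on (poly g) w" using inj[OF z(1)] z(2) inj_on_subset by blast
      have "poly g ` w = T"
      proof
        show "T \<subseteq> poly g ` w"
        proof
          fix t assume t: "t \<in> T"
          then have "t \<in> poly g ` ball z e" using z(1) unfolding T_def by blast
          then show "t \<in> poly g ` w" using t z(2) by blast
        qed
      qed (use z in blast)
      moreover obtain q where "homeomorphism w (poly g ` w) (poly g) q"
        by (rule invariance_of_domain_homeomorphism[OF opw _ _ injw]) (auto intro!: continuous_intros)
      ultimately show "\<exists>q. homeomorphism w T (poly g) q" by blast
    qed
  qed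
qed

lemma poly_lift_unique:
  fixes g :: "complex poly" and a :: "'a::topological_space"
  assumes nc: "degree g > 0" "open U" "\<And>z. poly g z \<in> U \<Longrightarrow> poly (pderiv g) z \<noteq> 0"
    and "connected T" "continuous_on T h1" "continuous_on T h2"
    and "\<And>x. x \<in> T \<Longrightarrow> poly g (h1 x) = poly g (h2 x)" "\<And>x. x \<in> T \<Longrightarrow> poly g (h1 x) \<in> U"
    and "a \<in> T" "h1 a = h2 a" "x \<in> T"
  shows "h1 x = h2 x"
proof (rule covering_space_lift_unique[OF poly_covering_space[OF nc], of h1 a h2 T "\<lambda>x. poly g (h1 x)"])
  show "continuous_on T (\<lambda>x. poly g (h1 x))" using assms by (intro continuous_intros)
  show "h2 \<in> T \<rightarrow> poly g -` U"
  proof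
    fix x assume "x \<in> T"
    then show "h2 x \<in> poly g -` U" using assms(7)[of x] assms(8)[of x] by simp
  qed
qed (use assms in auto)

text \<open>The section is the lift of the identity of \<open>U\<close> through the
  covering.\<close>

lemma poly_section:
  fixes g :: "complex poly"
  assumes nc: "degree g > 0" "open U" "\<And>z. poly g z \<in> U \<Longrightarrow> poly (pderiv g) z \<noteq> 0"
    and sc: "simply_connected U" and y: "poly g y \<in> U"
  obtains s where "s holomorphic_on U" "s (poly g y) = y" "\<And>u. u \<in> U \<Longrightarrow> poly g (s u) = u"
    "inj_on s U" "open (s ` U)" "connected (s ` U)"
proof -
  obtain s where s: "continuous_on U s" "s \<in> U \<rightarrow> poly g -` U" "s (poly g y) = y" "\<And>u. u \<in> U \<Longrightarrow> poly g (s u) = u"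
  proof (rule covering_space_lift_strong[OF poly_covering_space[OF nc], of y "poly g y" U "\<lambda>x. x"])
    show "locally path_connected U" by (simp add: nc(2) open_imp_locally_path_connected)
  qed (use sc y in auto)
  have hol: "s holomorphic_on U"
    unfolding holomorphic_on_def
  proof
    fix u assume u: "u \<in> U"
    have "(s has_field_derivative inverse (poly (pderiv g) (s u))) (at u)"
    proof (rule has_field_derivative_inverse_basic[OF poly_DERIV _ _ nc(2) u s(4)])
      show "poly (pderiv g) (s u) \<noteq> 0" using nc(3) s(4) u by auto
      show "continuous (at u) s" using s(1) nc(2) u by (simp add: continuous_on_eq_continuous_at)
    qed
    then show "s field_differentiable at u within U"
      using field_differentiable_at_within field_differentiable_def by blast
  qed
  have inj: "inj_on s U" using s(4) by (metis inj_onI)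
  show ?thesis
  proof (rule that[OF hol s(3) s(4) inj])
    show "open (s ` U)" by (rule open_mapping_thm3[OF hol nc(2) inj])
    show "connected (s ` U)" using s(1) sc simply_connected_imp_connected connected_continuous_image by blast
  qed
qed

section \<open>Connectedness of preimages\<close>

lemma poly_preimage_component:
  fixes g :: "complex poly"
  assumes deg: "degree g > 0" and M: "open M" "\<And>z. poly g z \<in> M \<Longrightarrow> poly (pderiv g) z \<noteq> 0"
    and sc: "\<And>C. C \<in> components M \<Longrightarrow> simply_connected C" and Q: "Q \<in> components (poly g -` M)"
  obtains C s where "C \<in> components M" "s holomorphic_on C" "s ` C = Q"
    "\<And>u. u \<in> C \<Longrightarrow> poly g (s u) = u"
proof -
  obtain y where y: "y \<in> Q" using Q in_components_nonempty by blast
  have gy: "poly g y \<in> M" using y Q in_components_subset by blast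
  define C where "C = connected_component_set M (poly g y)"
  have C: "C \<in> components M" "poly g y \<in> C" "C \<subseteq> M" "open C"
    using gy M(1) by (auto simp: C_def components_def connected_component_subset open_connected_component)
  obtain s where s: "s holomorphic_on C" "s (poly g y) = y" "\<And>u. u \<in> C \<Longrightarrow> poly g (s u) = u"
      "connected (s ` C)"
    using poly_section[OF deg C(4) _ sc[OF C(1)] C(2)] M(2) C(3) by (metis subsetD)
  have "s ` C \<subseteq> Q"
  proof (rule components_maximal[OF Q s(4)])
    show "s ` C \<subseteq> poly g -` M" using s(3) C(3) by auto
    show "Q \<inter> s ` C \<noteq> {}" using s(2) C(2) y by (metis IntI empty_iff image_eqI)
  qed
  moreover have "Q \<subseteq> s ` C"
  proof
    fix x assume x: "x \<in> Q"
    have conQ: "connected Q" using Q in_components_connected by blast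
    have "poly g ` Q \<subseteq> C"
    proof (rule components_maximal[OF C(1)])
      show "connected (poly g ` Q)" using conQ by (intro connected_continuous_image continuous_intros)
      show "poly g ` Q \<subseteq> M" using Q in_components_subset by blast
      show "C \<inter> poly g ` Q \<noteq> {}" using C(2) y by auto
    qed
    then have gC: "\<And>x. x \<in> Q \<Longrightarrow> poly g x \<in> C" by auto
    \<comment> \<open>The section composed with \<open>g\<close> and the identity lift the same map
      on \<open>Q\<close> and agree at \<open>y\<close>.\<close>
    have "s (poly g x) = x"
    proof (rule poly_lift_unique[where T=Q and a=y and ?h1.0="\<lambda>x. s (poly g x)" and ?h2.0="\<lambda>x. x", OF deg M])
      show "continuous_on Q (\<lambda>x. s (poly g x))"
        by (rule continuous_on_compose2[OF holomorphic_on_imp_continuous_on[OF s(1)]])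
           (use gC in \<open>auto intro!: continuous_intros\<close>)
      show "poly g (s (poly g z)) \<in> M" if "z \<in> Q" for z using s(3) gC that C(3) by auto
    qed (use conQ s gC y x in auto)
    then show "x \<in> s ` C" using gC[OF x] by (metis image_eqI)
  qed
  ultimately show ?thesis using that[OF C(1) s(1) _ s(3)] by blast
qed

text \<open>A separation of the preimage of \<open>A\<close> would extend to one of the preimage of
  \<open>A \<union> M\<close>. Each component \<open>Q\<close> of the preimage of \<open>M\<close>
  is a copy of a component \<open>C\<close>, and it meets the preimage of \<open>A\<close> in a copy
  of the connected non-empty set \<open>A \<inter> C\<close>; so the whole of \<open>Q\<close> can
  be added to one of the two sides.\<close>

lemma connected_preimage_subset:
  fixes g :: "complex poly"
  assumes deg: "degree g > 0" and M: "open M" "\<And>z. poly g z \<in> M \<Longrightarrow> poly (pderiv g) z \<noteq> 0"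
    and sc: "\<And>C. C \<in> components M \<Longrightarrow> simply_connected C"
    and A: "open A" "\<And>C. C \<in> components M \<Longrightarrow> connected (A \<inter> C) \<and> A \<inter> C \<noteq> {}"
    and con: "connected (poly g -` (A \<union> M))"
  shows "connected (poly g -` A)"
proof (rule connectedI)
  fix E1 E2 assume E: "open E1" "open E2" "E1 \<inter> poly g -` A \<noteq> {}" "E2 \<inter> poly g -` A \<noteq> {}"
    "E1 \<inter> E2 \<inter> poly g -` A = {}" "poly g -` A \<subseteq> E1 \<union> E2"
  define X where "X E = E \<inter> poly g -` A" for E
  have Qc: "connected (Q \<inter> poly g -` A) \<and> Q \<inter> poly g -` A \<noteq> {}" if Q: "Q \<in> components (poly g -` M)" for Q
  proof -
    obtain C s where C: "C \<in> components M" "s holomorphic_on C" "s ` C = Q" "\<And>u. u \<in> C \<Longrightarrow> poly g (s u) = u"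
      using poly_preimage_component[OF deg M sc Q] by metis
    have "Q \<inter> poly g -` A = s ` (A \<inter> C)" using C(3,4) by force
    moreover have "continuous_on (A \<inter> C) s"
      using C(2) holomorphic_on_imp_continuous_on continuous_on_subset by blast
    ultimately show ?thesis using A(2)[OF C(1)] connected_continuous_image by auto
  qed
  define O' where "O' E = X E \<union> \<Union>{Q \<in> components (poly g -` M). Q \<inter> X E \<noteq> {}}" for E
  have opQ: "open Q" if "Q \<in> components (poly g -` M)" for Q
    using that open_components open_poly_vimage[OF M(1)] by blast
  have opO: "open (O' E)" if "open E" for E
    unfolding O'_def X_def using that opQ A(1) open_poly_vimage by (intro open_Un open_Union open_Int) auto
  have one: "Q \<inter> X E1 = {} \<or> Q \<inter> X E2 = {}" if Q: "Q \<in> components (poly g -` M)" for Q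
  proof (rule ccontr)
    assume "\<not> ?thesis"
    then have "E1 \<inter> (Q \<inter> poly g -` A) \<noteq> {}" "E2 \<inter> (Q \<inter> poly g -` A) \<noteq> {}" by (auto simp: X_def)
    moreover have "E1 \<inter> E2 \<inter> (Q \<inter> poly g -` A) = {}" "Q \<inter> poly g -` A \<subseteq> E1 \<union> E2" using E by auto
    ultimately show False using Qc[OF Q] E(1,2) connectedD[of "Q \<inter> poly g -` A" E1 E2] by blast
  qed
  have "O' E1 \<inter> O' E2 = {}"
  proof -
    have "X E1 \<inter> X E2 = {}" using E by (auto simp: X_def)
    moreover have "x \<notin> O' E2" if "x \<in> Q" "Q \<in> components (poly g -` M)" "Q \<inter> X E1 \<noteq> {}" for x Q
      using that one[OF that(2)] components_eq[of Q "poly g -` M"] by (fastforce simp: O'_def)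
    moreover have "x \<notin> O' E1" if "x \<in> Q" "Q \<in> components (poly g -` M)" "Q \<inter> X E2 \<noteq> {}" for x Q
      using that one[OF that(2)] components_eq[of Q "poly g -` M"] by (fastforce simp: O'_def)
    ultimately show ?thesis unfolding O'_def by blast
  qed
  moreover have "poly g -` (A \<union> M) \<subseteq> O' E1 \<union> O' E2"
  proof
    fix x assume "x \<in> poly g -` (A \<union> M)"
    then consider "x \<in> poly g -` A" | "x \<in> poly g -` M" by auto
    then show "x \<in> O' E1 \<union> O' E2"
    proof cases
      case 1
      then show ?thesis using E(6) by (auto simp: O'_def X_def)
    next
      case 2
      then obtain Q where Q: "Q \<in> components (poly g -` M)" "x \<in> Q" by (metis Union_components UnionE)
      then have "Q \<inter> X E1 \<noteq> {} \<or> Q \<inter> X E2 \<noteq> {}" using Qc[OF Q(1)] E(6) by (auto simp: X_def)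
      then show ?thesis using Q by (auto simp: O'_def)
    qed
  qed
  moreover have "O' E1 \<inter> poly g -` (A \<union> M) \<noteq> {}" "O' E2 \<inter> poly g -` (A \<union> M) \<noteq> {}"
    using E(3,4) by (auto simp: O'_def X_def)
  ultimately show False using connectedD[OF con opO[OF E(1)] opO[OF E(2)]] by blast
qed

text \<open>A non-empty simply connected open subset of the plane is homeomorphic to the plane,
  whose unicoherence is carried over.\<close>

lemma open_unicoherent_simply_connected:
  fixes S T :: "complex set"
  assumes "open S" "open T" "connected S" "connected T" "simply_connected (S \<union> T)"
  shows "connected (S \<inter> T)"
proof (cases "S \<union> T = {}")
  case False
  have op: "open (S \<union> T)" using assms by auto
  have "S \<union> T homeomorphic ball (0::complex) 1"
    using simply_connected_eq_homeomorphic_to_disc[OF op] assms(5) False by auto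
  then have "S \<union> T homeomorphic (UNIV :: complex set)"
    using homeomorphic_ball_UNIV[of 1 "0::complex"] homeomorphic_trans by auto
  then obtain h k where hk: "homeomorphism (S \<union> T) (UNIV :: complex set) h k" unfolding homeomorphic_def by auto
  have k: "continuous_on UNIV k" "k ` UNIV = S \<union> T" "\<And>x. k (h x) = x \<or> x \<notin> S \<union> T" "\<And>x. h (k x) = x"
    using hk by (auto simp: homeomorphism_def)
  have h: "continuous_on (S \<union> T) h" using hk by (auto simp: homeomorphism_def)
  have im: "h ` S = k -` S" "h ` T = k -` T"
  proof -
    have "h ` R = k -` R" if "R \<subseteq> S \<union> T" for R
    proof (intro set_eqI iffI)
      fix y assume "y \<in> h ` R"
      then show "y \<in> k -` R" using k(3) that by fastforce
    next
      fix y assume "y \<in> k -` R"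
      then have "y = h (k y)" "k y \<in> R" using k(4) by auto
      then show "y \<in> h ` R" by blast
    qed
    then show "h ` S = k -` S" "h ` T = k -` T" by auto
  qed
  have "connected (h ` S \<inter> h ` T)"
  proof (rule open_unicoherent_UNIV)
    show "open (h ` S)" "open (h ` T)" unfolding im using assms k(1) by (auto intro: open_vimage)
    show "connected (h ` S)" "connected (h ` T)"
      using h assms by (auto intro!: connected_continuous_image elim: continuous_on_subset)
    show "h ` S \<union> h ` T = UNIV" unfolding im using k(2) by auto
  qed
  then have "connected (k ` (h ` S \<inter> h ` T))"
    using k(1) connected_continuous_image continuous_on_subset by blast
  moreover have "k ` (h ` S \<inter> h ` T) = S \<inter> T"
    unfolding im vimage_Int[symmetric] image_vimage_eq k(2) by blast
  ultimately show ?thesis by simp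
qed auto

text \<open>Unicoherence is applied to two open sets, \<open>C\<close> and the union of
  \<open>A\<close> with the remaining components of \<open>M\<close>: they cover
  \<open>A \<union> M\<close> and intersect exactly in \<open>A \<inter> C\<close>.\<close>

lemma connected_Int_component:
  fixes A M :: "complex set"
  assumes A: "open A" "connected A" "A \<noteq> {}" and M: "open M" and sc: "simply_connected (A \<union> M)"
    and C: "C \<in> components M"
  shows "connected (A \<inter> C) \<and> A \<inter> C \<noteq> {}"
proof -
  have con: "connected (A \<union> M)" using sc simply_connected_imp_connected by auto
  have mem: "\<exists>D\<in>components M. x \<in> D" if "x \<in> M" for x
    using that Union_components[of M] by blast
  have sub: "D \<subseteq> M" if "D \<in> components M" for D using that in_components_subset by blast
  have opC: "open C'" if "C' \<in> components M" for C' using that M open_components by blast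
  have ne: "A \<inter> C' \<noteq> {}" if C': "C' \<in> components M" for C'
  proof
    assume emp: "A \<inter> C' = {}"
    define B where "B = A \<union> \<Union>(components M - {C'})"
    have "open B" unfolding B_def using A opC by (intro open_Un open_Union) auto
    moreover have "A \<union> M \<subseteq> C' \<union> B"
      using mem unfolding B_def by blast
    moreover have "C' \<inter> B = {}"
      using emp C' components_nonoverlap[of C' M] by (auto simp: B_def)
    moreover have "C' \<inter> (A \<union> M) \<noteq> {}" using C' in_components_nonempty in_components_subset by blast
    moreover have "B \<inter> (A \<union> M) \<noteq> {}" using A by (auto simp: B_def)
    ultimately show False using connectedD[OF con opC[OF C']] by blast
  qed
  define S where "S = A \<union> \<Union>(components M - {C})"
  \<comment> \<open>The empty set is included so that the family has union \<open>S\<close> even if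
    \<open>M\<close> has no other component.\<close>
  have "S = \<Union>((\<lambda>C'. A \<union> C') ` (insert {} (components M - {C})))" by (auto simp: S_def)
  moreover have "connected \<dots>"
  proof (rule connected_Union)
    show "connected s" if s: "s \<in> (\<lambda>C'. A \<union> C') ` insert {} (components M - {C})" for s
    proof -
      obtain C' where C': "s = A \<union> C'" "C' = {} \<or> C' \<in> components M" using s by blast
      show ?thesis
        using C'(2)
      proof
        assume "C' \<in> components M"
        then show ?thesis
          unfolding C'(1) using A(2) ne in_components_connected by (intro connected_Un) auto
      qed (use C'(1) A(2) in simp)
    qed
    show "\<Inter> ((\<lambda>C'. A \<union> C') ` insert {} (components M - {C})) \<noteq> {}" using A(3) by auto
  qed
  ultimately have conS: "connected S" by simp
  have opS: "open S" unfolding S_def using A opC by (intro open_Un open_Union) auto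
  have un: "S \<union> C = A \<union> M" using C mem sub by (fastforce simp: S_def)
  have "S \<inter> C = A \<inter> C" using C components_nonoverlap[of _ M] by (fastforce simp: S_def)
  then show ?thesis
    using open_unicoherent_simply_connected[OF opS opC[OF C] conS] C in_components_connected sc un ne[OF C] by auto
qed

section \<open>Escape of orbits\<close>

text \<open>Iterates are kept as polynomials too, so that the covering results above apply to
  them.\<close>

fun iter_poly :: "complex poly \<Rightarrow> nat \<Rightarrow> complex poly" where
  "iter_poly f 0 = [:0, 1:]"
| "iter_poly f (Suc n) = pcompose f (iter_poly f n)"

lemma poly_iter_poly: "poly (iter_poly f n) = poly f ^^ n"
  by (induction n) (auto simp: poly_pcompose fun_eq_iff)

lemma degree_iter_poly: "degree (iter_poly f n) = degree f ^ n"
  by (induction n) (auto simp: degree_pcompose)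

lemma pderiv_iter_poly:
  "poly (pderiv (iter_poly f n)) z = (\<Prod>j<n. poly (pderiv f) ((poly f ^^ j) z))"
  by (induction n) (auto simp: pderiv_pcompose poly_pcompose poly_iter_poly pderiv_pCons mult.commute)

lemma iter_poly_add: "(poly f ^^ (m + n)) z = (poly f ^^ m) ((poly f ^^ n) z)"
  by (simp add: funpow_add)

lemma continuous_on_iter: "continuous_on S (poly f ^^ n)" for f :: "complex poly"
proof -
  have "continuous_on S (\<lambda>x. poly (iter_poly f n) x)" by (intro continuous_intros)
  then show ?thesis by (simp add: poly_iter_poly)
qed

lemma open_iter_vimage: "open U \<Longrightarrow> open ((poly f ^^ n) -` U)" for f :: "complex poly"
  using open_poly_vimage[of U "iter_poly f n"] by (simp add: poly_iter_poly)

lemma closed_iter_vimage: "closed U \<Longrightarrow> closed ((poly f ^^ n) -` U)" for f :: "complex poly"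
  using continuous_on_iter[of UNIV n f] by (simp add: closed_vimage)

locale monic_dynamics =
  fixes f :: "complex poly"
  assumes monic: "lead_coeff f = 1" and degree_ge_2: "degree f \<ge> 2"
begin

abbreviation F :: "nat \<Rightarrow> complex \<Rightarrow> complex" where "F n \<equiv> poly f ^^ n"
abbreviation d :: nat where "d \<equiv> degree f"
abbreviation K :: "complex set" where "K \<equiv> filled_julia_set f"
abbreviation J :: "complex set" where "J \<equiv> julia_set f"

lemma lead_coeff_iter_poly: "lead_coeff (iter_poly f n) = 1"
proof (induction n)
  case (Suc n)
  have "degree (iter_poly f n) > 0" using degree_ge_2 by (simp add: degree_iter_poly)
  then show ?case
    using Suc monic by (simp only: iter_poly.simps lead_coeff_comp power_one mult_1)
qed simp

text \<open>In the coordinate \<open>1 / z\<close> the quotient of \<open>f\<close> by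
  \<open>z ^ d\<close> becomes the reversed polynomial, whose value at 0 is the leading coefficient
  1. The lower bound 6 for the radius exceeds \<open>2 * exp 1\<close>, as the height estimate will
  require.\<close>

lemma growth_at_infinity: "\<exists>R\<ge>6. \<forall>z. R \<le> norm z \<longrightarrow> norm z ^ d / 2 \<le> norm (poly f z) \<and> norm (poly f z) \<le> 2 * norm z ^ d"
proof -
  define r where "r = reflect_poly f"
  have "poly r 0 = 1" using monic by (simp add: r_def)
  moreover have "isCont (poly r) 0" by simp
  ultimately obtain \<delta> where \<delta>: "\<delta> > 0" "\<And>x. norm x < \<delta> \<Longrightarrow> norm (poly r x - 1) < 1 / 2"
    unfolding continuous_at_eps_delta by (metis dist_norm diff_zero half_gt_zero zero_less_one)
  define R where "R = max 6 (2 / \<delta>)"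
  have "norm z ^ d / 2 \<le> norm (poly f z) \<and> norm (poly f z) \<le> 2 * norm z ^ d" if z: "R \<le> norm z" for z
  proof -
    have "6 \<le> norm z" using z by (simp add: R_def)
    then have z0: "norm z > 0" by linarith
    have "2 / \<delta> \<le> norm z" using z by (simp add: R_def)
    then have "norm (inverse z) < \<delta>"
    proof -
      assume "2 / \<delta> \<le> norm z"
      then have "2 \<le> \<delta> * norm z" using \<delta>(1) by (simp add: pos_divide_le_eq mult.commute)
      then have "1 < \<delta> * norm z" by linarith
      then have "1 / norm z < \<delta>" by (subst pos_divide_less_eq[OF z0])
      then show ?thesis by (simp add: norm_inverse inverse_eq_divide norm_divide)
    qed
    then have lt: "norm (poly r (inverse z) - 1) < 1 / 2" using \<delta>(2) by blast
    have "norm (poly r (inverse z)) \<le> 2" "norm (poly r (inverse z)) \<ge> 1 / 2"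
      using norm_triangle_ineq2[of "poly r (inverse z)" 1] norm_triangle_ineq3[of "poly r (inverse z)" 1] lt by auto
    moreover have "poly f z = z ^ d * poly r (inverse z)"
      using z0 by (simp add: r_def poly_reflect_poly_nz power_inverse)
    ultimately show ?thesis
      using mult_left_mono[of "norm (poly r (inverse z))" 2 "norm z ^ d"]
        mult_left_mono[of "1/2" "norm (poly r (inverse z))" "norm z ^ d"]
      by (auto simp: norm_mult norm_power)
  qed
  then show ?thesis by (intro exI[of _ R]) (auto simp: R_def)
qed

definition R0 :: real where
  "R0 = (SOME R. R \<ge> 6 \<and> (\<forall>z. R \<le> norm z \<longrightarrow> norm z ^ d / 2 \<le> norm (poly f z) \<and> norm (poly f z) \<le> 2 * norm z ^ d))"

lemma R0: "R0 \<ge> 6" "R0 \<le> norm z \<Longrightarrow> norm z ^ d / 2 \<le> norm (poly f z)" "R0 \<le> norm z \<Longrightarrow> norm (poly f z) \<le> 2 * norm z ^ d"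
proof -
  have *: "6 \<le> R0 \<and> (\<forall>z. R0 \<le> norm z \<longrightarrow> norm z ^ d / 2 \<le> norm (poly f z) \<and> norm (poly f z) \<le> 2 * norm z ^ d)"
    unfolding R0_def by (rule someI_ex[OF growth_at_infinity])
  show "R0 \<ge> 6" using * by blast
  show "norm z ^ d / 2 \<le> norm (poly f z)" if "R0 \<le> norm z" using * that by blast
  show "norm (poly f z) \<le> 2 * norm z ^ d" if "R0 \<le> norm z" using * that by blast
qed

lemma norm_poly_ge_double:
  assumes "R0 \<le> norm z"
  shows "2 * norm z \<le> norm (poly f z)"
proof -
  have "norm z ^ 2 \<le> norm z ^ d" using assms R0(1) degree_ge_2 by (intro power_increasing) auto
  moreover have "4 * norm z \<le> norm z ^ 2"
    unfolding power2_eq_square using assms R0(1) by (intro mult_right_mono) auto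
  ultimately show ?thesis using R0(2)[OF assms] by linarith
qed

lemma norm_iter_ge:
  assumes "R0 \<le> norm z"
  shows "2 ^ n * norm z \<le> norm (F n z)"
proof (induction n)
  case (Suc n)
  have "1 * norm z \<le> 2 ^ n * norm z" by (intro mult_right_mono) auto
  then have "R0 \<le> norm (F n z)" using Suc assms by linarith
  then show ?case using norm_poly_ge_double[of "F n z"] Suc by simp
qed simp

lemma norm_iter_ge_self: "R0 \<le> norm z \<Longrightarrow> norm z \<le> norm (F n z)"
  using norm_iter_ge[of z n] mult_right_mono[of 1 "2 ^ n" "norm z"] by simp

lemma norm_iter_unbounded:
  assumes "R0 \<le> norm (F m z)"
  shows "\<exists>N. \<forall>n\<ge>N. B \<le> norm (F n z)"
proof -
  obtain k where k: "B < 2 ^ k" using real_arch_pow[of 2 B] by auto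
  have "B \<le> norm (F n z)" if "n \<ge> m + k" for n
  proof -
    define j where "j = n - m"
    have j: "n = j + m" "j \<ge> k" using that by (auto simp: j_def)
    have "(2::real) ^ k * 1 \<le> 2 ^ j * norm (F m z)" using j assms R0(1) by (intro mult_mono power_increasing) auto
    then show ?thesis
      using norm_iter_ge[OF assms, of j] k by (simp add: j(1) iter_poly_add)
  qed
  then show ?thesis by blast
qed

lemma mem_K_iff: "z \<in> K \<longleftrightarrow> (\<forall>n. norm (F n z) < R0)"
proof
  assume z: "z \<in> K"
  then obtain B where B: "\<And>n. norm (F n z) \<le> B" by (auto simp: filled_julia_set_def bounded_iff)
  show "\<forall>n. norm (F n z) < R0"
  proof (rule ccontr)
    assume "\<not> ?thesis"
    then obtain m where "R0 \<le> norm (F m z)" by (auto simp: not_less)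
    then obtain N where "\<forall>n\<ge>N. B + 1 \<le> norm (F n z)" using norm_iter_unbounded by blast
    then show False using B[of N] by fastforce
  qed
next
  assume "\<forall>n. norm (F n z) < R0"
  then show "z \<in> K" by (auto simp: filled_julia_set_def bounded_iff intro!: exI[of _ R0] less_imp_le)
qed

lemma iter_mem_K_iff: "F n z \<in> K \<longleftrightarrow> z \<in> K"
proof
  assume "z \<in> K"
  then show "F n z \<in> K" unfolding mem_K_iff by (metis iter_poly_add)
next
  assume *: "F n z \<in> K"
  show "z \<in> K"
  proof (rule ccontr)
    assume "z \<notin> K"
    then obtain m where "R0 \<le> norm (F m z)" unfolding mem_K_iff by (auto simp: not_less)
    then obtain N where "\<forall>k\<ge>N. R0 \<le> norm (F k z)" using norm_iter_unbounded by blast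
    then have "R0 \<le> norm (F (N + n) z)" by simp
    then show False using * unfolding mem_K_iff iter_poly_add by (metis not_le)
  qed
qed

lemma escape: "z \<notin> K \<Longrightarrow> \<exists>N. \<forall>n\<ge>N. B \<le> norm (F n z)"
  using norm_iter_unbounded unfolding mem_K_iff by (meson not_le)

lemma compact_K: "compact K"
proof -
  have "K = (\<Inter>n. F n -` cball 0 R0)"
  proof (intro set_eqI iffI)
    fix z assume "z \<in> (\<Inter>n. F n -` cball 0 R0)"
    then have le: "norm (F n z) \<le> R0" for n by auto
    show "z \<in> K"
    proof (rule ccontr)
      assume "z \<notin> K"
      then obtain N where "\<forall>n\<ge>N. R0 + 1 \<le> norm (F n z)" using escape by blast
      then show False using le[of N] by force
    qed
  qed (auto simp: mem_K_iff less_imp_le)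
  then have "closed K" by (simp add: closed_INT closed_iter_vimage)
  moreover have "bounded K"
  proof -
    have "norm z \<le> R0" if "z \<in> K" for z using that mem_K_iff[of z] by (metis funpow_0 less_imp_le)
    then show ?thesis by (auto simp: bounded_iff)
  qed
  ultimately show ?thesis by (simp add: compact_eq_bounded_closed)
qed

lemma closed_K: "closed K"
  using compact_K compact_imp_closed by blast

lemma K_nonempty: "K \<noteq> {}"
proof -
  have "degree (f + [:0, -1:]) = d"
    using degree_ge_2 by (intro degree_add_eq_left) simp
  then obtain z where "poly (f + [:0, -1:]) z = 0" using poly_surj[of "f + [:0, -1:]" 0] degree_ge_2 by auto
  then have "poly f z = z" by simp
  then have "F n z = z" for n by (induction n) auto
  then have "z \<in> K" by (auto simp: filled_julia_set_def)
  then show ?thesis by blast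
qed

lemma compact_J: "compact J"
  unfolding julia_set_def using compact_K compact_frontier by blast

lemma J_subset_K: "J \<subseteq> K"
  unfolding julia_set_def using closed_K frontier_subset_closed by blast

lemma J_eq: "J = K - interior K"
  unfolding julia_set_def frontier_def using closed_K by simp

lemma J_nonempty: "J \<noteq> {}"
proof -
  have "K \<noteq> UNIV" using compact_K compact_imp_bounded not_bounded_UNIV by metis
  then show ?thesis unfolding julia_set_def using K_nonempty frontier_not_empty by blast
qed

lemma J_near_complement: "w \<in> J \<Longrightarrow> e > 0 \<Longrightarrow> \<exists>w'\<in>ball w e. w' \<notin> K"
  unfolding julia_set_def frontier_straddle by (metis (mono_tags, lifting) dist_commute mem_Collect_eq mem_ball)

lemma degree_iter_pos: "degree (iter_poly f n) > 0"
  using degree_ge_2 by (simp add: degree_iter_poly)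

lemma open_iter_image: "open U \<Longrightarrow> open (F n ` U)"
proof -
  assume U: "open U"
  show ?thesis
  proof (cases "U = {}")
    case False
    have "\<not> poly (iter_poly f n) constant_on UNIV"
    proof
      assume "poly (iter_poly f n) constant_on UNIV"
      then obtain c where c: "\<And>x. poly (iter_poly f n) x = c" by (auto simp: constant_on_def)
      obtain z where "poly (iter_poly f n) z = c + 1" using poly_surj[OF degree_iter_pos] by blast
      then show False using c by simp
    qed
    then have "open (poly (iter_poly f n) ` U)"
      by (intro open_mapping_thm[OF poly_holomorphic open_UNIV connected_UNIV U]) auto
    then show ?thesis by (simp add: poly_iter_poly)
  qed auto
qed

lemma iter_mem_interior_K_iff: "F n z \<in> interior K \<longleftrightarrow> z \<in> interior K"
proof
  assume "F n z \<in> interior K"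
  moreover have "F n -` interior K \<subseteq> K" using interior_subset iter_mem_K_iff by blast
  moreover have "open (F n -` interior K)" by (intro open_iter_vimage open_interior)
  ultimately show "z \<in> interior K" by (metis interior_maximal subsetD vimageI2 vimage_eq)
next
  assume "z \<in> interior K"
  moreover have "open (F n ` interior K)" by (intro open_iter_image open_interior)
  moreover have "F n ` interior K \<subseteq> K" using interior_subset iter_mem_K_iff by blast
  ultimately show "F n z \<in> interior K" by (metis imageI interior_maximal subsetD)
qed

section \<open>Height and escape time\<close>

lemma log_plus_growth:
  assumes "R0 \<le> norm y"
  shows "\<bar>log_plus (norm (poly f y)) - d * log_plus (norm y)\<bar> \<le> ln 2"
proof -
  have y: "norm y \<ge> 6" using assms R0(1) by linarith
  have fy: "norm (poly f y) \<ge> 2 * norm y" by (rule norm_poly_ge_double[OF assms])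
  have "ln (norm (poly f y)) \<le> ln (2 * norm y ^ d)"
    using R0(3)[OF assms] fy y by (subst ln_le_cancel_iff) auto
  moreover have "ln (norm (poly f y)) \<ge> ln (norm y ^ d / 2)"
  proof -
    have "0 < norm y ^ d" using y by (intro zero_less_power) linarith
    then show ?thesis using R0(2)[OF assms] by (subst ln_le_cancel_iff) auto
  qed
  moreover have "ln (2 * norm y ^ d) = ln 2 + d * ln (norm y)" "ln (norm y ^ d / 2) = d * ln (norm y) - ln 2"
    using y by (auto simp: ln_mult ln_div ln_realpow)
  moreover have "max 1 (norm y) = norm y" "max 1 (norm (poly f y)) = norm (poly f y)"
    using y fy by auto
  ultimately show ?thesis by (simp add: log_plus_def)
qed

text \<open>The normalised logarithms telescope. From time \<open>m\<close> on the increments sum to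
  at most \<open>ln 2 / d ^ m\<close> in modulus, while the value at time \<open>m\<close> is at
  least \<open>(1 + ln 2) / d ^ m\<close> because \<open>R0\<close> exceeds
  \<open>2 * exp 1\<close>. The convergence shown on the way justifies evaluating
  \<open>lim\<close>. Read backwards, small height keeps the orbit in the disc for a long
  time.\<close>

lemma local_height_escape:
  assumes "R0 \<le> norm (F m z)"
  shows "1 / real d ^ m \<le> local_height f z"
proof -
  define a where "a n = log_plus (norm (F n z)) / real d ^ n" for n
  have d2: "real d \<ge> 2" using degree_ge_2 by linarith
  have esc: "R0 \<le> norm (F (j + m) z)" for j
    using norm_iter_ge_self[OF assms, of j] assms by (simp add: iter_poly_add)
  have step: "\<bar>a (Suc (j + m)) - a (j + m)\<bar> \<le> (ln 2 / real d ^ Suc m) * (1 / real d) ^ j" for j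
  proof -
    have "a (Suc (j + m)) - a (j + m) = (log_plus (norm (poly f (F (j + m) z))) - d * log_plus (norm (F (j + m) z))) / real d ^ Suc (j + m)"
      using d2 by (simp add: a_def field_simps)
    then have "\<bar>a (Suc (j + m)) - a (j + m)\<bar> \<le> ln 2 / real d ^ Suc (j + m)"
      using log_plus_growth[OF esc[of j]] d2 by (simp add: divide_right_mono)
    then show ?thesis by (simp add: power_add power_divide mult_ac)
  qed
  define b where "b j = a (Suc (j + m)) - a (j + m)" for j
  have geo: "summable (\<lambda>j. (ln 2 / real d ^ Suc m) * (1 / real d) ^ j)"
    using d2 by (intro summable_mult summable_geometric) auto
  have sb: "summable b"
    by (rule summable_comparison_test[OF _ geo]) (use step in \<open>auto simp: b_def\<close>)
  have "(\<lambda>n. \<Sum>j<n. b j) \<longlonglongrightarrow> suminf b" using sb summable_LIMSEQ by blast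
  moreover have "(\<Sum>j<n. b j) = a (n + m) - a m" for n
    unfolding b_def using sum_lessThan_telescope[of "\<lambda>j. a (j + m)" n] by simp
  ultimately have "(\<lambda>n. a (n + m) - a m) \<longlonglongrightarrow> suminf b" by simp
  then have "(\<lambda>n. a (n + m)) \<longlonglongrightarrow> suminf b + a m"
    using tendsto_add[OF _ tendsto_const[of "a m"]] by fastforce
  then have lim: "a \<longlonglongrightarrow> suminf b + a m" using LIMSEQ_offset by blast
  then have lh: "local_height f z = suminf b + a m"
    unfolding local_height_def a_def[symmetric] by (rule limI)
  have "norm (suminf b) \<le> (\<Sum>j. (ln 2 / real d ^ Suc m) * (1 / real d) ^ j)"
    by (rule norm_suminf_le) (use step geo in \<open>auto simp: b_def\<close>)
  also have "\<dots> = (ln 2 / real d ^ Suc m) * (1 / (1 - 1 / real d))"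
    using d2 by (subst suminf_mult) (auto simp: suminf_geometric intro!: summable_geometric)
  also have "\<dots> \<le> (ln 2 / real d ^ Suc m) * 2"
    using d2 by (intro mult_left_mono) (auto simp: field_simps)
  also have "\<dots> \<le> ln 2 / real d ^ m"
    using d2 by (simp add: field_simps mult_right_mono)
  finally have "suminf b \<ge> - (ln 2 / real d ^ m)" by (simp add: abs_le_iff)
  moreover have "a m \<ge> (ln 2 + 1) / real d ^ m"
  proof -
    have "exp 1 * 2 \<le> norm (F m z)" using assms R0(1) e_less_272 by simp
    then have "ln (exp 1 * 2) \<le> ln (norm (F m z))" by (subst ln_le_cancel_iff) (use assms R0(1) in auto)
    then have "1 + ln 2 \<le> log_plus (norm (F m z))" using assms R0(1) by (simp add: log_plus_def ln_mult max_def)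
    then show ?thesis unfolding a_def using d2 by (intro divide_right_mono) auto
  qed
  ultimately show ?thesis unfolding lh by (simp add: add_divide_distrib)
qed

lemma iter_growth_bound:
  "\<exists>B\<ge>1. \<forall>j z. norm z \<le> R0 \<longrightarrow> norm (F j z) \<le> B ^ (d ^ j)"
proof -
  define C where "C = max 1 (\<Sum>i\<le>d. norm (coeff f i))"
  have C1: "C \<ge> 1" by (simp add: C_def)
  have fC: "norm (poly f z) \<le> C * \<rho> ^ d" if "norm z \<le> \<rho>" "\<rho> \<ge> 1" for z \<rho>
  proof -
    have "norm (poly f z) \<le> (\<Sum>i\<le>d. norm (coeff f i) * norm z ^ i)"
      unfolding poly_altdef by (rule order.trans[OF norm_sum]) (simp add: norm_mult norm_power)
    also have "\<dots> \<le> (\<Sum>i\<le>d. norm (coeff f i) * \<rho> ^ d)"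
      using that by (intro sum_mono mult_left_mono order.trans[OF power_mono power_increasing]) auto
    also have "\<dots> \<le> C * \<rho> ^ d"
      unfolding sum_distrib_right[symmetric] C_def using that by (intro mult_right_mono) auto
    finally show ?thesis .
  qed
  define B where "B = C * R0"
  have B: "B \<ge> C" "B \<ge> 1" proof -
    have "C * 1 \<le> C * R0" using C1 R0(1) by (intro mult_left_mono) auto
    then show "B \<ge> C" "B \<ge> 1" unfolding B_def using C1 by linarith+
  qed
  \<comment> \<open>The divisor \<open>C\<close> closes the induction: raising to the power
    \<open>d \<ge> 2\<close> produces enough powers of \<open>1 / C\<close> to absorb the factor
    \<open>C\<close> of the next step.\<close>
  have main: "norm (F j z) \<le> B ^ (d ^ j) / C" if z: "norm z \<le> R0" for j z
  proof (induction j)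
    case 0
    then show ?case using z C1 by (simp add: B_def)
  next
    case (Suc j)
    have "B ^ 1 \<le> B ^ (d ^ j)" using B(2) degree_ge_2 by (intro power_increasing) auto
    then have "B ^ (d ^ j) / C \<ge> 1" using B(1) C1 by (simp add: field_simps)
    then have "norm (F (Suc j) z) \<le> C * (B ^ (d ^ j) / C) ^ d"
      using fC[OF Suc] by simp
    also have "\<dots> = B ^ (d ^ Suc j) * (C / C ^ d)"
      by (simp add: power_divide mult.commute flip: power_mult)
    also have "C / C ^ d \<le> 1 / C"
    proof -
      have "C ^ 2 \<le> C ^ d" using C1 degree_ge_2 by (intro power_increasing) auto
      then show ?thesis using C1 by (simp add: field_simps power2_eq_square)
    qed
    finally show ?case using B(2) by (simp add: mult_left_mono)
  qed
  have "norm (F j z) \<le> B ^ (d ^ j)" if z: "norm z \<le> R0" for j z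
  proof -
    have "B ^ (d ^ j) / C \<le> B ^ (d ^ j) / 1" using C1 B(2) by (intro divide_left_mono) auto
    then show ?thesis using main[OF z, of j] by linarith
  qed
  then show ?thesis using B(2) by blast
qed

end

section \<open>Postcritically finite polynomials\<close>

text \<open>In the derivative of the product over the fibre only the term omitting the factor of
  \<open>p\<close> survives at \<open>p\<close>. Distances inside a fibre are thereby tied to the
  derivative.\<close>

lemma fibre_deriv:
  fixes g :: "complex poly"
  assumes "degree g > 0" "\<And>z. poly g z = u \<Longrightarrow> poly (pderiv g) z \<noteq> 0" and p: "poly g p = u"
  shows "poly (pderiv g) p = lead_coeff g * (\<Prod>q\<in>{z. poly g z = u} - {p}. p - q)"
proof -
  define Z where "Z = {z. poly g z = u}"
  have Z: "finite Z" "smult (lead_coeff g) (\<Prod>z\<in>Z. [:- z, 1:]) = g - [:u:]"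
    using card_simple_fibre(1,3)[OF assms(1,2)] unfolding Z_def by auto
  define q where "q = (\<Prod>z\<in>Z - {p}. [:- z, 1:])"
  have "(\<Prod>z\<in>Z. [:- z, 1:]) = [:- p, 1:] * q"
    unfolding q_def using p Z(1) by (intro prod.remove) (auto simp: Z_def)
  then have "g - [:u:] = smult (lead_coeff g) ([:- p, 1:] * q)" using Z(2) by simp
  moreover have "pderiv (g - [:u:]) = pderiv g" by (simp add: pderiv_diff pderiv_pCons)
  ultimately have "pderiv g = smult (lead_coeff g) (pderiv ([:- p, 1:] * q))"
    by (metis pderiv_smult)
  moreover have "poly (pderiv ([:- p, 1:] * q)) p = poly q p"
    by (simp only: pderiv_mult) (simp add: pderiv_pCons)
  ultimately have "poly (pderiv g) p = lead_coeff g * poly q p" by simp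
  then show ?thesis by (simp add: q_def poly_prod Z_def)
qed

lemma fibre_prod:
  fixes g :: "complex poly"
  assumes "degree g > 0" "\<And>z. poly g z = u \<Longrightarrow> poly (pderiv g) z \<noteq> 0"
  shows "poly g x - u = lead_coeff g * (\<Prod>q | poly g q = u. x - q)"
proof -
  have "poly (g - [:u:]) x = poly (smult (lead_coeff g) (\<Prod>z | poly g z = u. [:- z, 1:])) x"
    using card_simple_fibre(3)[OF assms] by simp
  then show ?thesis by (simp add: poly_prod)
qed

text \<open>Pigeonhole on \<open>N + 1\<close> real points spaced by \<open>1 / N\<close>: a single
  \<open>v\<close> is closer than \<open>1 / (2 * N)\<close> to at most one of them.\<close>

lemma avoid_values:
  fixes V :: "complex set"
  assumes "finite V" "card V \<le> N" "N > 0"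
  shows "\<exists>a::real. R \<le> a \<and> a \<le> R + 1 \<and> (\<forall>v\<in>V. 1 / (2 * real N) \<le> norm (v - of_real a))"
proof (rule ccontr)
  define a where "a j = R + real j / real N" for j :: nat
  assume neg: "\<not> ?thesis"
  have "\<exists>v\<in>V. norm (v - of_real (a j)) < 1 / (2 * real N)" if "j \<le> N" for j
  proof -
    have "R \<le> a j" "a j \<le> R + 1" using that assms(3) by (auto simp: a_def)
    then show ?thesis using neg by (meson not_le)
  qed
  then obtain v where v: "\<And>j. j \<le> N \<Longrightarrow> v j \<in> V" "\<And>j. j \<le> N \<Longrightarrow> norm (v j - of_real (a j)) < 1 / (2 * real N)"
    by metis
  have "inj_on v {..N}"
  proof (rule inj_onI, rule ccontr)
    fix i j assume ij: "i \<in> {..N}" "j \<in> {..N}" "v i = v j" "i \<noteq> j"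
    have "norm (of_real (a i) - of_real (a j) :: complex) \<le> norm (v i - of_real (a i)) + norm (v i - of_real (a j))"
      using norm_triangle_ineq4[of "v i - of_real (a j)" "v i - of_real (a i)"] by (simp add: add.commute)
    also have "\<dots> < 1 / (2 * real N) + 1 / (2 * real N)"
      using v(2)[of i] v(2)[of j] ij by (intro add_strict_mono) auto
    also have "\<dots> = 1 / real N" by simp
    finally have "\<bar>a i - a j\<bar> < 1 / real N"
      by (metis norm_of_real of_real_diff)
    moreover have "a i - a j = (real i - real j) / real N" by (simp add: a_def diff_divide_distrib)
    ultimately have "\<bar>real i - real j\<bar> < 1" using assms(3) by (simp add: abs_divide divide_less_cancel)
    then show False using ij(4) by linarith
  qed
  then have "card {..N} \<le> card V" using v(1) assms(1) by (intro card_inj_on_le) auto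
  then show False using assms(2) by simp
qed

text \<open>Of hyperbolicity the locale retains that critical points are interior to
  \<open>K\<close>. This form passes to iterates, and the locale is used for an iterate as well as
  for \<open>f\<close>.\<close>

locale pcf_dynamics = monic_dynamics +
  assumes crit_interior: "poly (pderiv f) c = 0 \<Longrightarrow> c \<in> interior K"
    and crit_finite: "poly (pderiv f) c = 0 \<Longrightarrow> finite (range (\<lambda>n. F n c))"
begin

text \<open>The index \<open>Suc n\<close> starts the orbits at the critical values, so
  \<open>P\<close> contains the critical values of every iterate.\<close>

definition P :: "complex set" where
  "P = (\<Union>c\<in>{c. poly (pderiv f) c = 0}. range (\<lambda>n. F (Suc n) c))"

lemma pderiv_degree: "degree (pderiv f) > 0"
  using degree_ge_2 by (simp add: degree_pderiv)

lemma finite_P: "finite P"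
proof -
  have "finite {c. poly (pderiv f) c = 0}"
    using pderiv_degree by (intro poly_roots_finite) auto
  moreover have "finite (range (\<lambda>n. F (Suc n) c))" if "poly (pderiv f) c = 0" for c
  proof (rule finite_subset[OF _ crit_finite[OF that]])
    show "range (\<lambda>n. F (Suc n) c) \<subseteq> range (\<lambda>n. F n c)" by blast
  qed
  ultimately show ?thesis unfolding P_def by auto
qed

lemma P_interior: "P \<subseteq> interior K"
  unfolding P_def using crit_interior iter_mem_interior_K_iff by (auto simp del: funpow.simps)

lemma P_nonempty: "P \<noteq> {}"
  unfolding P_def using poly_surj[OF pderiv_degree, of 0] by auto

lemma pderiv_iter_eq_0:
  assumes "poly (pderiv (iter_poly f n)) z = 0"
  shows "F n z \<in> P"
proof -
  obtain j where j: "j < n" "poly (pderiv f) (F j z) = 0"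
    using assms by (auto simp: pderiv_iter_poly)
  have "F n z = F (Suc (n - Suc j)) (F j z)"
    using j(1) by (metis Suc_diff_Suc iter_poly_add less_imp_le le_add_diff_inverse2)
  then show ?thesis unfolding P_def using j(2) by blast
qed

lemma iter_regular:
  assumes "U \<inter> P = {}" "poly (iter_poly f n) z \<in> U"
  shows "poly (pderiv (iter_poly f n)) z \<noteq> 0"
  using pderiv_iter_eq_0[of n z] assms by (auto simp: poly_iter_poly)

lemma notin_K_regular: "u \<notin> interior K \<Longrightarrow> poly (iter_poly f n) z = u \<Longrightarrow> poly (pderiv (iter_poly f n)) z \<noteq> 0"
  using iter_regular[of "{u}" n z] P_interior by auto

lemma deriv_lower_bound: "\<exists>\<eta>>0. \<eta> \<le> 1 \<and> (\<forall>z. norm z \<le> B \<and> z \<notin> interior K \<longrightarrow> \<eta> \<le> norm (poly (pderiv f) z))"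
proof -
  define S where "S = cball 0 B - interior K"
  show ?thesis
  proof (cases "S = {}")
    case True
    then show ?thesis by (intro exI[of _ 1]) (auto simp: S_def)
  next
    case False
    have "compact S" unfolding S_def by (intro compact_diff) auto
    moreover have "continuous_on S (\<lambda>z. norm (poly (pderiv f) z))" by (intro continuous_intros)
    ultimately obtain z0 where z0: "z0 \<in> S" "\<And>z. z \<in> S \<Longrightarrow> norm (poly (pderiv f) z0) \<le> norm (poly (pderiv f) z)"
      using continuous_attains_inf[of S] False by blast
    have "norm (poly (pderiv f) z0) > 0" using z0(1) crit_interior by (auto simp: S_def)
    then show ?thesis
      using z0(2) by (intro exI[of _ "min 1 (norm (poly (pderiv f) z0))"]) (auto simp: S_def min.coboundedI2)
  qed
qed

text \<open>By \<open>fibre_deriv\<close> the derivative at \<open>p\<close> is the product of the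
  differences to the other preimages. If its modulus is at least \<open>\<eta> \<le> 1\<close>, the
  factors cannot all be smaller than \<open>\<eta>\<close>.\<close>

lemma separated_preimages:
  "\<exists>\<delta>>0. \<forall>u. norm u \<le> B \<and> u \<notin> interior K \<longrightarrow>
     (\<exists>p q. poly f p = u \<and> poly f q = u \<and> \<delta> \<le> norm (p - q) \<and> norm p \<le> max R0 B \<and> norm q \<le> max R0 B)"
proof -
  obtain \<eta> where \<eta>01: "\<eta> > 0" "\<eta> \<le> 1"
    and "\<forall>z. norm z \<le> max R0 B \<and> z \<notin> interior K \<longrightarrow> \<eta> \<le> norm (poly (pderiv f) z)"
    using deriv_lower_bound[of "max R0 B"] by blast
  then have \<eta>: "\<eta> > 0" "\<eta> \<le> 1" "\<And>z. norm z \<le> max R0 B \<Longrightarrow> z \<notin> interior K \<Longrightarrow> \<eta> \<le> norm (poly (pderiv f) z)"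
    by blast+
  have "\<exists>p q. poly f p = u \<and> poly f q = u \<and> \<eta> \<le> norm (p - q) \<and> norm p \<le> max R0 B \<and> norm q \<le> max R0 B"
    if u: "norm u \<le> B" "u \<notin> interior K" for u
  proof -
    have le: "norm p \<le> max R0 B" if "poly f p = u" for p
    proof (cases "R0 \<le> norm p")
      case True
      then have "2 * norm p \<le> norm u" using norm_poly_ge_double that by blast
      then have "norm p \<le> B" using u(1) norm_ge_zero[of p] by linarith
      then show ?thesis by simp
    qed auto
    have reg: "\<And>z. poly f z = u \<Longrightarrow> poly (pderiv f) z \<noteq> 0"
      using u(2) crit_interior iter_mem_interior_K_iff[of 1] by auto
    have dp: "degree f > 0" using degree_ge_2 by simp
    obtain p where p: "poly f p = u" using poly_surj[OF dp] by blast
    define Z where "Z = {z. poly f z = u} - {p}"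
    have Z: "finite Z" "card Z = d - 1" using card_simple_fibre(1,2)[OF dp reg] p by (auto simp: Z_def)
    have "p \<notin> interior K" using p u(2) iter_mem_interior_K_iff[of 1 p] by auto
    then have "\<eta> \<le> norm (poly (pderiv f) p)" using \<eta>(3) le p by blast
    also have "\<dots> = (\<Prod>q\<in>Z. norm (p - q))"
      using fibre_deriv[OF dp reg p] monic by (simp add: Z_def flip: prod_norm)
    finally have le\<eta>: "\<eta> \<le> (\<Prod>q\<in>Z. norm (p - q))" .
    have "\<exists>q\<in>Z. \<eta> \<le> norm (p - q)"
    proof (rule ccontr)
      assume "\<not> ?thesis"
      then have lt: "\<And>q. q \<in> Z \<Longrightarrow> norm (p - q) < \<eta>" by (meson not_le)
      have "Z \<noteq> {}" using Z degree_ge_2 by auto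
      then obtain q where q: "q \<in> Z" by blast
      have "(\<Prod>q\<in>Z. norm (p - q)) = norm (p - q) * (\<Prod>q\<in>Z - {q}. norm (p - q))"
        using q Z(1) by (simp add: prod.remove)
      also have "\<dots> \<le> norm (p - q) * 1"
        by (intro mult_left_mono prod_le_1) (use lt \<eta>(2) in \<open>auto intro: less_imp_le order.trans\<close>)
      finally show False using lt[OF q] le\<eta> by simp
    qed
    then show ?thesis using p le by (auto simp: Z_def)
  qed
  then show ?thesis using \<eta>(1) by blast
qed

text \<open>If every iterate omitted a value on the ball, then it would also omit two preimages of a value,
  at definite distance from each other, and Schottky's theorem would bound all iterates near \<open>w\<close>.\<close>

lemma eventually_onto:
  assumes w: "w \<in> J" and e: "e > 0"
  shows "\<exists>l. \<forall>u. norm u \<le> B \<and> u \<notin> interior K \<longrightarrow> u \<in> F l ` ball w e"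
proof (rule ccontr)
  assume neg: "\<not> ?thesis"
  define R2 where "R2 = max R0 B"
  define h where "h = e / 2"
  have h: "h > 0" using e by (simp add: h_def)
  obtain \<delta> where \<delta>: "\<delta> > 0" "\<And>u. norm u \<le> B \<Longrightarrow> u \<notin> interior K \<Longrightarrow>
     \<exists>p q. poly f p = u \<and> poly f q = u \<and> \<delta> \<le> norm (p - q) \<and> norm p \<le> R2 \<and> norm q \<le> R2"
    using separated_preimages[of B] unfolding R2_def by metis
  \<comment> \<open>Schottky's bound on the disc of radius \<open>1 / 2\<close> for functions
    omitting 0 and 1 whose modulus at the centre is at most
    \<open>(R0 + R2) / \<delta>\<close>.\<close>
  define M where "M = exp (pi * exp (pi * (2 + 2 * ((R0 + R2) / \<delta>) + 12 * (1/2) / (1 - 1/2))))"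
  have R2: "R2 > 0" using R0(1) by (simp add: R2_def)
  have bound: "norm (F l w') \<le> R2 + 2 * R2 * M" if w': "w' \<in> ball w (e / 4)" for l w'
  proof -
    \<comment> \<open>The value is chosen omitted by the iterate \<open>Suc l\<close>, so that its
      preimages \<open>p\<close> and \<open>q\<close> are both omitted by the iterate
      \<open>l\<close>.\<close>
    obtain u where u: "norm u \<le> B" "u \<notin> interior K" "u \<notin> F (Suc l) ` ball w e" using neg by metis
    obtain p q where pq: "poly f p = u" "poly f q = u" "\<delta> \<le> norm (p - q)" "norm p \<le> R2" "norm q \<le> R2"
      using \<delta>(2)[OF u(1,2)] by blast
    have pq_ne: "q - p \<noteq> 0" using pq(3) \<delta>(1) by auto
    have omit: "F l z \<noteq> p" "F l z \<noteq> q" if "z \<in> ball w e" for z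
    proof -
      have "u \<noteq> F (Suc l) z" using u(3) that by blast
      then show "F l z \<noteq> p" "F l z \<noteq> q" using pq(1,2) by auto
    qed
    define \<phi> where "\<phi> \<zeta> = (F l (w + of_real h * \<zeta>) - p) / (q - p)" for \<zeta>
    have inb: "w + of_real h * \<zeta> \<in> ball w e" if "norm \<zeta> \<le> 1" for \<zeta>
    proof -
      have "h * norm \<zeta> \<le> h * 1" using that h by (intro mult_left_mono) auto
      then have "h * norm \<zeta> < e" using e by (simp add: h_def)
      then show ?thesis using h by (simp add: dist_norm norm_mult)
    qed
    define \<zeta> where "\<zeta> = (w' - w) / of_real h"
    have \<zeta>: "norm \<zeta> \<le> 1 / 2" "w + of_real h * \<zeta> = w'"
    proof -
      have "norm (w' - w) \<le> h / 2" using w' by (simp add: dist_norm norm_minus_commute h_def)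
      moreover have "norm \<zeta> = norm (w' - w) / h" using h by (simp add: \<zeta>_def norm_divide)
      ultimately show "norm \<zeta> \<le> 1 / 2" using h by (simp add: pos_divide_le_eq mult.commute)
      show "w + of_real h * \<zeta> = w'" using h by (simp add: \<zeta>_def)
    qed
    have "norm (\<phi> \<zeta>) \<le> M"
      unfolding M_def
    proof (rule Schottky[of \<phi>])
      show "\<phi> holomorphic_on cball 0 1"
        unfolding \<phi>_def poly_iter_poly[symmetric] using pq_ne
        by (intro holomorphic_intros) auto
      have "norm (F l w - p) \<le> R0 + R2"
        using norm_triangle_ineq4[of "F l w" p] pq(4) w J_subset_K mem_K_iff[of w] by (smt (verit) subsetD)
      then show "norm (\<phi> 0) \<le> (R0 + R2) / \<delta>"
        using pq(3) \<delta>(1) R2 R0(1) unfolding \<phi>_def norm_divide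
        by (intro frac_le) (auto simp: norm_minus_commute)
      show "\<not> (\<phi> z = 0 \<or> \<phi> z = 1)" if "z \<in> cball 0 1" for z
        using omit[OF inb[of z]] that pq_ne by (auto simp: \<phi>_def field_simps)
    qed (use \<zeta> in auto)
    moreover have "F l w' = p + (q - p) * \<phi> \<zeta>" using pq_ne \<zeta>(2) by (simp add: \<phi>_def)
    ultimately have "norm (F l w') \<le> norm p + norm (q - p) * M"
      using norm_triangle_ineq[of p "(q - p) * \<phi> \<zeta>"] mult_left_mono[of "norm (\<phi> \<zeta>)" M "norm (q - p)"]
      by (simp add: norm_mult)
    also have "\<dots> \<le> R2 + (2 * R2) * M"
    proof (intro add_mono mult_right_mono)
      show "norm (q - p) \<le> 2 * R2" using norm_triangle_ineq4[of q p] pq(4,5) by linarith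
    qed (use pq in \<open>auto simp: M_def\<close>)
    finally show ?thesis .
  qed
  obtain w' where w': "w' \<in> ball w (e / 4)" "w' \<notin> K" using J_near_complement[OF w, of "e / 4"] e by auto
  obtain n where "R2 + 2 * R2 * M + 1 \<le> norm (F n w')" using escape[OF w'(2)] by blast
  then show False using bound[OF w'(1), of n] by linarith
qed

text \<open>Only the orbit of \<open>y\<close> is assumed bounded; truncating the distance at 1
  keeps the one-step Lipschitz estimate valid even when the orbit of \<open>x\<close> is far away.
  Distances at time \<open>k\<close> thus bound the initial distance from below.\<close>

lemma iter_dist_lower_bound:
  "\<exists>L\<ge>1. \<forall>k x y. (\<forall>j<k. norm (F j y) \<le> B) \<longrightarrow> min 1 (norm (F k x - F k y)) \<le> L ^ k * norm (x - y)"
proof -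
  obtain L0 where L0: "\<And>x y. x \<in> cball 0 (B + 1) \<Longrightarrow> y \<in> cball 0 (B + 1) \<Longrightarrow> norm (poly f x - poly f y) \<le> L0 * norm (x - y)"
  proof -
    have "compact (poly (pderiv f) ` cball 0 (B + 1))"
      by (intro compact_continuous_image continuous_intros) auto
    then have "bounded (poly (pderiv f) ` cball 0 (B + 1))" by (rule compact_imp_bounded)
    then obtain L0 where "\<forall>x\<in>poly (pderiv f) ` cball 0 (B + 1). norm x \<le> L0" unfolding bounded_iff by blast
    then have L0: "\<And>z. z \<in> cball 0 (B + 1) \<Longrightarrow> norm (poly (pderiv f) z) \<le> L0" by blast
    show ?thesis
    proof (rule that)
      fix x y :: complex assume "x \<in> cball 0 (B + 1)" "y \<in> cball 0 (B + 1)"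
      then show "norm (poly f x - poly f y) \<le> L0 * norm (x - y)"
        using field_differentiable_bound[of "cball 0 (B + 1)" "poly f" "poly (pderiv f)" L0 y x] L0
        by (auto intro: has_field_derivative_at_within poly_DERIV simp: norm_minus_commute)
    qed
  qed
  define L where "L = max 1 L0"
  have step: "min 1 (norm (poly f x - poly f y)) \<le> L * min 1 (norm (x - y))" if "norm y \<le> B" for x y
  proof (cases "norm (x - y) \<le> 1")
    case True
    then have "norm x \<le> B + 1" using that norm_triangle_ineq2[of x y] by linarith
    then have "norm (poly f x - poly f y) \<le> L0 * norm (x - y)" using L0 that by auto
    also have "\<dots> \<le> L * norm (x - y)" by (intro mult_right_mono) (auto simp: L_def)
    finally show ?thesis using True by simp
  next
    case False
    then show ?thesis by (simp add: L_def)
  qed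
  have "min 1 (norm (F k x - F k y)) \<le> L ^ k * min 1 (norm (x - y))" if "\<forall>j<k. norm (F j y) \<le> B" for k x y
    using that
  proof (induction k)
    case (Suc k)
    have "min 1 (norm (F (Suc k) x - F (Suc k) y)) \<le> L * min 1 (norm (F k x - F k y))"
      using step[of "F k y" "F k x"] Suc.prems by simp
    also have "\<dots> \<le> L * (L ^ k * min 1 (norm (x - y)))"
      using Suc by (intro mult_left_mono) (auto simp: L_def)
    finally show ?case by (simp add: mult.assoc)
  qed auto
  moreover have "L ^ k * min 1 (norm (x - y)) \<le> L ^ k * norm (x - y)" for k and x y :: complex
    by (intro mult_left_mono) (auto simp: L_def)
  ultimately have "\<forall>k x y. (\<forall>j<k. norm (F j y) \<le> B) \<longrightarrow> min 1 (norm (F k x - F k y)) \<le> L ^ k * norm (x - y)"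
    by (meson order.trans)
  then show ?thesis by (intro exI[of _ L]) (auto simp: L_def)
qed

end

section \<open>Sets missing many preimages of a disc\<close>

lemma ln_fact_le: "ln (fact n :: real) \<le> n * ln (real n)"
proof (cases "n = 0")
  case False
  have "ln (fact n :: real) \<le> ln (real n ^ n)"
    using False fact_le_power[of n] of_nat_mono[OF fact_le_power[of n], where 'a=real]
    by (subst ln_le_cancel_iff) auto
  then show ?thesis using False by (simp add: ln_realpow)
qed auto

text \<open>Two sections with a common value take it over the same base point, hence agree
  everywhere by uniqueness of lifts.\<close>

lemma sections_disjoint:
  fixes g :: "complex poly"
  assumes "degree g > 0" "open U" "\<And>z. poly g z \<in> U \<Longrightarrow> poly (pderiv g) z \<noteq> 0" "connected U" "w \<in> U"
    and s: "continuous_on U s" "\<And>u. u \<in> U \<Longrightarrow> poly g (s u) = u"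
    and t: "continuous_on U t" "\<And>u. u \<in> U \<Longrightarrow> poly g (t u) = u"
    and "s w \<noteq> t w"
  shows "s ` U \<inter> t ` U = {}"
proof (rule ccontr)
  assume "s ` U \<inter> t ` U \<noteq> {}"
  then obtain u v where uv: "u \<in> U" "v \<in> U" "s u = t v" by auto
  then have "u = v" using s(2) t(2) by metis
  then have "s w = t w"
    using poly_lift_unique[OF assms(1-3), of U s t u w] assms uv by simp
  then show False using assms by simp
qed

context monic_dynamics
begin

text \<open>Outside the disc of radius \<open>R0\<close> the modulus never decreases along an orbit,
  so an early excess over \<open>B\<close> would persist.\<close>

lemma bounded_orbit:
  assumes "norm (F k y) \<le> B" "R0 \<le> B" "j \<le> k"
  shows "norm (F j y) \<le> B"
proof (rule ccontr)
  assume "\<not> ?thesis"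
  then have gt: "norm (F j y) > B" by simp
  then have "norm (F j y) \<le> norm (F (k - j) (F j y))" using assms(2) by (intro norm_iter_ge_self) auto
  also have "F (k - j) (F j y) = F k y" using assms(3) by (simp flip: iter_poly_add)
  finally show False using gt assms(1) by simp
qed

end

context pcf_dynamics
begin

text \<open>A point outside the interior of \<open>K\<close> is not a critical value of any iterate,
  so its fibres are simple; since \<open>f\<close> is monic the products carry no leading
  coefficient.\<close>

lemma fibre_outside_K:
  assumes a: "a \<notin> interior K"
  shows "finite {y. F k y = a}" "card {y. F k y = a} = d ^ k"
    "(\<Prod>y | F k y = a. norm (x - y)) = norm (F k x - a)"
    "F k y = a \<Longrightarrow> (\<Prod>y'\<in>{z. F k z = a} - {y}. norm (y - y')) = (\<Prod>j<k. norm (poly (pderiv f) (F j y)))"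
proof -
  have reg: "\<And>z. poly (iter_poly f k) z = a \<Longrightarrow> poly (pderiv (iter_poly f k)) z \<noteq> 0"
    using notin_K_regular[OF a] .
  note dg = degree_iter_pos[of k]
  show "finite {y. F k y = a}" "card {y. F k y = a} = d ^ k"
    using card_simple_fibre(1,2)[OF dg reg] by (auto simp: poly_iter_poly degree_iter_poly)
  show "(\<Prod>y | F k y = a. norm (x - y)) = norm (F k x - a)"
  proof -
    have "poly (iter_poly f k) x - a = lead_coeff (iter_poly f k) * (\<Prod>q | poly (iter_poly f k) q = a. x - q)"
      by (rule fibre_prod[OF dg reg])
    then show ?thesis using lead_coeff_iter_poly[of k] by (simp add: poly_iter_poly prod_norm)
  qed
  show "(\<Prod>y'\<in>{z. F k z = a} - {y}. norm (y - y')) = (\<Prod>j<k. norm (poly (pderiv f) (F j y)))" if "F k y = a"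
  proof -
    have "poly (pderiv (iter_poly f k)) y
        = lead_coeff (iter_poly f k) * (\<Prod>q\<in>{z. poly (iter_poly f k) z = a} - {y}. y - q)"
      by (rule fibre_deriv[OF dg reg]) (use that in \<open>simp_all add: poly_iter_poly\<close>)
    then show ?thesis
      using lead_coeff_iter_poly[of k] by (simp add: poly_iter_poly prod_norm pderiv_iter_poly)
  qed
qed

text \<open>The distances from \<open>y\<close> to the rest of its fibre multiply to the derivative
  of the \<open>k\<close>-th iterate, which by the chain rule is a product of \<open>k\<close>
  factors of modulus at least \<open>\<eta>\<close>. The resulting loss \<open>k * d ^ k\<close> in
  the exponent is negligible against \<open>(d ^ k)^2\<close>.\<close>

lemma vdm_fibre_ge:
  assumes a: "a \<notin> interior K" "norm a \<le> B" "R0 \<le> B"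
    and \<eta>: "\<eta> > 0" "\<And>z. norm z \<le> B \<Longrightarrow> z \<notin> interior K \<Longrightarrow> \<eta> \<le> norm (poly (pderiv f) z)"
  shows "\<eta> ^ (k * d ^ k) \<le> vdm {y. F k y = a}"
proof -
  define Y where "Y = {y. F k y = a}"
  have "\<eta> ^ k \<le> (\<Prod>y'\<in>Y - {y}. norm (y - y'))" if y: "y \<in> Y" for y
  proof -
    have "\<eta> \<le> norm (poly (pderiv f) (F j y))" if "j < k" for j
    proof (rule \<eta>(2))
      show "norm (F j y) \<le> B" using bounded_orbit[of k y B j] y a that by (simp add: Y_def)
      show "F j y \<notin> interior K"
        using iter_mem_interior_K_iff[of "k - j" "F j y"] y a(1) that by (simp add: Y_def flip: iter_poly_add)
    qed
    then have "(\<Prod>j<k. \<eta>) \<le> (\<Prod>j<k. norm (poly (pderiv f) (F j y)))"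
      using \<eta>(1) by (intro prod_mono) auto
    then show ?thesis using fibre_outside_K(4)[OF a(1), of k y] y by (simp add: Y_def)
  qed
  then have "(\<Prod>y\<in>Y. \<eta> ^ k) \<le> vdm Y"
    unfolding vdm_def using \<eta>(1) by (intro prod_mono) auto
  moreover have "(\<Prod>y\<in>Y. \<eta> ^ k) = \<eta> ^ (k * d ^ k)"
    using fibre_outside_K(2)[OF a(1), of k] by (simp add: Y_def power_mult)
  ultimately show ?thesis by (simp add: Y_def)
qed

text \<open>Each of the \<open>d ^ k\<close> points in the fibre of the \<open>k\<close>-th iterate
  has its own preimage in \<open>U\<close> under the \<open>l\<close>-th. Hence \<open>U\<close>
  receives at least the share \<open>1 / d ^ l\<close> of the fibre of \<open>a\<close>, uniformly
  in \<open>k\<close>.\<close>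

lemma many_preimages:
  assumes onto: "\<forall>u. norm u \<le> B \<and> u \<notin> interior K \<longrightarrow> u \<in> F l ` U"
    and a: "a \<notin> interior K" "norm a \<le> B" "R0 \<le> B"
  shows "d ^ k \<le> card {h \<in> U. F (k + l) h = a}" "finite {h \<in> U. F (k + l) h = a}"
proof -
  define E where "E = {e. F k e = a}"
  show fin: "finite {h \<in> U. F (k + l) h = a}"
    by (rule finite_subset[OF _ fibre_outside_K(1)[OF a(1), of "k + l"]]) auto
  have "\<exists>h\<in>U. F l h = e" if "e \<in> E" for e
  proof -
    have "norm e \<le> B" using bounded_orbit[of k e B 0] that a by (simp add: E_def)
    moreover have "e \<notin> interior K" using that a(1) iter_mem_interior_K_iff[of k e] by (auto simp: E_def)
    ultimately show ?thesis using onto by (auto simp: image_iff)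
  qed
  then obtain h where h: "\<And>e. e \<in> E \<Longrightarrow> h e \<in> U" "\<And>e. e \<in> E \<Longrightarrow> F l (h e) = e" by metis
  have "inj_on h E" using h(2) by (metis inj_onI)
  moreover have "h ` E \<subseteq> {h \<in> U. F (k + l) h = a}" using h by (auto simp: E_def iter_poly_add)
  ultimately have "card E \<le> card {h \<in> U. F (k + l) h = a}" using fin card_inj_on_le by blast
  then show "d ^ k \<le> card {h \<in> U. F (k + l) h = a}" using fibre_outside_K(2)[OF a(1), of k] by (simp add: E_def)
qed

text \<open>The comparison set \<open>Y\<close> is a fibre of a high iterate over a point close to the circle of radius
  \<open>R0\<close>, chosen so that it keeps its distance from the images of \<open>X\<close>.\<close>

lemma vdm_upper_bound:
  assumes w: "0 < r" "r < R" "ball w R \<inter> P = {}"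
    and onto: "\<forall>u. norm u \<le> R0 + 1 \<and> u \<notin> interior K \<longrightarrow> u \<in> F l ` ball w (r / 8)"
    and B: "B \<ge> 1" "\<And>j z. norm z \<le> R0 \<Longrightarrow> norm (F j z) \<le> B ^ (d ^ j)"
    and N0: "2 * ln B / real d ^ N0 \<le> ln 3 / (4 * real d ^ (2 * l))"
    and I: "finite I" "real d ^ n / 2 \<le> real (card I)"
    and s: "\<And>i. i \<in> I \<Longrightarrow> s i holomorphic_on ball w R"
      "\<And>i u. i \<in> I \<Longrightarrow> u \<in> ball w R \<Longrightarrow> F n (s i u) = u"
      "\<And>i j. i \<in> I \<Longrightarrow> j \<in> I \<Longrightarrow> i \<noteq> j \<Longrightarrow> s i w \<noteq> s j w"
    and T: "\<And>x. x \<in> T \<Longrightarrow> norm (F (n + N0) x) \<le> R0"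
      "\<And>i. i \<in> I \<Longrightarrow> T \<inter> s i ` ball w R = {}"
  shows "\<exists>A. \<forall>k X. k \<ge> n + N0 + l \<longrightarrow> X \<subseteq> T \<longrightarrow> finite X \<longrightarrow> card X = d ^ k \<longrightarrow>
     ln (vdm X) \<le> A * real (k + 1) * real d ^ k - ln 3 / (4 * real d ^ (2 * l)) / real d ^ n * (real d ^ k)^2"
proof -
  have inj: "inj_on (s i) (ball w R)" if "i \<in> I" for i
    using s(2)[OF that] by (metis inj_onI)
  have dj: "s i ` ball w R \<inter> s j ` ball w R = {}" if "i \<in> I" "j \<in> I" "i \<noteq> j" for i j
  proof (rule sections_disjoint[OF degree_iter_pos[of n] open_ball iter_regular[OF w(3)] connected_ball])
    show "w \<in> ball w R" using w by simp
    show "continuous_on (ball w R) (s i)" "continuous_on (ball w R) (s j)"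
      using s(1) that holomorphic_on_imp_continuous_on by blast+
  qed (use s(2,3) that in \<open>auto simp: poly_iter_poly\<close>)
  \<comment> \<open>The image of the circle is compact inside an open cell that \<open>T\<close>
    avoids, which keeps \<open>T\<close> at a positive distance. This distance may depend on
    \<open>n\<close>, but not on \<open>k\<close>.\<close>
  have "\<exists>\<delta>>0. \<forall>\<xi>\<in>sphere w r. \<forall>x\<in>T. \<delta> \<le> norm (x - s i \<xi>)" if i: "i \<in> I" for i
  proof -
    have opn: "open (s i ` ball w R)" by (rule open_mapping_thm3[OF s(1)[OF i] open_ball inj[OF i]])
    have sub: "sphere w r \<subseteq> ball w R" using w by auto
    have "continuous_on (sphere w r) (s i)"
      using s(1)[OF i] sub holomorphic_on_imp_continuous_on continuous_on_subset by blast
    then have "compact (s i ` sphere w r)"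
      by (rule compact_continuous_image) simp
    then obtain \<delta> where \<delta>: "\<delta> > 0" "(\<Union>y\<in>s i ` sphere w r. ball y \<delta>) \<subseteq> s i ` ball w R"
      using compact_subset_open_imp_ball_epsilon_subset[OF _ opn] sub by (metis image_mono)
    have "\<delta> \<le> norm (x - s i \<xi>)" if "\<xi> \<in> sphere w r" "x \<in> T" for \<xi> x
    proof (rule ccontr)
      assume "\<not> ?thesis"
      then have "x \<in> ball (s i \<xi>) \<delta>" by (simp add: dist_norm norm_minus_commute)
      then show False using \<delta>(2) that T(2)[OF i] by blast
    qed
    then show ?thesis using \<delta>(1) by blast
  qed
  then obtain \<delta>1 where \<delta>1: "\<And>i. i \<in> I \<Longrightarrow> \<delta>1 i > 0"
      "\<And>i \<xi> x. i \<in> I \<Longrightarrow> \<xi> \<in> sphere w r \<Longrightarrow> x \<in> T \<Longrightarrow> \<delta>1 i \<le> norm (x - s i \<xi>)" by metis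
  define \<delta>0 where "\<delta>0 = Min (insert 1 (\<delta>1 ` I))"
  have \<delta>0: "\<delta>0 > 0" "\<delta>0 \<le> 1" "\<And>i. i \<in> I \<Longrightarrow> \<delta>0 \<le> \<delta>1 i"
    using \<delta>1(1) I(1) by (auto simp: \<delta>0_def)
  obtain L where L: "L \<ge> 1" "\<And>k x y. (\<forall>j<k. norm (F j y) \<le> R0 + 1) \<Longrightarrow> min 1 (norm (F k x - F k y)) \<le> L ^ k * norm (x - y)"
    using iter_dist_lower_bound by metis
  obtain \<eta> where "\<eta> > 0" "\<eta> \<le> 1" and "\<forall>z. norm z \<le> R0 + 1 \<and> z \<notin> interior K \<longrightarrow> \<eta> \<le> norm (poly (pderiv f) z)"
    using deriv_lower_bound by blast
  then have \<eta>: "\<eta> > 0" "\<eta> \<le> 1" "\<And>z. norm z \<le> R0 + 1 \<Longrightarrow> z \<notin> interior K \<Longrightarrow> \<eta> \<le> norm (poly (pderiv f) z)"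
    by auto
  define q where "q = real d"
  have q: "q \<ge> 2" using degree_ge_2 by (simp add: q_def)
  \<comment> \<open>\<open>A\<close> gathers the contributions of order at most
    \<open>k * d ^ k\<close>, which disappear after division by the number of pairs.\<close>
  define A where "A = 4 * ln q + 2 * ln 2 + 2 * ln (1 / \<delta>0) + 2 * ln L + 2 * ln (R0 + 2) + ln (1 / \<eta>) + real (card I) * ln 3"
  have nn: "ln q \<ge> 0" "ln (2::real) \<ge> 0" "ln (1 / \<delta>0) \<ge> 0" "ln L \<ge> 0" "ln (R0 + 2) \<ge> 0" "ln (1 / \<eta>) \<ge> 0" "ln (3::real) \<ge> 0" "ln B \<ge> 0"
    using q \<delta>0 L(1) R0(1) \<eta> B(1) by auto
  show ?thesis
  proof (intro exI[of _ A] allI impI)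
    fix k X assume k: "k \<ge> n + N0 + l" and X: "X \<subseteq> T" "finite X" "card X = d ^ k"
    define N where "N = real d ^ k"
    have N: "N \<ge> 1" "real (card X) = N" using degree_ge_2 X(3) by (auto simp: N_def)
    have Npos: "d ^ k > 0" using degree_ge_2 by simp
    \<comment> \<open>The base point depends on \<open>X\<close>: it stays
      \<open>1 / (2 * N)\<close> away from the at most \<open>d ^ k\<close> points of the image of
      \<open>X\<close>, which separates \<open>X\<close> from the fibre.\<close>
    obtain a0 :: real where a0: "R0 \<le> a0" "a0 \<le> R0 + 1" "\<And>x. x \<in> X \<Longrightarrow> 1 / (2 * N) \<le> norm (F k x - of_real a0)"
      using avoid_values[of "F k ` X" "d ^ k" R0] X card_image_le[of X "F k"] Npos by (auto simp: N_def)
    define a :: complex where "a = of_real a0"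
    have na: "R0 \<le> norm a" "norm a \<le> R0 + 1" using a0 R0(1) by (auto simp: a_def)
    have aK: "a \<notin> K" using na(1) mem_K_iff[of a] by (metis funpow_0 not_le)
    then have ai: "a \<notin> interior K" using interior_subset by blast
    define Y where "Y = {y. F k y = a}"
    have Y: "finite Y" "card Y = d ^ k" using fibre_outside_K(1,2)[OF ai] by (auto simp: Y_def)
    have yorb: "norm (F j y) \<le> R0 + 1" if "y \<in> Y" "j \<le> k" for y j
      using bounded_orbit[of k y "R0 + 1" j] that na by (simp add: Y_def)
    define H where "H = {h \<in> ball w (r / 8). F (k - n) h = a}"
    define m where "m = d ^ (k - n - l)"
    have "k - n = (k - n - l) + l" using k by simp
    then have H: "m \<le> card H" "finite H"
      using many_preimages[OF onto ai na(2), of "k - n - l"] by (auto simp: H_def m_def)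
    have HR: "H \<subseteq> ball w R" using w by (force simp: H_def)
    have sH: "s i ` H \<subseteq> Y" if "i \<in> I" for i
    proof
      fix y assume "y \<in> s i ` H"
      then obtain h where h: "h \<in> H" "y = s i h" by auto
      have "F k y = F (k - n) (F n y)" using k by (simp flip: iter_poly_add)
      also have "\<dots> = a" using h HR s(2)[OF that] by (auto simp: H_def)
      finally show "y \<in> Y" by (simp add: Y_def)
    qed
    \<comment> \<open>A gap of \<open>1 / (2 * N)\<close> after \<open>k\<close> steps, each
      stretching by at most \<open>L\<close>, gives the gap \<open>1 / (2 * N * L ^ k)\<close> at
      the start; the factor \<open>\<delta>0 \<le> 1\<close> accounts for the circles.\<close>
    define \<delta> where "\<delta> = \<delta>0 / (2 * N * L ^ k)"
    have LN: "2 * N * L ^ k \<ge> 1" using N(1) L(1) one_le_power[OF L(1), of k] mult_mono[of 1 "2 * N" 1 "L ^ k"] by auto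
    have \<delta>: "\<delta> > 0" "\<delta> \<le> \<delta>0" using \<delta>0(1) LN by (auto simp: \<delta>_def divide_le_eq mult_left_le intro!: divide_pos_pos)
    have dXY: "\<delta> \<le> norm (x - y)" if "x \<in> X" "y \<in> Y" for x y
    proof -
      have "min 1 (norm (F k x - F k y)) \<le> L ^ k * norm (x - y)" using yorb[OF that(2)] by (intro L(2)) auto
      moreover have "1 / (2 * N) \<le> min 1 (norm (F k x - F k y))"
        using a0(3)[OF that(1)] that(2) N(1) by (auto simp: Y_def a_def)
      ultimately have "1 / (2 * N) \<le> L ^ k * norm (x - y)" by linarith
      then have "1 / (2 * N) / L ^ k \<le> norm (x - y)"
        using L(1) by (subst pos_divide_le_eq) (auto simp: mult.commute)
      moreover have "\<delta> \<le> 1 / (2 * N * L ^ k)"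
        unfolding \<delta>_def using \<delta>0(2) LN by (intro divide_right_mono) auto
      ultimately show ?thesis by simp
    qed
    have main: "vdm X * 3 ^ (card I * (card H * (card H - 1))) * vdm Y \<le> (fact (card X) / \<delta> ^ card X)^2 * (cross X Y)^2"
    proof (rule vdm_bound_cells[OF I(1) s(1) inj dj w(1,2)])
      show "X \<inter> s i ` ball w R = {}" if "i \<in> I" for i using T(2)[OF that] X(1) by blast
      show "\<delta> \<le> norm (x - s i \<xi>)" if "x \<in> X" "i \<in> I" "\<xi> \<in> sphere w r" for x i \<xi>
        using \<delta>1(2)[OF that(2,3), of x] \<delta>0(3)[OF that(2)] \<delta>(2) that(1) X(1) by (meson order.trans subsetD)
    qed (use X Y H sH \<delta> dXY in \<open>auto simp: H_def\<close>)
    have vY: "\<eta> ^ (k * d ^ k) \<le> vdm Y"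
      using vdm_fibre_ge[OF ai na(2) _ \<eta>(1,3)] by (simp add: Y_def)
    \<comment> \<open>Bound for one row of \<open>cross X Y\<close>, which equals
      \<open>norm (F k x - a)\<close>: the orbit of \<open>x\<close> is still in the disc at time
      \<open>n + N0\<close>, and grows at most to \<open>B ^ (d ^ j)\<close> in the remaining
      \<open>j\<close> steps.\<close>
    define Q where "Q = (R0 + 2) * B ^ (d ^ (k - n - N0))"
    have Q: "Q > 0" using R0(1) B(1) by (simp add: Q_def)
    have cr: "cross X Y \<le> Q ^ (d ^ k)"
    proof -
      have "(\<Prod>y\<in>Y. norm (x - y)) \<le> Q" if "x \<in> X" for x
      proof -
        have kk: "k = (k - n - N0) + (n + N0)" using k by simp
        have "norm (F k x) \<le> B ^ (d ^ (k - n - N0))"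
          using B(2)[OF T(1), of x "k - n - N0"] that X(1) by (subst kk, subst iter_poly_add) auto
        moreover have "1 \<le> B ^ (d ^ (k - n - N0))" using B(1) by simp
        then have "(R0 + 1) * 1 \<le> (R0 + 1) * B ^ (d ^ (k - n - N0))" using R0(1) by (intro mult_left_mono) auto
        ultimately have "norm (F k x - a) \<le> Q"
          using norm_triangle_ineq4[of "F k x" a] na(2) by (simp add: Q_def algebra_simps)
        then show ?thesis using fibre_outside_K(3)[OF ai, of x k] by (simp add: Y_def)
      qed
      then have "cross X Y \<le> (\<Prod>x\<in>X. Q)" unfolding cross_def by (intro prod_mono) (auto intro: prod_nonneg)
      then show ?thesis using X(3) by simp
    qed
    define G where "G = card I * (m * (m - 1))"
    have vX: "vdm X > 0" using X(2) vdm_pos by blast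
    have "vdm X * 3 ^ G * \<eta> ^ (k * d ^ k) \<le> vdm X * 3 ^ (card I * (card H * (card H - 1))) * vdm Y"
      using vY vX H(1) \<eta>(1) vdm_nonneg unfolding G_def
      by (intro mult_mono mult_left_mono power_increasing mult_le_mono diff_le_mono) auto
    also have "\<dots> \<le> (fact (card X) / \<delta> ^ card X)^2 * (cross X Y)^2" by (rule main)
    also have "\<dots> \<le> (fact (card X) / \<delta> ^ card X)^2 * (Q ^ (d ^ k))^2"
      using cr cross_nonneg by (intro mult_left_mono power_mono) auto
    finally have fin: "vdm X * 3 ^ G * \<eta> ^ (k * d ^ k) \<le> (fact (card X) / \<delta> ^ card X)^2 * (Q ^ (d ^ k))^2" .
    have l1: "ln (vdm X * 3 ^ G * \<eta> ^ (k * d ^ k)) = ln (vdm X) + G * ln 3 - k * N * ln (1 / \<eta>)"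
      using vX \<eta>(1) by (simp add: ln_mult ln_realpow ln_div N_def)
    have l2: "ln ((fact (card X) / \<delta> ^ card X)^2 * (Q ^ (d ^ k))^2) = 2 * ln (fact (card X)) + 2 * N * ln (1 / \<delta>) + 2 * N * ln Q"
      using \<delta>(1) Q N(2) X(3) by (simp add: ln_mult ln_realpow ln_div N_def algebra_simps)
    have l3: "ln (fact (card X) :: real) \<le> N * (k * ln q)"
      using ln_fact_le[of "card X"] N(2) q by (simp add: N_def ln_realpow q_def)
    have l4: "ln (1 / \<delta>) = ln (1 / \<delta>0) + ln 2 + k * ln q + k * ln L"
      using \<delta>0(1) N(1) L(1) q by (simp add: \<delta>_def ln_mult ln_div ln_realpow N_def q_def)
    have l5: "ln Q = ln (R0 + 2) + q ^ (k - n - N0) * ln B"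
      using R0(1) B(1) by (simp add: Q_def ln_mult ln_realpow q_def)
    have "ln (vdm X * 3 ^ G * \<eta> ^ (k * d ^ k)) \<le> ln ((fact (card X) / \<delta> ^ card X)^2 * (Q ^ (d ^ k))^2)"
      using fin vX \<eta>(1) \<delta>(1) Q by (subst ln_le_cancel_iff) auto
    then have up: "ln (vdm X) \<le> 2 * (N * (k * ln q)) + 2 * N * (ln (1 / \<delta>0) + ln 2 + k * ln q + k * ln L)
        + 2 * N * (ln (R0 + 2) + q ^ (k - n - N0) * ln B) + k * N * ln (1 / \<eta>) - G * ln 3"
      using l1 l2 l3 l4 l5 by simp
    have qN: "q ^ (k - n - N0) = N / q ^ n / q ^ N0" "real m = N / q ^ n / q ^ l"
    proof -
      have e: "N = q ^ (k - n - N0) * q ^ n * q ^ N0" "N = q ^ (k - n - l) * q ^ n * q ^ l"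
        using k by (simp_all add: N_def flip: power_add q_def)
      show "q ^ (k - n - N0) = N / q ^ n / q ^ N0" unfolding e(1) using q by simp
      have "real m = q ^ (k - n - l)" by (simp add: m_def q_def)
      then show "real m = N / q ^ n / q ^ l" unfolding e(2) using q by simp
    qed
    define M where "M = N / q ^ n / q ^ l"
    have M: "M \<ge> 1" "M \<le> N" "real m = M"
    proof -
      show "real m = M" using qN(2) by (simp add: M_def)
      have "m \<ge> 1" using degree_ge_2 by (simp add: m_def)
      then show "M \<ge> 1" using \<open>real m = M\<close> by linarith
      have "m \<le> d ^ k" unfolding m_def using degree_ge_2 by (intro power_increasing) auto
      then have "real m \<le> real (d ^ k)" by (rule of_nat_mono)
      then show "M \<le> N" using \<open>real m = M\<close> by (simp add: N_def)
    qed
    have Gr: "real G = real (card I) * (M * M) - real (card I) * M"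
      using M by (simp add: G_def of_nat_diff algebra_simps)
    have "real (card I) * (M * M) \<ge> (q ^ n / 2) * (M * M)"
      using I(2) by (intro mult_right_mono) (auto simp: q_def)
    moreover have "(q ^ n / 2) * (M * M) = 2 * (N^2 / q ^ n / (4 * q ^ (2 * l)))"
    proof -
      have *: "(a / 2) * ((x / a / b) * (x / a / b)) = 2 * (x^2 / a / (4 * (b * b)))" if "a > 0" "b > 0" for a b x :: real
        using that by (simp add: power2_eq_square)
      have "q ^ (2 * l) = q ^ l * q ^ l" by (simp only: mult_2 power_add)
      then show ?thesis using *[of "q ^ n" "q ^ l" N] q unfolding M_def by (simp only: zero_less_power)
    qed
    ultimately have G1: "real G * ln 3 \<ge> (2 * (N^2 / q ^ n / (4 * q ^ (2 * l))) - real (card I) * N) * ln 3"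
    proof -
      assume *: "q ^ n / 2 * (M * M) \<le> real (card I) * (M * M)" "q ^ n / 2 * (M * M) = 2 * (N^2 / q ^ n / (4 * q ^ (2 * l)))"
      have "real (card I) * M \<le> real (card I) * N" using M by (intro mult_left_mono) auto
      then have "real G \<ge> 2 * (N^2 / q ^ n / (4 * q ^ (2 * l))) - real (card I) * N" using * Gr by linarith
      then show ?thesis using nn(7) by (intro mult_right_mono) auto
    qed
    \<comment> \<open>By the choice of \<open>N0\<close> this loss is at most half of the main term
      in \<open>G1\<close>; the other half is the asserted bound.\<close>
    have G2: "2 * N * (q ^ (k - n - N0) * ln B) \<le> N^2 / q ^ n * (ln 3 / (4 * q ^ (2 * l)))"
    proof -
      have "2 * N * (q ^ (k - n - N0) * ln B) = N^2 / q ^ n * (2 * ln B / q ^ N0)"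
        unfolding qN by (simp add: power2_eq_square)
      also have "\<dots> \<le> N^2 / q ^ n * (ln 3 / (4 * q ^ (2 * l)))"
        using N0 q N(1) unfolding q_def[symmetric] by (intro mult_left_mono) auto
      finally show ?thesis .
    qed
    have G3: "N^2 / q ^ n * (ln 3 / (4 * q ^ (2 * l))) - 2 * (N^2 / q ^ n / (4 * q ^ (2 * l))) * ln 3
        = - (ln 3 / (4 * q ^ (2 * l)) / q ^ n * N^2)"
      using q by (simp add: field_simps)
    define kk where "kk = real k"
    have kk: "kk \<ge> 0" by (simp add: kk_def)
    have A1: "2 * (N * (kk * ln q)) + 2 * N * (ln (1 / \<delta>0) + ln 2 + kk * ln q + kk * ln L)
        + 2 * N * ln (R0 + 2) + kk * N * ln (1 / \<eta>) + real (card I) * N * ln 3 \<le> A * (kk + 1) * N"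
    proof -
      have "A * (kk + 1) - (2 * (kk * ln q) + 2 * (ln (1 / \<delta>0) + ln 2 + kk * ln q + kk * ln L)
        + 2 * ln (R0 + 2) + kk * ln (1 / \<eta>) + real (card I) * ln 3)
        = 4 * ln q + kk * (2 * ln 2 + 2 * ln (1 / \<delta>0) + 2 * ln (R0 + 2) + real (card I) * ln 3) + 2 * ln L + ln (1 / \<eta>)"
        by (simp add: A_def algebra_simps)
      also have "\<dots> \<ge> 0" using nn kk by (intro add_nonneg_nonneg mult_nonneg_nonneg) auto
      finally have "2 * (kk * ln q) + 2 * (ln (1 / \<delta>0) + ln 2 + kk * ln q + kk * ln L)
        + 2 * ln (R0 + 2) + kk * ln (1 / \<eta>) + real (card I) * ln 3 \<le> A * (kk + 1)" by linarith
      then have "(2 * (kk * ln q) + 2 * (ln (1 / \<delta>0) + ln 2 + kk * ln q + kk * ln L)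
        + 2 * ln (R0 + 2) + kk * ln (1 / \<eta>) + real (card I) * ln 3) * N \<le> A * (kk + 1) * N"
        using N(1) by (intro mult_right_mono) auto
      then show ?thesis by (simp add: algebra_simps)
    qed
    have "ln (vdm X) \<le> A * (kk + 1) * N - ln 3 / (4 * q ^ (2 * l)) / q ^ n * N^2"
    proof -
      have "2 * N * (ln (R0 + 2) + q ^ (k - n - N0) * ln B) = 2 * N * ln (R0 + 2) + 2 * N * (q ^ (k - n - N0) * ln B)"
        by (simp add: algebra_simps)
      moreover have "(2 * (N^2 / q ^ n / (4 * q ^ (2 * l))) - real (card I) * N) * ln 3
         = 2 * (N^2 / q ^ n / (4 * q ^ (2 * l))) * ln 3 - real (card I) * N * ln 3"
        by (simp add: left_diff_distrib)
      ultimately show ?thesis using up G1 G2 G3 A1 unfolding kk_def[symmetric] by linarith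
    qed
    then show "ln (vdm X) \<le> A * real (k + 1) * real d ^ k - ln 3 / (4 * real d ^ (2 * l)) / real d ^ n * (real d ^ k)^2"
      by (simp add: kk_def N_def q_def add.commute)
  qed
qed

end

section \<open>Transfinite diameter\<close>

abbreviation pairs_upto :: "nat \<Rightarrow> (nat \<times> nat) set" where
  "pairs_upto N \<equiv> {(i, j). 1 \<le> i \<and> i < j \<and> j \<le> N}"

lemma finite_pairs_upto: "finite (pairs_upto N)"
  by (rule finite_subset[of _ "{1..N} \<times> {1..N}"]) auto

lemma prod_pairs_eq_vdm:
  assumes "inj_on z {1..N}"
  shows "(\<Prod>(i, j)\<in>pairs_upto N. norm (z j - z i))^2 = vdm (z ` {1..N})"
proof -
  define Q where "Q = {(i, j). 1 \<le> j \<and> j < i \<and> i \<le> N}"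
  have finQ: "finite Q" unfolding Q_def by (rule finite_subset[of _ "{1..N} \<times> {1..N}"]) auto
  have "vdm (z ` {1..N}) = (\<Prod>i\<in>{1..N}. \<Prod>x\<in>z ` {1..N} - {z i}. norm (z i - x))"
    unfolding vdm_def using assms by (simp add: prod.reindex)
  also have "\<dots> = (\<Prod>i\<in>{1..N}. \<Prod>j\<in>{1..N} - {i}. norm (z i - z j))"
  proof (intro prod.cong refl)
    fix i assume i: "i \<in> {1..N}"
    have "z ` {1..N} - {z i} = z ` ({1..N} - {i})"
      using i by (subst inj_on_image_set_diff[OF assms]) auto
    moreover have "inj_on z ({1..N} - {i})" using assms by (rule inj_on_subset) auto
    ultimately show "(\<Prod>x\<in>z ` {1..N} - {z i}. norm (z i - x)) = (\<Prod>j\<in>{1..N} - {i}. norm (z i - z j))"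
      by (simp add: prod.reindex)
  qed
  also have "\<dots> = (\<Prod>(i, j)\<in>(SIGMA i:{1..N}. {1..N} - {i}). norm (z i - z j))"
    by (rule prod.Sigma) auto
  also have "(SIGMA i:{1..N}. {1..N} - {i}) = pairs_upto N \<union> Q" by (auto simp: Q_def)
  also have "(\<Prod>(i, j)\<in>pairs_upto N \<union> Q. norm (z i - z j))
      = (\<Prod>(i, j)\<in>pairs_upto N. norm (z i - z j)) * (\<Prod>(i, j)\<in>Q. norm (z i - z j))"
    using finite_pairs_upto finQ by (intro prod.union_disjoint) (auto simp: Q_def)
  also have "(\<Prod>(i, j)\<in>Q. norm (z i - z j)) = (\<Prod>(i, j)\<in>pairs_upto N. norm (z j - z i))"
    by (rule prod.reindex_bij_witness[of _ "\<lambda>(i, j). (j, i)" "\<lambda>(i, j). (j, i)"]) (auto simp: Q_def)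
  also have "(\<Prod>(i, j)\<in>pairs_upto N. norm (z i - z j)) = (\<Prod>(i, j)\<in>pairs_upto N. norm (z j - z i))"
    by (intro prod.cong) (auto simp: norm_minus_commute)
  finally show ?thesis by (simp add: power2_eq_square)
qed

lemma elog_prod_pairs:
  assumes "inj_on z {1..N}"
  shows "elog (\<Prod>(i, j)\<in>pairs_upto N. norm (z j - z i)) = ereal (ln (vdm (z ` {1..N})) / 2)"
proof -
  define p where "p = (\<Prod>(i, j)\<in>pairs_upto N. norm (z j - z i))"
  have p2: "p^2 = vdm (z ` {1..N})" using prod_pairs_eq_vdm[OF assms] by (simp add: p_def)
  have "p \<ge> 0" unfolding p_def by (intro prod_nonneg) auto
  moreover have "p \<noteq> 0" using p2 vdm_pos[of "z ` {1..N}"] by auto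
  ultimately have "p > 0" by simp
  then have "ln (p^2) = 2 * ln p" by (simp add: ln_realpow)
  then show ?thesis using p2 \<open>p \<noteq> 0\<close> unfolding p_def[symmetric] elog_def by simp
qed

lemma elog_prod_pairs_not_inj:
  assumes "\<not> inj_on z {1..N}"
  shows "elog (\<Prod>(i, j)\<in>pairs_upto N. norm (z j - z i)) = - \<infinity>"
proof -
  obtain i j where ij: "i \<in> {1..N}" "j \<in> {1..N}" "z i = z j" "i < j"
    using assms by (metis inj_on_def linorder_less_linear)
  then have "(\<Prod>(i, j)\<in>pairs_upto N. norm (z j - z i)) = 0"
    by (intro prod_zero finite_pairs_upto bexI[of _ "(i, j)"]) auto
  then show ?thesis by (simp add: elog_def)
qed

definition max_elog :: "nat \<Rightarrow> complex set \<Rightarrow> ereal" where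
  "max_elog N K = (SUP z\<in>{1..N} \<rightarrow> K. elog (\<Prod>(i, j)\<in>pairs_upto N. norm (z j - z i)))"

lemma log_diam_eq: "log_diam N K = ereal (2 / (real N * (real N - 1))) * max_elog N K"
  by (simp add: log_diam_def max_elog_def)

lemma max_elog_ge:
  assumes "finite X" "card X = N" "X \<subseteq> K"
  shows "ereal (ln (vdm X) / 2) \<le> max_elog N K"
proof -
  obtain z where z: "bij_betw z {1..N} X"
    using ex_bij_betw_nat_finite_1[OF assms(1)] assms(2) by auto
  have "z \<in> {1..N} \<rightarrow> K" using z assms(3) by (auto simp: bij_betw_def)
  moreover have "elog (\<Prod>(i, j)\<in>pairs_upto N. norm (z j - z i)) = ereal (ln (vdm X) / 2)"
    using elog_prod_pairs[of z N] z by (simp add: bij_betw_def)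
  ultimately show ?thesis unfolding max_elog_def by (metis (no_types, lifting) SUP_upper)
qed

lemma max_elog_le:
  assumes "\<And>X. finite X \<Longrightarrow> card X = N \<Longrightarrow> X \<subseteq> K \<Longrightarrow> ereal (ln (vdm X) / 2) \<le> B"
  shows "max_elog N K \<le> B"
  unfolding max_elog_def
proof (rule SUP_least)
  fix z assume z: "z \<in> {1..N} \<rightarrow> K"
  show "elog (\<Prod>(i, j)\<in>pairs_upto N. norm (z j - z i)) \<le> B"
  proof (cases "inj_on z {1..N}")
    case True
    have "finite (z ` {1..N})" "card (z ` {1..N}) = N" "z ` {1..N} \<subseteq> K"
      using True z by (auto simp: card_image)
    then show ?thesis unfolding elog_prod_pairs[OF True] by (rule assms)
  next
    case False
    show ?thesis unfolding elog_prod_pairs_not_inj[OF False] by simp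
  qed
qed

text \<open>Removing a point loses the pairs containing it; each pair survives in all but two of the
  \<open>card X\<close> subsets.\<close>

lemma sum_ln_vdm_remove:
  assumes "finite X"
  shows "(\<Sum>x\<in>X. ln (vdm (X - {x}))) = (real (card X) - 2) * ln (vdm X)"
proof -
  define p where "p x = (\<Prod>x'\<in>X - {x}. norm (x - x'))" for x
  have p: "p x > 0" for x unfolding p_def by (intro prod_pos) auto
  have "ln (vdm (X - {x})) = ln (vdm X) - 2 * ln (p x)" if "x \<in> X" for x
  proof -
    have "vdm X = vdm (X - {x}) * (p x)^2"
      using vdm_insert[of "X - {x}" x] that assms by (simp add: insert_absorb p_def)
    then show ?thesis using p[of x] vdm_pos[of "X - {x}"] assms by (simp add: ln_mult ln_realpow)
  qed
  then have "(\<Sum>x\<in>X. ln (vdm (X - {x}))) = real (card X) * ln (vdm X) - 2 * (\<Sum>x\<in>X. ln (p x))"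
    by (simp add: sum_subtractf sum_distrib_left)
  also have "(\<Sum>x\<in>X. ln (p x)) = ln (vdm X)"
    unfolding vdm_def p_def[symmetric] using p by (intro ln_prod[symmetric] assms) (auto simp: less_imp_neq[symmetric])
  finally show ?thesis by (simp add: algebra_simps)
qed

text \<open>The \<open>N\<close>-point bound is averaged over the subsets of \<open>N + 1\<close>
  points that omit one point. \<open>K\<close> is arbitrary here, so an infinite supremum is handled
  separately; minus infinity cannot occur once \<open>N + 1\<close> distinct points exist.\<close>

lemma log_diam_Suc_le:
  assumes N: "N \<ge> 2"
  shows "log_diam (Suc N) K \<le> log_diam N K"
proof -
  define S where "S = max_elog N K"
  define \<kappa> where "\<kappa> = (real N + 1) / (real N - 1)"
  have \<kappa>: "\<kappa> > 0" using N by (simp add: \<kappa>_def)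
  have "max_elog (Suc N) K \<le> ereal \<kappa> * S"
  proof (rule max_elog_le)
    fix X assume X: "finite X" "card X = Suc N" "X \<subseteq> K"
    have ge: "ereal (ln (vdm (X - {x})) / 2) \<le> S" if "x \<in> X" for x
      unfolding S_def using X that by (intro max_elog_ge) auto
    obtain x0 where x0: "x0 \<in> X" using X(2) by fastforce
    show "ereal (ln (vdm X) / 2) \<le> ereal \<kappa> * S"
    proof (cases S)
      case (real s)
      have "(\<Sum>x\<in>X. ln (vdm (X - {x}))) \<le> (\<Sum>x\<in>X. 2 * s)"
        using ge real by (intro sum_mono) (auto simp: mult.commute)
      then have "(real N - 1) * ln (vdm X) \<le> (real N + 1) * (2 * s)"
        using sum_ln_vdm_remove[OF X(1)] X(2) by (simp add: algebra_simps)
      then have "ln (vdm X) \<le> (real N + 1) * (2 * s) / (real N - 1)"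
        using N by (subst pos_le_divide_eq) (auto simp: mult.commute)
      then show ?thesis using real by (simp add: \<kappa>_def mult_ac)
    next
      case PInf
      then show ?thesis using \<kappa> by simp
    next
      case MInf
      then show ?thesis using ge[OF x0] by simp
    qed
  qed
  then have "log_diam (Suc N) K \<le> ereal (2 / (real (Suc N) * (real (Suc N) - 1))) * (ereal \<kappa> * S)"
    unfolding log_diam_eq by (intro ereal_mult_left_mono) auto
  also have "\<dots> = ereal (2 / (real (Suc N) * (real (Suc N) - 1)) * \<kappa>) * S"
    by (metis ereal_times(1) mult.assoc times_ereal.simps(1))
  also have "2 / (real (Suc N) * (real (Suc N) - 1)) * \<kappa> = 2 / (real N * (real N - 1))"
  proof -
    have "2 / (a * b) * (a / c) = 2 / (b * c)" if "a > 0" "b > 0" "c > 0" for a b c :: real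
      using that by (simp add: field_simps)
    from this[of "real N + 1" "real N" "real N - 1"] show ?thesis using N by (simp add: \<kappa>_def add.commute)
  qed
  finally show ?thesis by (simp add: log_diam_eq S_def)
qed

text \<open>Monotonicity makes the sequence converge, so it suffices to bound it along
  \<open>N = q ^ k\<close>, where the term with \<open>A\<close> vanishes in the limit and division
  by the number of pairs turns the quadratic term into \<open>- c\<close>.\<close>

lemma log_transfinite_diam_le:
  fixes q :: nat and A c :: real
  assumes q: "q \<ge> 2" and c: "c \<ge> 0"
    and bound: "\<And>k X. k \<ge> k0 \<Longrightarrow> X \<subseteq> T \<Longrightarrow> finite X \<Longrightarrow> card X = q ^ k \<Longrightarrow>
      ln (vdm X) \<le> A * real (k + 1) * real q ^ k - c * (real q ^ k)^2"
  shows "log_transfinite_diam T \<le> ereal (- c)"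
proof -
  define g where "g N = log_diam N T" for N
  \<comment> \<open>The shift by 2 skips the indices 0 and 1, where the normalising factor is
    degenerate.\<close>
  have dec: "decseq (\<lambda>N. g (N + 2))"
    by (rule decseq_SucI) (simp add: g_def log_diam_Suc_le)
  obtain L where "(\<lambda>N. g (N + 2)) \<longlonglongrightarrow> L" using LIMSEQ_INF[OF dec] by blast
  then have gL: "g \<longlonglongrightarrow> L" by (rule LIMSEQ_offset)
  then have "log_transfinite_diam T = L"
    unfolding log_transfinite_diam_def g_def[symmetric] by (rule limI)
  moreover have "L \<le> ereal (- c)"
  proof (rule LIMSEQ_le)
    have "strict_mono (\<lambda>k. q ^ k)" using q by (intro strict_monoI power_strict_increasing) auto
    then show "(\<lambda>k. g (q ^ k)) \<longlonglongrightarrow> L" using LIMSEQ_subseq_LIMSEQ[OF gL] by (simp add: o_def)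
    have "(\<lambda>k. (\<bar>A\<bar> * real (k + 1)) * 2 / 2 ^ k - c) \<longlonglongrightarrow> - c" by real_asymp
    then show "(\<lambda>k. ereal ((\<bar>A\<bar> * real (k + 1)) * 2 / 2 ^ k - c)) \<longlonglongrightarrow> ereal (- c)" by simp
    show "\<exists>N. \<forall>k\<ge>N. g (q ^ k) \<le> ereal ((\<bar>A\<bar> * real (k + 1)) * 2 / 2 ^ k - c)"
    proof (intro exI[of _ "Suc k0"] allI impI)
      fix k assume k: "k \<ge> Suc k0"
      define N where "N = real q ^ k"
      have "(2::real) ^ 1 \<le> 2 ^ k" using k by (intro power_increasing) auto
      moreover have "2 ^ k \<le> N" unfolding N_def using q by (intro power_mono) auto
      ultimately have N: "N \<ge> 2 ^ k" "N \<ge> 2" by auto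
      define b where "b = (A * real (k + 1) * N - c * N^2) / 2"
      have "max_elog (q ^ k) T \<le> ereal b"
        using bound[of k] k by (intro max_elog_le) (auto simp: b_def N_def)
      then have "g (q ^ k) \<le> ereal (2 / (N * (N - 1))) * ereal b"
        unfolding g_def log_diam_eq N_def of_nat_power[symmetric] using N
        by (intro ereal_mult_left_mono) (auto simp: N_def)
      also have "\<dots> = ereal (2 / (N * (N - 1)) * b)" by simp
      also have "2 / (N * (N - 1)) * b = A * real (k + 1) / (N - 1) - c * (N / (N - 1))"
      proof -
        have "2 / (N * M) * ((a * N - c * N^2) / 2) = a / M - c * (N / M)" if "M > 0" "N > 0" for a M N :: real
          using that by (simp add: field_simps power2_eq_square)
        from this[of "N - 1" N "A * real (k + 1)"] show ?thesis using N(2) by (simp add: b_def)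
      qed
      also have "\<dots> \<le> (\<bar>A\<bar> * real (k + 1)) * 2 / 2 ^ k - c"
      proof -
        have "A * real (k + 1) / (N - 1) \<le> \<bar>A\<bar> * real (k + 1) / (N / 2)"
          using N(2) by (intro frac_le) (auto intro!: mult_right_mono)
        also have "\<dots> \<le> \<bar>A\<bar> * real (k + 1) / (2 ^ k / 2)"
          using N by (intro divide_left_mono divide_right_mono) auto
        finally have "A * real (k + 1) / (N - 1) \<le> (\<bar>A\<bar> * real (k + 1)) * 2 / 2 ^ k" by simp
        moreover have "c * 1 \<le> c * (N / (N - 1))" using c N(2) by (intro mult_left_mono) auto
        ultimately show ?thesis by simp
      qed
      finally show "g (q ^ k) \<le> ereal ((\<bar>A\<bar> * real (k + 1)) * 2 / 2 ^ k - c)" by simp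
    qed
  qed
  ultimately show ?thesis by simp
qed

section \<open>Arcs and lemniscate domains\<close>

text \<open>The tree has two vertices and one edge; a cycle would need three distinct
  vertices.\<close>

lemma finite_topological_tree_arc:
  assumes "arc p"
  shows "finite_topological_tree (path_image p)"
proof -
  define a b where "a = pathstart p" and "b = pathfinish p"
  have ab: "a \<noteq> b" using arc_distinct_ends[OF assms] by (auto simp: a_def b_def)
  have sub: "{a, b} \<subseteq> path_image p" by (auto simp: a_def b_def)
  have nocycle: "\<not> graph_cycle {{a, b}} vs" for vs
  proof
    assume c: "graph_cycle {{a, b}} vs"
    then have "set vs \<subseteq> {a, b}"
      unfolding graph_cycle_def by (metis (no_types, lifting) in_set_conv_nth insertI1 singletonD subsetI)
    then have "card (set vs) \<le> card {a, b}" by (intro card_mono) auto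
    also have "\<dots> \<le> 2" by (simp add: card_insert_if)
    finally show False using c by (auto simp: graph_cycle_def distinct_card)
  qed
  have con: "graph_connected {a, b} {{a, b}}"
    unfolding graph_connected_def by (auto intro!: r_into_rtrancl simp: insert_commute)
  have "finite_tree {a, b} {{a, b}}"
    unfolding finite_tree_def using nocycle con ab by auto
  then show ?thesis
    unfolding finite_topological_tree_def using assms sub
    by (intro exI[of _ "{a, b}"] exI[of _ "{{a, b}}"] exI[of _ "\<lambda>_. p"]) (auto simp: a_def b_def)
qed

text \<open>A short segment in \<open>G\<close>, carrying as many marked points as \<open>Z\<close>
  has, is mapped by a homeomorphism of the plane that takes the marked points to \<open>Z\<close>
  and is the identity off \<open>G\<close>. Hence the image of the segment stays in
  \<open>G\<close>.\<close>

lemma arc_through_finite_set: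
  fixes G :: "complex set"
  assumes G: "open G" "connected G" and Z: "finite Z" "Z \<noteq> {}" "Z \<subseteq> G"
  shows "\<exists>p. arc p \<and> Z \<subseteq> path_image p \<and> path_image p \<subseteq> G"
proof -
  define D where "D = card Z"
  have D: "D > 0" using Z by (simp add: D_def card_gt_0_iff)
  obtain y where y: "bij_betw y {..<D} Z" using ex_bij_betw_nat_finite[OF Z(1)] by (auto simp: D_def lessThan_atLeast0)
  obtain z0 where z0: "z0 \<in> Z" using Z by blast
  obtain e where e: "e > 0" "cball z0 e \<subseteq> G" using G(1) Z(3) z0 open_contains_cball by blast
  define q where "q = linepath z0 (z0 + of_real e)"
  have qG: "q t \<in> G" if "t \<in> {0..1}" for t
  proof -
    have "q t = z0 + of_real (t * e)" by (simp add: q_def linepath_def algebra_simps scaleR_conv_of_real)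
    then have "dist z0 (q t) = norm (of_real (t * e) :: complex)" by (simp add: dist_norm del: of_real_mult)
    also have "\<dots> = \<bar>t * e\<bar>" by (rule norm_of_real)
    also have "\<dots> \<le> e" using that e(1) mult_right_mono[of t 1 e] by simp
    finally have "dist z0 (q t) \<le> e" .
    then show ?thesis using e(2) by auto
  qed
  have arcq: "arc q" unfolding q_def using e(1) by (intro arc_linepath) auto
  define x where "x i = q (real i / real D)" for i :: nat
  have tI: "real i / real D \<in> {0..1}" if "i < D" for i using that by auto
  have injx: "x i \<noteq> x j" if "i < D" "j < D" "i \<noteq> j" for i j
  proof
    assume "x i = x j"
    then have "real i / real D = real j / real D"
      using arcq tI that unfolding arc_def x_def by (meson inj_onD)
    then show False using D that by simp
  qed
  obtain h k where hk: "homeomorphism UNIV UNIV h k" "\<And>i. i \<in> {..<D} \<Longrightarrow> h (x i) = y i"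
      "{x. \<not> (h x = x \<and> k x = x)} \<subseteq> G"
  proof (rule homeomorphism_moving_points_exists[of G UNIV "{..<D}" x y])
    show "x i \<in> G \<and> y i \<in> G" if "i \<in> {..<D}" for i
      using that qG tI y Z(3) unfolding x_def by (auto simp: bij_betw_def)
    show "pairwise (\<lambda>i j. x i \<noteq> x j \<and> y i \<noteq> y j) {..<D}"
      using injx y by (auto simp: pairwise_def bij_betw_def inj_on_def)
    have "affine hull G = UNIV" using G(1) Z by (intro affine_hull_open) auto
    then show "UNIV \<subseteq> affine hull G" by simp
  qed (use G in auto)
  have hc: "continuous_on UNIV h" "\<And>x. k (h x) = x" using hk(1) by (auto simp: homeomorphism_def)
  define p where "p = h \<circ> q"
  have "path p" unfolding p_def using arcq hc(1) by (intro path_continuous_image) (auto simp: arc_def elim: continuous_on_subset)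
  moreover have "inj_on p {0..1}"
    using arcq hc(2) unfolding p_def arc_def by (metis comp_inj_on inj_on_def)
  ultimately have "arc p" by (simp add: arc_def)
  moreover have "Z \<subseteq> path_image p"
  proof
    fix z assume "z \<in> Z"
    then obtain i where i: "i < D" "y i = z" using y by (auto simp: bij_betw_def)
    then have "p (real i / real D) = z" using hk(2) by (simp add: p_def x_def)
    then show "z \<in> path_image p" unfolding path_image_def using tI[OF i(1)] by blast
  qed
  moreover have "path_image p \<subseteq> G"
  proof
    fix u assume "u \<in> path_image p"
    then obtain t where t: "t \<in> {0..1}" "u = h (q t)" by (auto simp: path_image_def p_def)
    show "u \<in> G"
    proof (rule ccontr)
      assume "u \<notin> G"
      then have "k u = u" using hk(3) by auto
      then have "u = q t" using t(2) hc(2) by metis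
      then show False using qG[OF t(1)] \<open>u \<notin> G\<close> by simp
    qed
  qed
  ultimately show ?thesis by blast
qed

text \<open>The complement of a component of \<open>M\<close> is connected, as \<open>- M\<close>
  is, and unbounded; an open connected plane set with such a complement is simply connected.\<close>

lemma simply_connected_components:
  fixes M :: "complex set"
  assumes "open M" "connected (- M)" "\<not> bounded (- M)" "C \<in> components M"
  shows "simply_connected C"
proof -
  have opC: "open C" and conC: "connected C" using assms open_components in_components_connected by blast+
  have con: "connected (- C)" using component_complement_connected[of "- M" C] assms by simp
  have "- M \<subseteq> - C" using assms(4) in_components_subset by blast
  then have unb: "\<not> bounded (- C)" using assms(3) bounded_subset by blast
  have "\<not> bounded B" if "B \<in> components (- C)" for B
  proof -
    have "- C \<noteq> {}" using unb by auto
    then have "components (- C) = {- C}" using con by (simp add: components_eq_sing_iff)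
    then show ?thesis using that unb by simp
  qed
  then show ?thesis unfolding simply_connected_eq_unbounded_complement_components[OF opC] using conC by blast
qed

text \<open>The exterior of the disc cannot be removed at once, since it is not simply connected.
  Cut along the positive ray it is: this leaves the disc with a strip \<open>S\<close> around the
  ray, and the strip, being convex, is removed second. No critical value lies outside the disc of
  radius \<open>R1\<close>, so both removals pull back.\<close>

lemma lemniscate_connected:
  fixes g :: "complex poly"
  assumes deg: "degree g > 0" and R: "0 < R1" "R1 < R"
    and crit: "\<And>z. poly (pderiv g) z = 0 \<Longrightarrow> norm (poly g z) \<le> R1"
  shows "connected (poly g -` ball 0 R)"
proof -
  define S where "S = {z. Re z > R1} \<inter> {z. Im z < 1} \<inter> {z. Im z > -1}"
  have convS: "convex S" unfolding S_def
    by (intro convex_Int convex_halfspace_Re_gt convex_halfspace_Im_lt convex_halfspace_Im_gt)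
  have opS: "open S" unfolding S_def
    by (intro open_Int open_halfspace_Re_gt open_halfspace_Im_lt open_halfspace_Im_gt)
  have ray: "{z. Im z = 0 \<and> Re z \<ge> 0} = {z. Im z = 0} \<inter> {z. Re z \<ge> 0}" by auto
  define A where "A = ball 0 R \<union> S"
  define M where "M = - (cball 0 R1 \<union> {z. Im z = 0 \<and> Re z \<ge> 0})"
  have convray: "convex {z. Im z = 0 \<and> Re z \<ge> 0}" unfolding ray
    by (intro convex_Int convex_halfspace_Re_ge) (auto simp: convex_def)
  define \<mu> where "\<mu> = (R1 + R) / 2"
  have \<mu>: "R1 < \<mu>" "\<mu> < R" using R by (auto simp: \<mu>_def)
  have "of_real \<mu> \<in> ball 0 R \<inter> S"
    using R \<mu> by (auto simp: S_def)
  then have mid: "ball 0 R \<inter> S \<noteq> {}" by blast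
  have "open A" unfolding A_def using opS by auto
  have conA: "connected A" unfolding A_def
    using mid convS by (intro connected_Un convex_connected) auto
  have clray: "closed {z. Im z = 0 \<and> Re z \<ge> 0}" unfolding ray
    by (intro closed_Int closed_halfspace_Re_ge closed_Collect_eq continuous_intros)
  have opM: "open M" unfolding M_def using clray by (intro open_Compl closed_Un) auto
  have "A \<union> M = UNIV"
  proof -
    have "z \<in> A" if "norm z \<le> R1 \<or> Im z = 0 \<and> Re z \<ge> 0" for z
    proof (cases "norm z < R")
      case False
      then have z: "Im z = 0" "Re z \<ge> 0" "norm z \<ge> R" using that R by auto
      then have "norm z = Re z" by (simp add: norm_complex_def)
      then show ?thesis using z R by (auto simp: A_def S_def)
    qed (simp add: A_def)
    then show ?thesis by (auto simp: M_def)
  qed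
  have scM: "simply_connected C" if "C \<in> components M" for C
  proof (rule simply_connected_components[OF opM _ _ that])
    have "0 \<in> cball 0 R1 \<inter> {z. Im z = 0 \<and> Re z \<ge> 0}" using R by simp
    then have "cball 0 R1 \<inter> {z. Im z = 0 \<and> Re z \<ge> 0} \<noteq> {}" by blast
    then show "connected (- M)" unfolding M_def double_complement
      using convray by (intro connected_Un convex_connected) auto
    show "\<not> bounded (- M)"
    proof
      assume "bounded (- M)"
      then obtain B where B: "\<And>z. z \<in> - M \<Longrightarrow> norm z \<le> B" by (auto simp: bounded_iff)
      have "of_real (\<bar>B\<bar> + 1) \<in> - M" by (simp add: M_def)
      then show False using B[of "of_real (\<bar>B\<bar> + 1)"] by simp
    qed
  qed
  have 1: "connected (poly g -` A)"
  proof (rule connected_preimage_subset[OF deg opM _ scM \<open>open A\<close>])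
    show "poly (pderiv g) z \<noteq> 0" if "poly g z \<in> M" for z
      using crit[of z] that by (auto simp: M_def)
    show "connected (A \<inter> C) \<and> A \<inter> C \<noteq> {}" if "C \<in> components M" for C
      using \<open>open A\<close> conA mid opM that \<open>A \<union> M = UNIV\<close>
      by (intro connected_Int_component) (auto simp: A_def convex_imp_simply_connected)
    show "connected (poly g -` (A \<union> M))" by (simp add: \<open>A \<union> M = UNIV\<close> connected_UNIV)
  qed
  have compS: "components S = {S}" using convS mid by (auto simp: components_eq_sing_iff convex_connected)
  show ?thesis
  proof (rule connected_preimage_subset[OF deg opS])
    show "poly (pderiv g) z \<noteq> 0" if "poly g z \<in> S" for z
      using crit[of z] that complex_Re_le_cmod[of "poly g z"] by (auto simp: S_def)
    show "simply_connected C" if "C \<in> components S" for C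
      using that convS by (simp add: compS convex_imp_simply_connected)
    show "connected (ball 0 R \<inter> C) \<and> ball 0 R \<inter> C \<noteq> {}" if "C \<in> components S" for C
      using that convS mid by (auto simp: compS intro!: convex_connected convex_Int)
    show "connected (poly g -` (ball 0 R \<union> S))" using 1 by (simp add: A_def)
  qed auto
qed

text \<open>No component of the complement is bounded: from any of its points the radial ray of
  values towards infinity lifts to a path that stays in the component and along which
  \<open>g\<close> is unbounded.\<close>

lemma lemniscate_simply_connected:
  fixes g :: "complex poly"
  assumes deg: "degree g > 0" and R: "0 < R1" "R1 < R"
    and crit: "\<And>z. poly (pderiv g) z = 0 \<Longrightarrow> norm (poly g z) \<le> R1"
  shows "simply_connected (poly g -` ball 0 R)"
proof -
  define W where "W = poly g -` ball 0 R"
  have opW: "open W" unfolding W_def by (intro open_poly_vimage) auto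
  have "\<not> bounded B" if B: "B \<in> components (- W)" for B
  proof
    assume bd: "bounded B"
    obtain z where z: "z \<in> B" using B in_components_nonempty by blast
    then have gz: "norm (poly g z) \<ge> R" using B in_components_subset by (force simp: W_def)
    define U where "U = - (cball 0 R1 :: complex set)"
    have nc: "open U" "\<And>z. poly g z \<in> U \<Longrightarrow> poly (pderiv g) z \<noteq> 0"
      using crit by (auto simp: U_def)
    have ge: "norm (poly g z * of_real (1 + t)) \<ge> R" if "t \<ge> 0" for t
    proof -
      have "R * 1 \<le> norm (poly g z) * (1 + t)" using gz that R by (intro mult_mono) auto
      then show ?thesis using that by (simp add: norm_mult del: of_real_add)
    qed
    obtain h where h: "continuous_on {0::real..} h" "h 0 = z"
        "\<And>t. t \<in> {0..} \<Longrightarrow> poly g (h t) = poly g z * of_real (1 + t)"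
    proof (rule covering_space_lift_strong[OF poly_covering_space[OF deg nc], of z 0 "{0::real..}" "\<lambda>t. poly g z * of_real (1 + t)"])
      show "simply_connected {0::real..}" by (intro convex_imp_simply_connected) auto
      show "locally path_connected {0::real..}" by (intro convex_imp_locally_path_connected) auto
      show "(\<lambda>t. poly g z * of_real (1 + t)) \<in> {0..} \<rightarrow> U"
        using ge R by (force simp: U_def)
      show "z \<in> poly g -` U" using gz R by (simp add: U_def)
    qed (auto intro!: continuous_intros)
    have hB: "h ` {0..} \<subseteq> B"
    proof (rule components_maximal[OF B])
      show "connected (h ` {0..})" using h(1) by (intro connected_continuous_image) auto
      show "h ` {0..} \<subseteq> - W" using h(3) ge by (force simp: W_def)
      show "B \<inter> h ` {0..} \<noteq> {}" using z h(2) by force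
    qed
    have "bounded (poly g ` B)"
    proof -
      have "compact (poly g ` closure B)"
        using bd by (intro compact_continuous_image continuous_intros) auto
      then show ?thesis using closure_subset compact_imp_bounded bounded_subset by (metis image_mono)
    qed
    then obtain c where c: "\<And>x. x \<in> B \<Longrightarrow> norm (poly g x) \<le> c" by (auto simp: bounded_iff)
    define t where "t = \<bar>c\<bar> / R"
    have t: "t \<ge> 0" using R by (simp add: t_def)
    have "h t \<in> B" using hB t by auto
    then have "norm (poly g z) * (1 + t) \<le> c"
      using c[of "h t"] h(3)[of t] t by (simp add: norm_mult del: of_real_add)
    moreover have "R * (1 + t) \<le> norm (poly g z) * (1 + t)" using gz t by (intro mult_right_mono) auto
    moreover have "R * (1 + t) = R + \<bar>c\<bar>" using R by (simp add: t_def field_simps)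
    ultimately show False using R by linarith
  qed
  then show ?thesis
    using lemniscate_connected[OF assms] simply_connected_eq_unbounded_complement_components[OF opW]
    unfolding W_def by blast
qed

context pcf_dynamics
begin

text \<open>The radius \<open>2 * R0\<close> leaves a gap above the critical values of the iterates,
  which lie in \<open>K\<close>; by doubling, it also forces the iterate preceding the
  \<open>N\<close>-th to have modulus at most \<open>R0\<close>.\<close>

definition W :: "nat \<Rightarrow> complex set" where
  "W N = F N -` ball 0 (2 * R0)"

lemma W_eq: "W N = poly (iter_poly f N) -` ball 0 (2 * R0)"
  by (simp add: W_def poly_iter_poly)

lemma W_crit: "poly (pderiv (iter_poly f N)) z = 0 \<Longrightarrow> norm (poly (iter_poly f N) z) \<le> R0"
  using pderiv_iter_eq_0[of N z] P_interior interior_subset mem_K_iff[of "F N z"]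
  by (metis funpow_0 less_imp_le poly_iter_poly subsetD)

lemma simply_connected_W: "simply_connected (W N)"
  unfolding W_eq using R0(1) W_crit by (intro lemniscate_simply_connected[of _ R0] degree_iter_pos) auto

lemma open_W: "open (W N)"
  unfolding W_def by (intro open_iter_vimage) auto

lemma connected_W: "connected (W N)"
  using simply_connected_W simply_connected_imp_connected by blast

lemma W_preimage: "F n -` W N = W (N + n)"
  by (auto simp: W_def iter_poly_add)

lemma W_bounded: "W N \<subseteq> ball 0 (2 * R0)"
proof
  fix z assume "z \<in> W N"
  then have z: "norm (F N z) < 2 * R0" by (simp add: W_def)
  show "z \<in> ball 0 (2 * R0)"
  proof (cases "R0 \<le> norm z")
    case True
    then show ?thesis using norm_iter_ge_self[of z N] z by simp
  next
    case False
    then show ?thesis using R0(1) by simp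
  qed
qed

lemma connected_compl_W: "connected (- W N)"
  using simply_connected_W simply_connected_iff_simple[OF open_W] W_bounded bounded_ball bounded_subset by metis

lemma K_subset_W: "K \<subseteq> W N"
proof
  fix z assume "z \<in> K"
  then have "norm (F N z) < R0" by (simp add: mem_K_iff)
  then show "z \<in> W N" using R0(1) by (simp add: W_def)
qed

end

section \<open>A parametrisation of the Julia set\<close>

text \<open>In the coordinate \<open>1 / z\<close> the map takes \<open>\<zeta>\<close> to
  \<open>\<beta> \<zeta> ^ d\<close> with \<open>\<beta> \<zeta> = \<zeta> * E \<zeta>\<close>,
  where \<open>E\<close> is a branch of the inverse \<open>d\<close>-th root of the reversed
  polynomial; \<open>b\<close> is the local inverse of \<open>\<beta>\<close>. The condition on
  \<open>Re (b x / x)\<close> will keep a straight homotopy away from 0.\<close>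

lemma inverse_branch_at_infinity:
  fixes f :: "complex poly"
  assumes monic: "lead_coeff f = 1" and deg: "degree f > 0" and \<epsilon>: "\<epsilon> > 0"
  obtains b c where "0 < c" "continuous_on (ball 0 c) b" "inj_on b (ball 0 c)"
    "\<And>x. x \<in> ball 0 c \<Longrightarrow> x \<noteq> 0 \<Longrightarrow> b x \<noteq> 0 \<and> norm (b x) < \<epsilon> \<and> Re (b x / x) > 0 \<and>
        poly f (1 / b x) = 1 / x ^ degree f"
proof -
  define d where "d = degree f"
  define r where "r = reflect_poly f"
  have r0: "poly r 0 = 1" using monic by (simp add: r_def)
  define E where "E \<zeta> = exp (- Ln (poly r \<zeta>) / of_nat d)" for \<zeta>
  have E0: "E 0 = 1" by (simp add: E_def r0)
  have "isCont (poly r) 0" by simp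
  then obtain \<delta>1 where \<delta>1: "\<delta>1 > 0" "\<And>x. norm x < \<delta>1 \<Longrightarrow> norm (poly r x - 1) < 1"
    unfolding continuous_at_eps_delta using r0 by (metis dist_norm diff_zero zero_less_one)
  have nonneg: "poly r \<zeta> \<notin> \<real>\<^sub>\<le>\<^sub>0" if "norm \<zeta> < \<delta>1" for \<zeta>
  proof -
    have "\<bar>Re (poly r \<zeta> - 1)\<bar> < 1" using \<delta>1(2)[OF that] abs_Re_le_cmod le_less_trans by blast
    then have "Re (poly r \<zeta>) > 0" by simp
    then show ?thesis by (auto simp: complex_nonpos_Reals_iff)
  qed
  have holE: "E holomorphic_on ball 0 \<delta>1"
    unfolding E_def using deg nonneg by (intro holomorphic_intros poly_holomorphic) (auto simp: d_def)
  then have "isCont E 0"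
    using \<delta>1(1) by (meson centre_in_ball continuous_on_eq_continuous_at holomorphic_on_imp_continuous_on open_ball)
  then obtain \<delta>2 where \<delta>2: "\<delta>2 > 0" "\<And>x. norm x < \<delta>2 \<Longrightarrow> norm (E x - 1) < 1"
    unfolding continuous_at_eps_delta using E0 by (metis dist_norm diff_zero zero_less_one)
  define \<delta> where "\<delta> = min \<epsilon> (min \<delta>1 \<delta>2)"
  have \<delta>: "\<delta> > 0" using \<delta>1(1) \<delta>2(1) \<epsilon> by (simp add: \<delta>_def)
  have ReE: "Re (E \<zeta>) > 0" if "norm \<zeta> < \<delta>" for \<zeta>
  proof -
    have "\<bar>Re (E \<zeta> - 1)\<bar> < 1" using \<delta>2(2)[of \<zeta>] that abs_Re_le_cmod[of "E \<zeta> - 1"] by (simp add: \<delta>_def)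
    then show ?thesis by simp
  qed
  define \<beta> where "\<beta> \<zeta> = \<zeta> * E \<zeta>" for \<zeta>
  have hol\<beta>: "\<beta> holomorphic_on ball 0 \<delta>"
    unfolding \<beta>_def using holE by (intro holomorphic_intros) (auto simp: \<delta>_def elim!: holomorphic_on_subset)
  have "deriv \<beta> 0 = 1"
  proof -
    have "(E has_field_derivative deriv E 0) (at 0)"
      using holE \<delta>1(1) by (intro holomorphic_derivI[of E "ball 0 \<delta>1"]) auto
    then have "((\<lambda>\<zeta>. \<zeta> * E \<zeta>) has_field_derivative 1) (at 0)"
      by (auto intro!: derivative_eq_intros simp: E0)
    then show ?thesis unfolding \<beta>_def by (rule DERIV_imp_deriv)
  qed
  then have dn: "deriv \<beta> 0 \<noteq> 0" by simp
  have "(0::complex) \<in> ball 0 \<delta>" using \<delta> by simp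
  then obtain \<rho> where \<rho>: "\<rho> > 0" "ball (0::complex) \<rho> \<subseteq> ball 0 \<delta>" "open (\<beta> ` ball 0 \<rho>)" "inj_on \<beta> (ball 0 \<rho>)"
    using has_complex_derivative_locally_invertible[OF hol\<beta> _ open_ball dn] by blast
  have "\<beta> 0 = 0" "(0::complex) \<in> ball 0 \<rho>" using \<rho>(1) by (auto simp: \<beta>_def)
  then have "0 \<in> \<beta> ` ball 0 \<rho>" by (metis image_eqI)
  then obtain c where c: "c > 0" "ball 0 c \<subseteq> \<beta> ` ball 0 \<rho>"
    using openE[OF \<rho>(3)] by (metis (no_types))
  have "continuous_on (ball 0 \<rho>) \<beta>"
    using hol\<beta> \<rho>(2) holomorphic_on_imp_continuous_on holomorphic_on_subset by blast
  then obtain b where b: "homeomorphism (ball 0 \<rho>) (\<beta> ` ball 0 \<rho>) \<beta> b"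
    using invariance_of_domain_homeomorphism[OF open_ball _ _ \<rho>(4)] by auto
  have bi: "b x \<in> ball 0 \<rho>" "\<beta> (b x) = x" if "x \<in> ball 0 c" for x
    using b c(2) that unfolding homeomorphism_def by (auto simp: subset_iff)
  show ?thesis
  proof (rule that[of c b])
    show "continuous_on (ball 0 c) b" using b c(2) unfolding homeomorphism_def by (metis continuous_on_subset)
    show "inj_on b (ball 0 c)" using bi(2) by (metis inj_onI)
    fix x assume x: "x \<in> ball (0::complex) c" "x \<noteq> 0"
    define \<zeta> where "\<zeta> = b x"
    have "\<zeta> \<in> ball 0 \<delta>" using bi(1)[OF x(1)] \<rho>(2) unfolding \<zeta>_def by blast
    then have \<zeta>: "norm \<zeta> < \<delta>" "\<zeta> * E \<zeta> = x" using bi(2)[OF x(1)] by (auto simp: \<zeta>_def \<beta>_def)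
    then have \<zeta>0: "\<zeta> \<noteq> 0" using x(2) by auto
    have En: "E \<zeta> \<noteq> 0" by (simp add: E_def)
    have "\<zeta> / x = 1 / E \<zeta>" using \<zeta>(2) \<zeta>0 En x(2) by (simp add: field_simps)
    moreover have "Re (1 / E \<zeta>) > 0"
      using ReE[OF \<zeta>(1)] En by (simp add: Re_divide complex_eq_iff power2_eq_square add_pos_nonneg zero_less_divide_iff)
    ultimately have 1: "Re (\<zeta> / x) > 0" by simp
    have rn: "poly r \<zeta> \<noteq> 0" using nonneg[of \<zeta>] \<zeta>(1) by (auto simp: \<delta>_def)
    have "E \<zeta> ^ d = exp (of_nat d * (- Ln (poly r \<zeta>) / of_nat d))"
      unfolding E_def by (rule exp_of_nat_mult[symmetric])
    also have "\<dots> = inverse (poly r \<zeta>)" using deg rn by (simp add: d_def exp_minus)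
    finally have Ed: "E \<zeta> ^ d = inverse (poly r \<zeta>)" .
    have "poly r \<zeta> = \<zeta> ^ d * poly f (inverse \<zeta>)"
      using \<zeta>0 by (simp add: r_def poly_reflect_poly_nz d_def)
    then have "poly f (1 / \<zeta>) = poly r \<zeta> / \<zeta> ^ d" using \<zeta>0 by (simp add: divide_inverse)
    also have "\<dots> = 1 / (\<zeta> ^ d * E \<zeta> ^ d)" using rn by (simp add: Ed field_simps)
    also have "\<zeta> ^ d * E \<zeta> ^ d = x ^ d" by (metis \<zeta>(2) power_mult_distrib)
    finally have 2: "poly f (1 / \<zeta>) = 1 / x ^ d" .
    show "b x \<noteq> 0 \<and> norm (b x) < \<epsilon> \<and> Re (b x / x) > 0 \<and> poly f (1 / b x) = 1 / x ^ degree f"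
      using \<zeta>0 \<zeta>(1) 1 2 by (auto simp: \<zeta>_def \<delta>_def d_def)
  qed (rule c(1))
qed

text \<open>The mean value inequality is applied to \<open>f\<close> minus its linear part at
  \<open>y\<close>. Uniform continuity of the derivative makes \<open>r\<close> independent of
  \<open>y\<close>, and \<open>y'\<close> is free to leave \<open>S\<close>.\<close>

lemma expansion_of_deriv_bound:
  fixes f :: "complex poly"
  assumes S: "\<And>y. y \<in> S \<Longrightarrow> norm y \<le> B" "\<And>y. y \<in> S \<Longrightarrow> \<kappa> \<le> norm (poly (pderiv f) y)" and \<kappa>': "\<kappa>' < \<kappa>"
  shows "\<exists>r>0. \<forall>y\<in>S. \<forall>y'. norm (y' - y) \<le> r \<longrightarrow> \<kappa>' * norm (y' - y) \<le> norm (poly f y' - poly f y)"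
proof -
  have "uniformly_continuous_on (cball 0 (B + 1)) (poly (pderiv f))"
    by (intro compact_uniformly_continuous continuous_intros) auto
  then obtain r0 where r0: "r0 > 0" "\<And>x y. x \<in> cball 0 (B + 1) \<Longrightarrow> y \<in> cball 0 (B + 1) \<Longrightarrow> dist x y < r0 \<Longrightarrow>
      dist (poly (pderiv f) x) (poly (pderiv f) y) < \<kappa> - \<kappa>'"
    unfolding uniformly_continuous_on_def using \<kappa>' by (metis diff_gt_0_iff_gt)
  define r where "r = min 1 (r0 / 2)"
  have r: "r > 0" "r \<le> 1" "r < r0" using r0(1) by (auto simp: r_def)
  have "\<kappa>' * norm (y' - y) \<le> norm (poly f y' - poly f y)" if y: "y \<in> S" and y': "norm (y' - y) \<le> r" for y y'
  proof -
    define h where "h z = poly f z - poly (pderiv f) y * z" for z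
    have "norm (h y' - h y) \<le> (\<kappa> - \<kappa>') * norm (y' - y)"
    proof (rule field_differentiable_bound[of "cball y r" h "\<lambda>z. poly (pderiv f) z - poly (pderiv f) y"])
      show "(h has_field_derivative poly (pderiv f) z - poly (pderiv f) y) (at z within cball y r)" for z
        unfolding h_def by (auto intro!: derivative_eq_intros has_field_derivative_at_within[OF poly_DERIV])
      fix z assume z: "z \<in> cball y r"
      then have "norm z \<le> B + 1" using S(1)[OF y] r(2) norm_triangle_ineq2[of z y] by (simp add: dist_norm norm_minus_commute)
      then have "dist (poly (pderiv f) z) (poly (pderiv f) y) < \<kappa> - \<kappa>'"
        using z S(1)[OF y] r(3) by (intro r0(2)) (auto simp: dist_commute)
      then show "norm (poly (pderiv f) z - poly (pderiv f) y) \<le> \<kappa> - \<kappa>'" by (simp add: dist_norm)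
    qed (use r y' in \<open>auto simp: dist_norm norm_minus_commute\<close>)
    moreover have "poly (pderiv f) y * (y' - y) = (poly f y' - poly f y) - (h y' - h y)"
      by (simp add: h_def algebra_simps)
    then have "norm (poly (pderiv f) y) * norm (y' - y) \<le> norm (poly f y' - poly f y) + norm (h y' - h y)"
      by (metis norm_mult norm_triangle_ineq4)
    moreover have "\<kappa> * norm (y' - y) \<le> norm (poly (pderiv f) y) * norm (y' - y)"
      using S(2)[OF y] by (intro mult_right_mono) auto
    ultimately show ?thesis by (simp add: algebra_simps)
  qed
  then show ?thesis using r(1) by blast
qed

text \<open>Expansion is known only up to distance \<open>r\<close>. Within \<open>C\<close>,
  distance at most \<open>r\<close> from \<open>y\<close> forces distance less than
  \<open>r\<close>, because the image has diameter at most \<open>\<delta> < \<kappa> * r\<close>;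
  so these points form an open and closed subset, which is all of \<open>C\<close>.\<close>

lemma connected_contraction:
  fixes f :: "complex \<Rightarrow> complex"
  assumes C: "connected C" "C \<subseteq> S" and f: "continuous_on C f" and r: "r > 0" "\<kappa> > 0"
    and ex: "\<And>y y'. y \<in> S \<Longrightarrow> norm (y' - y) \<le> r \<Longrightarrow> \<kappa> * norm (y' - y) \<le> norm (f y' - f y)"
    and small: "\<And>y y'. y \<in> C \<Longrightarrow> y' \<in> C \<Longrightarrow> norm (f y' - f y) \<le> \<delta>" "\<delta> < \<kappa> * r"
    and y: "y \<in> C" "y' \<in> C"
  shows "\<kappa> * norm (y' - y) \<le> norm (f y' - f y)"
proof -
  define U where "U = {z \<in> C. norm (z - y) < r}"
  have eq: "U = {z \<in> C. norm (z - y) \<le> r}"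
  proof -
    have "norm (z - y) < r" if "z \<in> C" "norm (z - y) \<le> r" for z
    proof -
      have "\<kappa> * norm (z - y) \<le> \<delta>" using ex[of y z] small(1)[of y z] that y C(2) by fastforce
      then have "\<kappa> * norm (z - y) < \<kappa> * r" using small(2) by linarith
      then show ?thesis using r(2) by simp
    qed
    then show ?thesis by (auto simp: U_def)
  qed
  have "openin (top_of_set C) U"
  proof -
    have "U = C \<inter> ball y r" by (auto simp: U_def dist_norm norm_minus_commute)
    then show ?thesis by (simp add: openin_open_Int)
  qed
  moreover have "closedin (top_of_set C) U"
  proof -
    have "U = C \<inter> cball y r" unfolding eq by (auto simp: dist_norm norm_minus_commute)
    then show ?thesis by (simp add: closedin_closed_Int)
  qed
  moreover have "U \<noteq> {}" using y r by (auto simp: U_def)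
  ultimately have "U = C" using C(1) connected_clopen by blast
  then have "norm (y' - y) \<le> r" using y unfolding eq by blast
  then show ?thesis using ex y C(2) by blast
qed

context pcf_dynamics
begin

text \<open>A family of loops outside \<open>K\<close> joining a loop \<open>h (0, _)\<close> to its lift \<open>h (1, _)\<close> under \<open>f\<close>. The last
  condition says that \<open>d\<close> points of the lift over one point of the loop form a full fibre.\<close>

definition strip_loop :: "(real \<times> real \<Rightarrow> complex) \<Rightarrow> bool" where
  "strip_loop h \<longleftrightarrow> continuous_on ({0..1} \<times> UNIV) h \<and>
     (\<forall>s\<in>{0..1}. \<forall>t. h (s, t) \<notin> K \<and> h (s, t + 1) = h (s, t)) \<and>
     (\<forall>t. poly f (h (1, t)) = h (0, real d * t)) \<and>
     (\<forall>t. \<forall>i<d. \<forall>j<d. h (1, t + real i / real d) = h (1, t + real j / real d) \<longrightarrow> i = j)"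

text \<open>One turn of the lift covers the original loop \<open>d\<close> times, whence the factor
  \<open>real d\<close>; the second clause makes consecutive strips share an edge.\<close>

definition strip_lift :: "(real \<times> real \<Rightarrow> complex) \<Rightarrow> (real \<times> real \<Rightarrow> complex) \<Rightarrow> bool" where
  "strip_lift h h' \<longleftrightarrow> (\<forall>s\<in>{0..1}. \<forall>t. poly f (h' (s, t)) = h (s, real d * t)) \<and> (\<forall>t. h' (0, t) = h (1, t))"

lemma strip_loop_periodic:
  assumes "strip_loop h" "s \<in> {0..1}"
  shows "h (s, t + real n) = h (s, t)"
proof (induction n)
  case (Suc n)
  have "t + real (Suc n) = (t + real n) + 1" by simp
  then show ?case using assms Suc unfolding strip_loop_def by metis
qed simp

lemma f_lift_unique:
  assumes "connected T" "continuous_on T h1" "continuous_on T h2"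
    "\<And>x. x \<in> T \<Longrightarrow> poly f (h1 x) = poly f (h2 x)" "\<And>x. x \<in> T \<Longrightarrow> poly f (h1 x) \<notin> K"
    "a \<in> T" "h1 a = h2 a" "x \<in> T"
  shows "h1 x = h2 x"
proof (rule poly_lift_unique[of f "- K" T h1 h2 a])
  show "poly (pderiv f) z \<noteq> 0" if "poly f z \<in> - K" for z
    using that crit_interior[of z] interior_subset iter_mem_K_iff[of 1 z] by auto
qed (use assms closed_K degree_ge_2 in auto)

text \<open>The strip is simply connected and the map is a covering outside \<open>K\<close>, so the
  lift exists. Periodicity and the separation of the \<open>d\<close> fibre points pass to it by
  uniqueness of lifts, the latter along the segments of constant \<open>t\<close>.\<close>

lemma strip_loop_lift:
  assumes h: "strip_loop h"
  shows "\<exists>h'. strip_loop h' \<and> strip_lift h h'"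
proof -
  have hc: "continuous_on ({0..1} \<times> UNIV) h" and hK: "\<And>s t. s \<in> {0..1} \<Longrightarrow> h (s, t) \<notin> K"
    and hp: "\<And>s t. s \<in> {0..1} \<Longrightarrow> h (s, t + 1) = h (s, t)"
    and h1: "\<And>t. poly f (h (1, t)) = h (0, real d * t)"
    and hd: "\<And>t i j. i < d \<Longrightarrow> j < d \<Longrightarrow> h (1, t + real i / real d) = h (1, t + real j / real d) \<Longrightarrow> i = j"
    using h unfolding strip_loop_def by blast+
  have d0: "d > 0" using degree_ge_2 by simp
  define H where "H = (\<lambda>(s, t). h (s, real d * t))"
  have Hc: "continuous_on ({0..1} \<times> UNIV) H"
    unfolding H_def case_prod_unfold by (intro continuous_on_compose2[OF hc] continuous_intros) auto
  have nc: "poly (pderiv f) z \<noteq> 0" if "poly f z \<in> - K" for z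
    using that crit_interior[of z] interior_subset iter_mem_K_iff[of 1 z] by auto
  have cvx: "convex ({0..1::real} \<times> (UNIV :: real set))" by (intro convex_Times) auto
  obtain h' where h': "continuous_on ({0..1} \<times> UNIV) h'" "h' (0, 0) = h (1, 0)"
      "\<And>x. x \<in> {0..1} \<times> UNIV \<Longrightarrow> poly f (h' x) = H x"
  proof (rule covering_space_lift_strong[of "poly f -` (- K)" "poly f" "- K" "h (1, 0)" "(0, 0)" "{0..1} \<times> UNIV" H])
    show "covering_space (poly f -` (- K)) (poly f) (- K)"
      using nc closed_K d0 by (intro poly_covering_space) auto
    show "simply_connected ({0..1::real} \<times> (UNIV :: real set))" using cvx by (rule convex_imp_simply_connected)
    show "locally path_connected ({0..1::real} \<times> (UNIV :: real set))" using cvx by (rule convex_imp_locally_path_connected)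
    show "h (1, 0) \<in> poly f -` (- K)" using hK[of 0 0] h1[of 0] by simp
    show "H \<in> {0..1} \<times> UNIV \<rightarrow> - K" using hK by (auto simp: H_def)
  qed (use Hc h1[of 0] in \<open>auto simp: H_def\<close>)
  have hf: "poly f (h' (s, t)) = h (s, real d * t)" if "s \<in> {0..1}" for s t
    using h'(3)[of "(s, t)"] that by (simp add: H_def)
  have cont_t: "continuous_on UNIV (\<lambda>t. k (s, t + a))" if "continuous_on ({0..1} \<times> UNIV) k" "s \<in> {0..1}"
    for k :: "real \<times> real \<Rightarrow> complex" and s a
    using that(2) by (intro continuous_on_compose2[OF that(1)] continuous_intros) auto
  have cont_s: "continuous_on {0..1} (\<lambda>s. k (s, t))" if "continuous_on ({0..1} \<times> UNIV) k"
    for k :: "real \<times> real \<Rightarrow> complex" and t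
    by (intro continuous_on_compose2[OF that] continuous_intros) auto
  have h0: "h' (0, t) = h (1, t)" for t
  proof (rule f_lift_unique[of UNIV "\<lambda>t. h' (0, t)" "\<lambda>t. h (1, t)" 0 t])
    show "continuous_on UNIV (\<lambda>t. h' (0, t))" "continuous_on UNIV (\<lambda>t. h (1, t))"
      using cont_t[OF h'(1), of 0 0] cont_t[OF hc, of 1 0] by auto
  qed (use hf[of 0] h1 hK[of 0] h'(2) in auto)
  have hp': "h' (s, t + 1) = h' (s, t)" if s: "s \<in> {0..1}" for s t
  proof -
    have "(\<lambda>x. h' (fst x, snd x + 1)) (s, t) = h' (s, t)"
    proof (rule f_lift_unique[of "{0..1} \<times> UNIV" "\<lambda>x. h' (fst x, snd x + 1)" h' "(0, 0)" "(s, t)"])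
      show "connected ({0..1::real} \<times> (UNIV :: real set))" using cvx by (rule convex_connected)
      show "continuous_on ({0..1} \<times> UNIV) (\<lambda>x. h' (fst x, snd x + 1))"
        by (intro continuous_on_compose2[OF h'(1)] continuous_intros) auto
      show "h' (fst (0, 0), snd (0::real, 0::real) + 1) = h' (0, 0)"
        using h0[of 1] h'(2) hp[of 1 0] by simp
      fix x :: "real \<times> real" assume x: "x \<in> {0..1} \<times> UNIV"
      then obtain s t where st: "x = (s, t)" "s \<in> {0..1}" by auto
      have "h (s, real d * (t + 1)) = h (s, real d * t)"
        using strip_loop_periodic[OF h st(2), of "real d * t" d] by (simp add: distrib_left)
      then show "poly f (h' (fst x, snd x + 1)) = poly f (h' x)" using hf[OF st(2)] st by simp
      show "poly f (h' (fst x, snd x + 1)) \<notin> K" using hf[OF st(2)] st hK[OF st(2)] by simp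
    qed (use h'(1) s in auto)
    then show ?thesis by simp
  qed
  have hd': "i = j" if ij: "i < d" "j < d" "h' (1, t + real i / real d) = h' (1, t + real j / real d)" for t i j
  proof -
    have per: "h (s, real d * (t + real m / real d)) = h (s, real d * t)" if "s \<in> {0..1}" for s m
      using strip_loop_periodic[OF h that, of "real d * t" m] d0 by (simp add: distrib_left)
    have "(\<lambda>s. h' (s, t + real i / real d)) 0 = (\<lambda>s. h' (s, t + real j / real d)) 0"
    proof (rule f_lift_unique[of "{0..1}" "\<lambda>s. h' (s, t + real i / real d)" "\<lambda>s. h' (s, t + real j / real d)" 1 0])
      show "continuous_on {0..1} (\<lambda>s. h' (s, t + real i / real d))" "continuous_on {0..1} (\<lambda>s. h' (s, t + real j / real d))"
        using cont_s[OF h'(1)] by auto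
      show "poly f (h' (s, t + real i / real d)) = poly f (h' (s, t + real j / real d))"
        "poly f (h' (s, t + real i / real d)) \<notin> K" if "s \<in> {0..1}" for s
        using hf[OF that] per[OF that] hK[OF that] by auto
    qed (use ij(3) in auto)
    then have "h (1, t + real i / real d) = h (1, t + real j / real d)" using h0 by simp
    then show ?thesis using hd ij by blast
  qed
  have "h' (s, t) \<notin> K" if "s \<in> {0..1}" for s t
    using iter_mem_K_iff[of 1 "h' (s, t)"] hf[OF that] hK[OF that] by simp
  moreover have "poly f (h' (1, t)) = h' (0, real d * t)" for t using hf[of 1] h0 by simp
  ultimately have "strip_loop h'" unfolding strip_loop_def using h'(1) hp' hd' by blast
  moreover have "strip_lift h h'" unfolding strip_lift_def using hf h0 by blast
  ultimately show ?thesis by blast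
qed

text \<open>In the coordinate \<open>1 / z\<close> the loop is the circle of radius
  \<open>c ^ d\<close> and its lift is the curve \<open>b (x t)\<close>. At each \<open>t\<close>
  both points have positive real part after division by \<open>u t\<close>, so the segment between
  them avoids 0.\<close>

lemma initial_strip_loop:
  "\<exists>h \<rho>. strip_loop h \<and> R0 \<le> \<rho> \<and> (\<forall>z. norm z = \<rho> \<longrightarrow> (\<exists>t. h (0, t) = z)) \<and>
     (\<forall>t. norm (h (0, t)) = \<rho>) \<and> bounded (h ` ({0..1} \<times> UNIV))"
proof -
  have d0: "d > 0" "d \<ge> 1" using degree_ge_2 by auto
  have e0: "1 / R0 > 0" "1 / R0 \<le> 1" using R0(1) by auto
  obtain b c0 where c0: "0 < c0" "continuous_on (ball 0 c0) b" "inj_on b (ball 0 c0)"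
    "\<And>x. x \<in> ball 0 c0 \<Longrightarrow> x \<noteq> 0 \<Longrightarrow> b x \<noteq> 0 \<and> norm (b x) < 1 / R0 \<and> Re (b x / x) > 0 \<and> poly f (1 / b x) = 1 / x ^ d"
    using inverse_branch_at_infinity[OF monic d0(1) e0(1)] by (metis (no_types))
  \<comment> \<open>\<open>c \<le> 1 / R0\<close> helps to keep the strip outside the disc of radius
    \<open>R0\<close>, hence off \<open>K\<close>; \<open>c < c0\<close> keeps \<open>x t\<close> in
    the domain of \<open>b\<close>.\<close>
  define c where "c = min (c0 / 2) (1 / R0)"
  have c: "c > 0" "c < c0" "c \<le> 1 / R0" using c0(1) e0 by (auto simp: c_def)
  then have c1: "c \<le> 1" using e0(2) by linarith
  define u where "u t = cis (- (2 * pi * t))" for t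
  have u: "norm (u t) = 1" "u t \<noteq> 0" for t by (auto simp: u_def)
  have u1: "u (t + 1) = u t" for t
    unfolding u_def by (simp add: complex_eq_iff algebra_simps cos_diff sin_diff)
  have ud: "u t ^ d = u (real d * t)" for t
    unfolding u_def by (simp add: Complex.DeMoivre mult_ac)
  define x where "x t = of_real c * u t" for t
  have x: "x t \<in> ball 0 c0" "x t \<noteq> 0" for t using c u by (auto simp: x_def norm_mult)
  note bx = c0(4)[OF x]
  define D where "D = (\<lambda>(s :: real, t). of_real ((1 - s) * c ^ d) * u t + of_real s * b (x t))"
  have cd: "c ^ d \<le> c" "c ^ d > 0" using c c1 d0(2) power_decreasing[of 1 d c] by auto
  have Re_of_real: "Re (of_real a * z) = a * Re z" for a z by simp
  have Re: "Re (D (s, t) / u t) > 0" if s: "s \<in> {0..1}" for s t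
  proof -
    have "b (x t) / u t = of_real c * (b (x t) / x t)" using c(1) by (simp add: x_def)
    then have "Re (b (x t) / u t) = c * Re (b (x t) / x t)" by (simp only: Re_of_real)
    then have pos: "Re (b (x t) / u t) > 0" using bx[of t] c(1) by simp
    have "D (s, t) / u t = of_real ((1 - s) * c ^ d) + of_real s * (b (x t) / u t)"
      using u(2)[of t] by (simp add: D_def add_divide_distrib)
    then have eq: "Re (D (s, t) / u t) = (1 - s) * c ^ d + s * Re (b (x t) / u t)"
      by (simp only: plus_complex.sel Re_of_real Re_complex_of_real)
    show ?thesis
    proof (cases "s = 0")
      case False
      then have "s * Re (b (x t) / u t) > 0" using pos s by simp
      moreover have "(1 - s) * c ^ d \<ge> 0" using s cd(2) by simp
      ultimately show ?thesis unfolding eq by linarith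
    qed (use eq cd in simp)
  qed
  have D0: "D (s, t) \<noteq> 0" if "s \<in> {0..1}" for s t using Re[OF that, of t] by auto
  have Dle: "norm (D (s, t)) \<le> 1 / R0" if s: "s \<in> {0..1}" for s t
  proof -
    have "norm (D (s, t)) \<le> norm (of_real ((1 - s) * c ^ d) * u t) + norm (of_real s * b (x t))"
      unfolding D_def prod.case by (rule norm_triangle_ineq)
    also have "norm (of_real ((1 - s) * c ^ d) * u t) = (1 - s) * c ^ d"
      unfolding norm_mult norm_of_real using u(1)[of t] s cd(2) by (simp add: abs_mult)
    also have "norm (of_real s * b (x t)) = s * norm (b (x t))" using s by (simp add: norm_mult)
    also have "(1 - s) * c ^ d + s * norm (b (x t)) \<le> (1 - s) * (1 / R0) + s * (1 / R0)"
      using s cd(1) c(3) bx[of t] by (intro add_mono mult_left_mono) auto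
    also have "\<dots> = 1 / R0" by (simp only: flip: distrib_right) simp
    finally show ?thesis .
  qed
  have contu: "continuous_on A u" for A unfolding u_def by (intro continuous_intros)
  have contx: "continuous_on A x" for A unfolding x_def by (intro continuous_intros contu)
  have contD: "continuous_on ({0..1} \<times> UNIV) D"
    unfolding D_def case_prod_unfold
    by (intro continuous_intros continuous_on_compose2[OF contu[of UNIV]]
          continuous_on_compose2[OF c0(2)] continuous_on_compose2[OF contx[of UNIV]]) (use x in auto)
  define h where "h z = 1 / D z" for z
  define \<rho> where "\<rho> = 1 / c ^ d"
  have h0: "h (0, t) = of_real \<rho> * cis (2 * pi * t)" for t
  proof -
    have "D (0, t) = of_real (c ^ d) * cis (- (2 * pi * t))" by (simp add: D_def u_def)
    then have "h (0, t) = 1 / of_real (c ^ d) * inverse (cis (- (2 * pi * t)))"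
      by (simp add: h_def divide_inverse)
    then show ?thesis by (simp add: \<rho>_def cis_inverse)
  qed
  have h1: "h (1, t) = 1 / b (x t)" for t by (simp add: h_def D_def)
  have hR: "norm (h (s, t)) \<ge> R0" if "s \<in> {0..1}" for s t
    using Dle[OF that, of t] D0[OF that, of t] R0(1) by (simp add: h_def norm_divide field_simps)
  have xper: "x (t + 1) = x t" for t by (simp add: x_def u1)
  have "strip_loop h"
    unfolding strip_loop_def
  proof (intro conjI allI ballI impI)
    show "continuous_on ({0..1} \<times> UNIV) h"
      unfolding h_def by (intro continuous_intros contD) (use D0 in auto)
    show "h (s, t) \<notin> K" if "s \<in> {0..1}" for s t
      using hR[OF that, of t] mem_K_iff[of "h (s, t)"] by (metis funpow_0 not_le)
    show "h (s, t + 1) = h (s, t)" for s t by (simp add: h_def D_def u1 xper)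
    show "poly f (h (1, t)) = h (0, real d * t)" for t
    proof -
      have "poly f (h (1, t)) = 1 / x t ^ d" using bx[of t] by (simp add: h1)
      also have "\<dots> = 1 / (of_real (c ^ d) * u (real d * t))" by (simp add: x_def power_mult_distrib ud)
      also have "\<dots> = h (0, real d * t)" by (simp add: h_def D_def)
      finally show ?thesis .
    qed
    fix t i j assume ij: "i < d" "j < d" "h (1, t + real i / real d) = h (1, t + real j / real d)"
    then have "b (x (t + real i / real d)) = b (x (t + real j / real d))"
      using bx by (simp add: h1)
    then have "x (t + real i / real d) = x (t + real j / real d)"
      using c0(3) x(1) by (meson inj_onD)
    then have ue: "u (t + real i / real d) = u (t + real j / real d)" using c(1) by (simp add: x_def)
    have "cis (2 * pi * (real i - real j) / real d) = 1"
    proof -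
      have "cis (2 * pi * (real i - real j) / real d) = u (t + real j / real d) / u (t + real i / real d)"
        unfolding u_def cis_divide by (rule arg_cong[of _ _ cis]) (simp add: field_simps diff_divide_distrib)
      then show ?thesis using ue u(2) by simp
    qed
    then have "cos (2 * pi * (real i - real j) / real d) = 1" by (simp add: complex_eq_iff)
    then obtain m :: int where m: "2 * pi * (real i - real j) / real d = of_int m * 2 * pi"
      using cos_one_2pi_int by blast
    have "(2 * pi) * ((real i - real j) / real d) = (2 * pi) * of_int m" using m by (simp only: times_divide_eq_right mult_ac)
    then have "(real i - real j) / real d = of_int m" by (subst (asm) mult_cancel_left) simp
    moreover have "real d \<noteq> 0" using d0(1) by simp
    ultimately have "real i - real j = of_int m * real d" using nonzero_divide_eq_eq by blast
    then have "real_of_int (int i - int j) = real_of_int (m * int d)" by simp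
    then have im: "int i - int j = m * int d" by (simp only: of_int_eq_iff)
    have "\<bar>int i - int j\<bar> < int d" using ij by linarith
    then have "\<bar>m\<bar> * int d < 1 * int d" using im by (simp add: abs_mult)
    then have "\<bar>m\<bar> < 1" using mult_less_cancel_right_pos[of "int d" "\<bar>m\<bar>" 1] d0(1) by simp
    then have "m = 0" by simp
    then show "i = j" using im by simp
  qed
  moreover have "R0 \<le> \<rho>"
    using hR[of 0 0] h0[of 0] cd(2) by (simp add: \<rho>_def norm_mult norm_divide norm_power abs_of_pos[OF c(1)])
  moreover have "\<exists>t. h (0, t) = z" if "norm z = \<rho>" for z
  proof -
    have "z = of_real \<rho> * cis (2 * pi * (Arg z / (2 * pi)))"
      using that rcis_cmod_Arg[of z] by (simp add: rcis_def)
    then show ?thesis using h0 by metis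
  qed
  moreover have "norm (h (0, t)) = \<rho>" for t using cd(2) by (simp add: h0 norm_mult \<rho>_def norm_power norm_divide abs_of_pos[OF c(1)])
  moreover have "bounded (h ` ({0..1} \<times> UNIV))"
  proof -
    have "h ` ({0..1} \<times> UNIV) \<subseteq> h ` ({0..1} \<times> {0..1})"
    proof
      fix y assume "y \<in> h ` ({0..1} \<times> UNIV)"
      then obtain s t where st: "s \<in> {0..1}" "y = h (s, t)" by auto
      have "u t = u (frac t)"
      proof -
        have "t = frac t + of_int \<lfloor>t\<rfloor>" by (simp add: frac_def)
        then have "u t = cis (- (2 * pi * frac t)) * cis (2 * pi * of_int (- \<lfloor>t\<rfloor>))"
          unfolding u_def cis_mult by (intro arg_cong[of _ _ cis]) (simp add: frac_def algebra_simps)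
        then show ?thesis by (simp add: u_def cis_multiple_2pi del: of_int_minus)
      qed
      then have "y = h (s, frac t)" by (simp add: st(2) h_def D_def x_def)
      moreover have "frac t \<in> {0..1}" by (simp add: frac_ge_0 less_imp_le frac_lt_1)
      ultimately show "y \<in> h ` ({0..1} \<times> {0..1})" using st(1) by blast
    qed
    moreover have "compact (h ` ({0..1} \<times> {0..1}))"
      using \<open>strip_loop h\<close> unfolding strip_loop_def
      by (intro compact_continuous_image compact_Times) (auto elim!: continuous_on_subset)
    ultimately show ?thesis using compact_imp_bounded bounded_subset by blast
  qed
  ultimately show ?thesis by blast
qed

definition strip_loops :: "(nat \<Rightarrow> real \<times> real \<Rightarrow> complex) \<Rightarrow> real \<Rightarrow> bool" where
  "strip_loops h \<rho> \<longleftrightarrow> (\<forall>n. strip_loop (h n) \<and> strip_lift (h n) (h (Suc n))) \<and> R0 \<le> \<rho> \<and>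
     (\<forall>z. norm z = \<rho> \<longrightarrow> (\<exists>t. h 0 (0, t) = z)) \<and> (\<forall>t. norm (h 0 (0, t)) = \<rho>) \<and> bounded (h 0 ` ({0..1} \<times> UNIV))"

lemma strip_loops_exist: "\<exists>h \<rho>. strip_loops h \<rho>"
proof -
  obtain h0 \<rho> where h0: "strip_loop h0" "R0 \<le> \<rho>" "\<forall>z. norm z = \<rho> \<longrightarrow> (\<exists>t. h0 (0, t) = z)"
      "\<forall>t. norm (h0 (0, t)) = \<rho>" "bounded (h0 ` ({0..1} \<times> UNIV))"
    using initial_strip_loop by blast
  have "\<exists>h. \<forall>n. (strip_loop (h n) \<and> (n = 0 \<longrightarrow> h n = h0)) \<and> strip_lift (h n) (h (Suc n))"
    by (rule dependent_nat_choice) (use h0(1) strip_loop_lift in auto)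
  then obtain h where "\<And>n. strip_loop (h n)" "\<And>n. strip_lift (h n) (h (Suc n))" "h 0 = h0" by blast
  then show ?thesis unfolding strip_loops_def using h0 by blast
qed

context
  fixes h :: "nat \<Rightarrow> real \<times> real \<Rightarrow> complex" and \<rho> :: real
  assumes h: "strip_loops h \<rho>"
begin

lemma h_loop: "strip_loop (h n)" and h_lift: "strip_lift (h n) (h (Suc n))" and h_rho: "R0 \<le> \<rho>"
  and h_circle: "norm z = \<rho> \<Longrightarrow> \<exists>t. h 0 (0, t) = z" "norm (h 0 (0, t)) = \<rho>"
  and h_bounded: "bounded (h 0 ` ({0..1} \<times> UNIV))"
  using h unfolding strip_loops_def by blast+

lemma h_step: "s \<in> {0..1} \<Longrightarrow> poly f (h (Suc n) (s, t)) = h n (s, real d * t)" "h (Suc n) (0, t) = h n (1, t)"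
  using h_lift[of n] unfolding strip_lift_def by blast+

lemma h_notin_K: "s \<in> {0..1} \<Longrightarrow> h n (s, t) \<notin> K"
  using h_loop[of n] unfolding strip_loop_def by blast

lemma h_cont: "continuous_on ({0..1} \<times> UNIV) (h n)"
  using h_loop[of n] unfolding strip_loop_def by blast

lemma h_iter: "s \<in> {0..1} \<Longrightarrow> F n (h n (s, t)) = h 0 (s, real d ^ n * t)"
proof (induction n arbitrary: t)
  case (Suc n)
  have "F (Suc n) (h (Suc n) (s, t)) = F n (poly f (h (Suc n) (s, t)))"
    by (metis comp_apply funpow_Suc_right)
  then show ?case using Suc h_step(1)[of s n t] by (simp add: mult_ac)
qed simp

lemma h_norm_bound: "\<exists>B\<ge>R0. \<forall>n. \<forall>s\<in>{0..1}. \<forall>t. \<forall>j\<le>n. norm (F j (h n (s, t))) \<le> B"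
proof -
  obtain B where B: "\<And>x. x \<in> {0..1} \<times> UNIV \<Longrightarrow> norm (h 0 x) \<le> B"
    using h_bounded by (auto simp: bounded_iff)
  have "norm (F j (h n (s, t))) \<le> max R0 B" if "s \<in> {0..1}" "j \<le> n" for n s t j
    using bounded_orbit[of n "h n (s, t)" "max R0 B" j] h_iter[OF that(1), of n t] B[of "(s, real d ^ n * t)"] that
    by auto
  then show ?thesis by (intro exI[of _ "max R0 B"]) auto
qed

text \<open>Over a point of loop \<open>n\<close> the lift has \<open>d\<close> distinct points,
  which must be its full fibre; this is what the last clause of \<open>strip_loop\<close> is
  for.\<close>

lemma h_level_curve: "norm (F n z) = \<rho> \<Longrightarrow> \<exists>t. h n (0, t) = z"
proof (induction n arbitrary: z)
  case 0
  then show ?case using h_circle(1) by simp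
next
  case (Suc n)
  have "norm (F n (poly f z)) = \<rho>" using Suc.prems by (metis comp_apply funpow_Suc_right)
  then obtain \<tau> where \<tau>: "h n (0, \<tau>) = poly f z" using Suc.IH by blast
  have d0: "d > 0" using degree_ge_2 by simp
  define y where "y j = h n (1, \<tau> / real d + real j / real d)" for j :: nat
  have fy: "poly f (y j) = poly f z" for j
  proof -
    have "poly f (y j) = h n (0, real d * (\<tau> / real d + real j / real d))"
      using h_loop[of n] unfolding strip_loop_def y_def by blast
    also have "real d * (\<tau> / real d + real j / real d) = \<tau> + real j" using d0 by (simp add: distrib_left)
    also have "h n (0, \<tau> + real j) = h n (0, \<tau>)" using strip_loop_periodic[OF h_loop] by simp
    finally show ?thesis using \<tau> by simp
  qed
  have "inj_on y {..<d}"
    using h_loop[of n] unfolding strip_loop_def y_def inj_on_def by blast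
  then have "card (y ` {..<d}) = d" by (simp add: card_image)
  then have "y ` {..<d} = {x. poly f x = poly f z}"
    using finite_fibre[OF d0, of "poly f z"] fy by (intro card_seteq) auto
  then obtain j where "y j = z" by (metis (mono_tags, lifting) imageE mem_Collect_eq)
  then have "h (Suc n) (0, \<tau> / real d + real j / real d) = z" unfolding h_step(2) y_def .
  then show ?case by blast
qed

text \<open>Close to \<open>J\<close> the map expands, so the tracks \<open>s \<mapsto> h n (s, t)\<close> shrink geometrically.\<close>

lemma h_tracks_shrink:
  assumes l: "l > 1" "\<And>z. z \<in> J \<Longrightarrow> l \<le> norm (poly (pderiv f) z)"
  shows "\<exists>C \<theta>. 0 \<le> \<theta> \<and> \<theta> < 1 \<and> (\<forall>n t. norm (h n (1, t) - h n (0, t)) \<le> C * \<theta> ^ n)"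
proof -
  obtain B where B: "B \<ge> R0" "\<And>n s t j. s \<in> {0..1} \<Longrightarrow> j \<le> n \<Longrightarrow> norm (F j (h n (s, t))) \<le> B"
    using h_norm_bound by blast
  \<comment> \<open>Two rates strictly between 1 and \<open>l\<close>: \<open>l1\<close> for the
    derivative near \<open>J\<close>, \<open>l2\<close> for the resulting expansion of small
    distances.\<close>
  define l1 where "l1 = (1 + 2 * l) / 3"
  define l2 where "l2 = (2 + l) / 3"
  have l12: "1 < l2" "l2 < l1" "l1 < l" using l(1) by (auto simp: l1_def l2_def)
  \<comment> \<open>A decreasing sequence of compact sets with intersection \<open>J\<close>, so the
    derivative bound on \<open>J\<close> extends to one of them at the rate
    \<open>l1\<close>.\<close>
  define V where "V N = {z. norm (F N z) \<le> 2 * R0} - interior K" for N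
  have V_anti: "V N \<subseteq> V M" if "M \<le> N" for M N
  proof
    fix z assume z: "z \<in> V N"
    have "norm (F M z) \<le> 2 * R0"
      using bounded_orbit[of N z "2 * R0" M] z that R0(1) by (simp add: V_def)
    then show "z \<in> V M" using z by (simp add: V_def)
  qed
  have V_bd: "norm z \<le> 2 * R0" if "z \<in> V N" for z N
    using V_anti[of 0 N] that by (auto simp: V_def)
  have V_cpt: "compact (V N)" for N
  proof -
    have "{z. norm (F N z) \<le> 2 * R0} = F N -` cball 0 (2 * R0)" by auto
    then have "closed (V N)" unfolding V_def by (intro closed_Diff) (simp_all add: closed_iter_vimage)
    moreover have "bounded (V N)" using V_bd by (auto simp: bounded_iff)
    ultimately show ?thesis by (simp add: compact_eq_bounded_closed)
  qed
  obtain N1 where N1: "\<And>z. z \<in> V N1 \<Longrightarrow> l1 \<le> norm (poly (pderiv f) z)"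
  proof (rule ccontr)
    assume "\<not> thesis"
    then have ne: "\<forall>N. \<exists>z\<in>V N. norm (poly (pderiv f) z) \<le> l1" using that by (meson le_cases)
    define G where "G N = V N \<inter> {z. norm (poly (pderiv f) z) \<le> l1}" for N
    have "\<Inter>(range G) \<noteq> {}"
    proof (rule compact_nest)
      show "compact (G n)" for n
        unfolding G_def by (intro compact_Int_closed V_cpt closed_Collect_le continuous_intros)
      show "G n \<noteq> {}" for n using ne by (auto simp: G_def)
      show "G n \<subseteq> G m" if "m \<le> n" for m n using V_anti[OF that] by (auto simp: G_def)
    qed
    then obtain z where z: "\<And>n. z \<in> G n" by blast
    have "bounded (range (\<lambda>n. F n z))" using z by (auto simp: bounded_iff G_def V_def)
    then have "z \<in> K" by (simp add: filled_julia_set_def)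
    then have "z \<in> J" using z[of 0] by (simp add: J_eq G_def V_def)
    then show False using l(2)[of z] z[of 0] l12 by (simp add: G_def)
  qed
  obtain k where k: "B < 2 ^ k" using real_arch_pow[of 2 B] by auto
  define N2 where "N2 = N1 + k"
  have hV: "h n (s, t) \<in> V N1" if "s \<in> {0..1}" "n \<ge> N2" for n s t
  proof -
    have "norm (F N1 (h n (s, t))) \<le> 2 * R0"
    proof (rule ccontr)
      assume "\<not> ?thesis"
      then have gt: "norm (F N1 (h n (s, t))) > 2 * R0" by simp
      have "n = (n - N1) + N1" using that(2) by (simp add: N2_def)
      then have "F n (h n (s, t)) = F (n - N1) (F N1 (h n (s, t)))" by (metis iter_poly_add)
      moreover have "2 ^ (n - N1) * norm (F N1 (h n (s, t))) \<le> norm (F (n - N1) (F N1 (h n (s, t))))"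
        using gt R0(1) by (intro norm_iter_ge) auto
      moreover have "(2::real) ^ k * 1 \<le> 2 ^ (n - N1) * norm (F N1 (h n (s, t)))"
        using gt R0(1) that(2) by (intro mult_mono power_increasing) (auto simp: N2_def)
      ultimately show False using k B(2)[OF that(1), of n n t] by simp
    qed
    then show ?thesis using h_notin_K[OF that(1)] interior_subset by (auto simp: V_def)
  qed
  obtain \<eta> where \<eta>: "\<eta> > 0" "\<eta> \<le> 1" "\<forall>z. norm z \<le> B \<and> z \<notin> interior K \<longrightarrow> \<eta> \<le> norm (poly (pderiv f) z)"
    using deriv_lower_bound by blast
  define S where "S = cball 0 B - interior K"
  have hS: "h n (s, t) \<in> S" if "s \<in> {0..1}" for n s t
    using B(2)[OF that, of 0 n t] h_notin_K[OF that] interior_subset by (auto simp: S_def)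
  obtain ra where ra: "ra > 0" "\<And>y y'. y \<in> S \<Longrightarrow> norm (y' - y) \<le> ra \<Longrightarrow> \<eta> / 2 * norm (y' - y) \<le> norm (poly f y' - poly f y)"
    using expansion_of_deriv_bound[of S B \<eta> f "\<eta> / 2"] \<eta> by (auto simp: S_def)
  obtain rb where rb: "rb > 0" "\<And>y y'. y \<in> V N1 \<Longrightarrow> norm (y' - y) \<le> rb \<Longrightarrow> l2 * norm (y' - y) \<le> norm (poly f y' - poly f y)"
    using expansion_of_deriv_bound[of "V N1" "2 * R0" l1 f l2] N1 V_bd l12 by blast
  \<comment> \<open>Each of the first \<open>N2\<close> lifts may enlarge distances by the factor
    \<open>2 / \<eta>\<close>. Starting at \<open>\<delta>\<close> they stay below both thresholds,
    after which expansion by \<open>l2\<close> takes over.\<close>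
  define \<delta> where "\<delta> = min (\<eta> / 2 * ra) (l2 * rb) / 2 * (\<eta> / 2) ^ N2"
  have \<eta>2: "0 < \<eta> / 2" "\<eta> / 2 \<le> 1" using \<eta> by auto
  have \<delta>: "\<delta> > 0" using \<eta>2 ra(1) rb(1) l12 by (simp add: \<delta>_def)
  have uc: "uniformly_continuous_on ({0..1} \<times> {0..1}) (h 0)"
    by (intro compact_uniformly_continuous continuous_on_subset[OF h_cont] compact_Times) auto
  obtain e where e: "e > 0" "\<And>x y. x \<in> {0..1} \<times> {0..1} \<Longrightarrow> y \<in> {0..1} \<times> {0..1} \<Longrightarrow> dist x y < e \<Longrightarrow> dist (h 0 x) (h 0 y) < \<delta>"
    using uc \<delta> unfolding uniformly_continuous_on_def by metis
  \<comment> \<open>The interval of \<open>s\<close> is subdivided once and for all so that every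
    subtrack of the initial strip has diameter at most \<open>\<delta>\<close>; \<open>M\<close>
    does not grow with \<open>n\<close>.\<close>
  obtain M :: nat where M: "M > 0" "1 / real M < e" using e(1) by (metis nat_approx_posE of_nat_Suc zero_less_Suc)
  define I where "I i = {real i / real M..real (Suc i) / real M}" for i
  have I01: "I i \<subseteq> {0..1}" if "i < M" for i
  proof -
    have "real (Suc i) \<le> real M" using that by linarith
    then have "real (Suc i) / real M \<le> 1" using M(1) by (simp add: divide_le_eq)
    then show ?thesis by (auto simp: I_def intro: order.trans)
  qed
  have frac_h: "h n (s, t) = h n (s, frac t)" if "s \<in> {0..1}" for n s t
  proof -
    have pos: "h n (s, frac a + of_int m) = h n (s, frac a)" for a and m :: int
    proof (cases "m \<ge> 0")
      case True
      then show ?thesis using strip_loop_periodic[OF h_loop that, of n "frac a" "nat m"] by simp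
    next
      case False
      then show ?thesis using strip_loop_periodic[OF h_loop that, of n "frac a + of_int m" "nat (- m)"] by simp
    qed
    have "t = frac t + of_int \<lfloor>t\<rfloor>" by (simp add: frac_def)
    then show ?thesis using pos[of t "\<lfloor>t\<rfloor>"] by simp
  qed
  have base: "norm (h 0 (s, t) - h 0 (s', t)) \<le> \<delta>" if "i < M" "s \<in> I i" "s' \<in> I i" for i s s' t
  proof -
    have s01: "s \<in> {0..1}" "s' \<in> {0..1}" using I01 that by blast+
    have "\<bar>s - s'\<bar> \<le> 1 / real M" using that(2,3) by (auto simp: I_def add_divide_distrib abs_le_iff)
    then have "dist (s, frac t) (s', frac t) < e" using M(2) by (simp add: dist_prod_def dist_real_def)
    then have "dist (h 0 (s, frac t)) (h 0 (s', frac t)) < \<delta>"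
      using s01 by (intro e(2)) (auto simp: frac_ge_0 less_imp_le frac_lt_1)
    then show ?thesis using frac_h[OF s01(1), of 0 t] frac_h[OF s01(2), of 0 t] by (simp add: dist_norm)
  qed
  have step: "norm (h (Suc n) (s, t) - h (Suc n) (s', t)) \<le> D / \<kappa>"
    if prev: "\<And>s s' t. s \<in> I i \<Longrightarrow> s' \<in> I i \<Longrightarrow> norm (h n (s, t) - h n (s', t)) \<le> D"
      and i: "i < M" and ss: "s \<in> I i" "s' \<in> I i"
      and X: "\<And>s t. s \<in> {0..1} \<Longrightarrow> h (Suc n) (s, t) \<in> X" and r: "r > 0" "\<kappa> > 0" "D < \<kappa> * r"
      and ex: "\<And>y y'. y \<in> X \<Longrightarrow> norm (y' - y) \<le> r \<Longrightarrow> \<kappa> * norm (y' - y) \<le> norm (poly f y' - poly f y)"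
    for n i D \<kappa> X r s s' t
  proof -
    define C where "C = (\<lambda>s. h (Suc n) (s, t)) ` I i"
    have fC: "poly f (h (Suc n) (s, t)) = h n (s, real d * t)" if "s \<in> I i" for s
      using h_step(1) I01[OF i] that by blast
    have "\<kappa> * norm (h (Suc n) (s, t) - h (Suc n) (s', t)) \<le> norm (poly f (h (Suc n) (s, t)) - poly f (h (Suc n) (s', t)))"
    proof (rule connected_contraction[of C X "poly f" r \<kappa> D])
      show "connected C" unfolding C_def
      proof (rule connected_continuous_image)
        show "continuous_on (I i) (\<lambda>s. h (Suc n) (s, t))"
          using I01[OF i] by (intro continuous_on_compose2[OF h_cont] continuous_intros) auto
      qed (simp add: I_def)
      show "C \<subseteq> X" using X I01[OF i] by (auto simp: C_def)
      show "continuous_on C (poly f)" by (intro continuous_intros)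
      show "norm (poly f y' - poly f y) \<le> D" if "y \<in> C" "y' \<in> C" for y y'
        using that prev fC by (auto simp: C_def)
    qed (use r ex ss in \<open>auto simp: C_def\<close>)
    also have "\<dots> \<le> D" using prev ss fC by simp
    finally show ?thesis using r(2) by (simp add: pos_le_divide_eq mult.commute)
  qed
  have \<delta>le: "\<delta> / (\<eta> / 2) ^ n < \<eta> / 2 * ra" "\<delta> / (\<eta> / 2) ^ n < l2 * rb" if "n \<le> N2" for n
  proof -
    define m where "m = min (\<eta> / 2 * ra) (l2 * rb)"
    have m: "m > 0" using \<eta>2 ra(1) rb(1) l12 by (simp add: m_def)
    have "\<delta> / (\<eta> / 2) ^ n = m / 2 * (\<eta> / 2) ^ (N2 - n)"
      using that \<eta>2 by (simp add: \<delta>_def m_def power_diff)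
    also have "\<dots> \<le> m / 2 * 1" using \<eta>2 m by (intro mult_left_mono power_le_one) auto
    also have "\<dots> < m" using m by simp
    finally show "\<delta> / (\<eta> / 2) ^ n < \<eta> / 2 * ra" "\<delta> / (\<eta> / 2) ^ n < l2 * rb" by (auto simp: m_def)
  qed
  have early: "norm (h n (s, t) - h n (s', t)) \<le> \<delta> / (\<eta> / 2) ^ n" if "i < M" "n \<le> N2" "s \<in> I i" "s' \<in> I i" for i n s s' t
    using that(2,3,4)
  proof (induction n arbitrary: s s' t)
    case 0
    then show ?case using base that(1) by simp
  next
    case (Suc n)
    have "norm (h (Suc n) (s, t) - h (Suc n) (s', t)) \<le> \<delta> / (\<eta> / 2) ^ n / (\<eta> / 2)"
      by (rule step[of i n "\<delta> / (\<eta> / 2) ^ n" s s' S ra]) (use Suc that(1) hS ra \<eta>2 \<delta>le(1)[of n] in auto)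
    then show ?case by (simp add: field_simps)
  qed
  define \<delta>2 where "\<delta>2 = \<delta> / (\<eta> / 2) ^ N2"
  have \<delta>2: "\<delta>2 > 0" using \<delta> \<eta>2 by (simp add: \<delta>2_def)
  have late: "norm (h (N2 + n) (s, t) - h (N2 + n) (s', t)) \<le> \<delta>2 / l2 ^ n" if "i < M" "s \<in> I i" "s' \<in> I i" for i n s s' t
    using that(2,3)
  proof (induction n arbitrary: s s' t)
    case 0
    then show ?case using early[OF that(1), of N2] by (simp add: \<delta>2_def)
  next
    case (Suc n)
    have "\<delta>2 / l2 ^ n \<le> \<delta>2 / 1" using \<delta>2 l12 by (intro divide_left_mono) auto
    then have lt: "\<delta>2 / l2 ^ n < l2 * rb" using \<delta>le(2)[of N2] by (simp add: \<delta>2_def)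
    have "norm (h (Suc (N2 + n)) (s, t) - h (Suc (N2 + n)) (s', t)) \<le> \<delta>2 / l2 ^ n / l2"
      by (rule step[of i "N2 + n" "\<delta>2 / l2 ^ n" s s' "V N1" rb]) (use Suc that(1) hV rb l12 lt in auto)
    then show ?case by (simp add: field_simps)
  qed
  have total: "norm (h n (1, t) - h n (0, t)) \<le> real M * D"
    if D: "\<And>i s s'. i < M \<Longrightarrow> s \<in> I i \<Longrightarrow> s' \<in> I i \<Longrightarrow> norm (h n (s, t) - h n (s', t)) \<le> D" for n t D
  proof -
    define a where "a i = h n (real i / real M, t)" for i
    have "norm (a (Suc i) - a i) \<le> D" if "i < M" for i
      unfolding a_def using that by (intro D[of i]) (auto simp: I_def divide_right_mono)
    then have "norm (\<Sum>i<M. a (Suc i) - a i) \<le> (\<Sum>i<M. D)" by (intro order.trans[OF norm_sum] sum_mono) auto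
    moreover have "(\<Sum>i<M. a (Suc i) - a i) = h n (1, t) - h n (0, t)"
      unfolding sum_lessThan_telescope using M(1) by (simp add: a_def)
    ultimately show ?thesis by simp
  qed
  define \<theta> where "\<theta> = 1 / l2"
  have \<theta>: "0 < \<theta>" "\<theta> < 1" using l12 by (auto simp: \<theta>_def)
  \<comment> \<open>\<open>C\<close> is normalised at \<open>n = N2\<close>; for smaller
    \<open>n\<close> the bound there suffices because \<open>\<theta> < 1\<close>.\<close>
  define C where "C = real M * \<delta>2 / \<theta> ^ N2"
  have "norm (h n (1, t) - h n (0, t)) \<le> C * \<theta> ^ n" for n t
  proof (cases "n \<le> N2")
    case True
    have "norm (h n (1, t) - h n (0, t)) \<le> real M * (\<delta> / (\<eta> / 2) ^ n)"
      using early[OF _ True] by (intro total) auto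
    also have "\<dots> \<le> real M * \<delta>2"
      unfolding \<delta>2_def using True \<delta> \<eta>2 by (intro mult_left_mono divide_left_mono power_decreasing) auto
    also have "\<dots> = C * \<theta> ^ N2" using \<theta> by (simp add: C_def)
    also have "\<dots> \<le> C * \<theta> ^ n"
      using True \<theta> \<delta>2 by (intro mult_left_mono power_decreasing) (auto simp: C_def)
    finally show ?thesis .
  next
    case False
    define j where "j = n - N2"
    have n: "n = N2 + j" using False by (simp add: j_def)
    have "norm (h n (1, t) - h n (0, t)) \<le> real M * (\<delta>2 / l2 ^ j)"
      unfolding n using late by (intro total) auto
    also have "\<dots> = C * \<theta> ^ n" using \<theta> l12 by (simp add: C_def n power_add \<theta>_def power_divide)
    finally show ?thesis .
  qed
  then show ?thesis using \<theta> by (intro exI[of _ C] exI[of _ \<theta>]) auto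
qed

end

text \<open>By geometric shrinking the loops converge uniformly. The limit lies in \<open>K\<close>
  because the orbits along the loops are uniformly bounded, and not in its interior because the
  loops avoid \<open>K\<close>. For surjectivity, a segment from a Julia point to a nearby escaping
  point crosses the level \<open>\<rho>\<close> of a high iterate, hence meets a loop.\<close>

lemma julia_curve:
  assumes l: "l > 1" "\<And>z. z \<in> J \<Longrightarrow> l \<le> norm (poly (pderiv f) z)"
  shows "\<exists>\<phi> :: real \<Rightarrow> complex. continuous_on {0..1} \<phi> \<and> \<phi> ` {0..1} = J"
proof -
  obtain h \<rho> where h: "strip_loops h \<rho>" using strip_loops_exist by blast
  obtain C \<theta> where C: "0 \<le> \<theta>" "\<theta> < 1" "\<And>n t. norm (h n (1, t) - h n (0, t)) \<le> C * \<theta> ^ n"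
    using h_tracks_shrink[OF h l] by blast
  define \<gamma> where "\<gamma> n t = h n (0, t)" for n t
  have diff: "norm (\<gamma> (Suc n) t - \<gamma> n t) \<le> C * \<theta> ^ n" for n t
    using C(3)[of n t] h_step(2)[OF h, of n t] by (simp add: \<gamma>_def)
  have sumC: "summable (\<lambda>n. C * \<theta> ^ n)" using C(1,2) by (intro summable_mult summable_geometric) auto
  define \<phi> where "\<phi> t = \<gamma> 0 t + (\<Sum>n. \<gamma> (Suc n) t - \<gamma> n t)" for t
  have cont\<gamma>: "continuous_on UNIV (\<gamma> n)" for n
    unfolding \<gamma>_def by (intro continuous_on_compose2[OF h_cont[OF h]] continuous_intros) auto
  have "uniform_limit UNIV (\<lambda>n t. \<Sum>i<n. \<gamma> (Suc i) t - \<gamma> i t) (\<lambda>t. \<Sum>n. \<gamma> (Suc n) t - \<gamma> n t) sequentially"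
    by (rule Weierstrass_m_test[OF _ sumC]) (use diff in auto)
  then have "uniform_limit UNIV (\<lambda>n t. \<gamma> 0 t + (\<Sum>i<n. \<gamma> (Suc i) t - \<gamma> i t)) \<phi> sequentially"
    unfolding \<phi>_def by (intro uniform_limit_intros)
  moreover have "\<gamma> 0 t + (\<Sum>i<n. \<gamma> (Suc i) t - \<gamma> i t) = \<gamma> n t" for n t
    using sum_lessThan_telescope[of "\<lambda>i. \<gamma> i t" n] by simp
  ultimately have ul: "uniform_limit UNIV \<gamma> \<phi> sequentially" by simp
  have cont: "continuous_on UNIV \<phi>"
    by (rule uniform_limit_theorem[OF _ ul]) (use cont\<gamma> in auto)
  have lim: "(\<lambda>n. \<gamma> n t) \<longlonglongrightarrow> \<phi> t" for t by (rule tendsto_uniform_limitI[OF ul UNIV_I])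
  have \<gamma>K: "\<gamma> n t \<notin> K" for n t unfolding \<gamma>_def using h_notin_K[OF h] by simp
  have \<phi>J: "\<phi> t \<in> J" for t
  proof -
    obtain B where B: "\<And>n s t j. s \<in> {0..1} \<Longrightarrow> j \<le> n \<Longrightarrow> norm (F j (h n (s, t))) \<le> B"
      using h_norm_bound[OF h] by blast
    have "norm (F j (\<phi> t)) \<le> B" for j
    proof (rule LIMSEQ_le_const2)
      show "(\<lambda>n. norm (F j (\<gamma> n t))) \<longlonglongrightarrow> norm (F j (\<phi> t))"
        using continuous_on_tendsto_compose[OF continuous_on_iter[of UNIV j f] lim[of t]] by (intro tendsto_norm) auto
      show "\<exists>N. \<forall>n\<ge>N. norm (F j (\<gamma> n t)) \<le> B" unfolding \<gamma>_def using B by (intro exI[of _ j]) auto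
    qed
    then have "\<phi> t \<in> K" by (auto simp: filled_julia_set_def bounded_iff)
    moreover have "\<phi> t \<notin> interior K"
    proof
      assume "\<phi> t \<in> interior K"
      then have "eventually (\<lambda>n. \<gamma> n t \<in> interior K) sequentially"
        using lim open_interior topological_tendstoD by blast
      then obtain n where "\<gamma> n t \<in> interior K" unfolding eventually_sequentially by blast
      then show False using \<gamma>K[of n t] interior_subset[of K] by blast
    qed
    ultimately show ?thesis by (simp add: J_eq)
  qed
  have per: "\<phi> t = \<phi> (frac t)" for t
  proof -
    have "\<gamma> n t = \<gamma> n (frac t)" for n
    proof (cases "\<lfloor>t\<rfloor> \<ge> 0")
      case True
      have "\<gamma> n (frac t + real (nat \<lfloor>t\<rfloor>)) = \<gamma> n (frac t)"
        unfolding \<gamma>_def by (rule strip_loop_periodic[OF h_loop[OF h]]) simp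
      then show ?thesis using True by (simp add: frac_def)
    next
      case False
      have "\<gamma> n (t + real (nat (- \<lfloor>t\<rfloor>))) = \<gamma> n t"
        unfolding \<gamma>_def by (rule strip_loop_periodic[OF h_loop[OF h]]) simp
      then show ?thesis using False by (simp add: frac_def)
    qed
    then have "(\<lambda>n. \<gamma> n t) \<longlonglongrightarrow> \<phi> (frac t)" using lim[of "frac t"] by simp
    then show ?thesis using lim[of t] LIMSEQ_unique by blast
  qed
  have im: "\<phi> ` {0..1} = range \<phi>"
  proof
    show "range \<phi> \<subseteq> \<phi> ` {0..1}"
    proof
      fix y assume "y \<in> range \<phi>"
      then obtain t where "y = \<phi> (frac t)" using per by blast
      then show "y \<in> \<phi> ` {0..1}" by (simp add: frac_ge_0 less_imp_le frac_lt_1)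
    qed
  qed auto
  have "J \<subseteq> \<phi> ` {0..1}"
  proof
    fix w assume w: "w \<in> J"
    have "compact (\<phi> ` {0..1})" using cont by (intro compact_continuous_image continuous_on_subset[OF cont]) auto
    then have cl: "closed (\<phi> ` {0..1})" by (rule compact_imp_closed)
    have "\<exists>y\<in>\<phi> ` {0..1}. dist y w < e" if e: "e > 0" for e
    proof -
      obtain w' where w': "w' \<in> ball w (e / 2)" "w' \<notin> K" using J_near_complement[OF w, of "e / 2"] e by auto
      obtain N1 where N1: "\<And>n. n \<ge> N1 \<Longrightarrow> \<rho> \<le> norm (F n w')" using escape[OF w'(2)] by blast
      obtain N2 where N2: "\<And>n t. n \<ge> N2 \<Longrightarrow> dist (\<gamma> n t) (\<phi> t) < e / 2"
        using ul e unfolding uniform_limit_iff eventually_sequentially by (metis UNIV_I half_gt_zero)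
      define n where "n = max N1 N2"
      have "norm (F n w) < R0" using w J_subset_K mem_K_iff by blast
      then have le: "norm (F n w) \<le> \<rho>" using h_rho[OF h] by linarith
      have "continuous_on (closed_segment w w') (\<lambda>z. norm (F n z))"
        by (intro continuous_on_norm continuous_on_iter)
      then have "connected ((\<lambda>z. norm (F n z)) ` closed_segment w w')"
        by (intro connected_continuous_image) auto
      moreover have "norm (F n w) \<in> (\<lambda>z. norm (F n z)) ` closed_segment w w'"
        "norm (F n w') \<in> (\<lambda>z. norm (F n z)) ` closed_segment w w'" by auto
      moreover have "\<rho> \<le> norm (F n w')" using N1 by (simp add: n_def)
      ultimately have "\<rho> \<in> (\<lambda>z. norm (F n z)) ` closed_segment w w'"
        using le by (meson connected_contains_Icc atLeastAtMost_iff subsetD)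
      then obtain z where z: "z \<in> closed_segment w w'" "norm (F n z) = \<rho>" by auto
      obtain t where t: "h n (0, t) = z" using h_level_curve[OF h z(2)] by blast
      have "dist z w \<le> dist w' w" using dist_in_closed_segment[OF z(1)] by (metis dist_commute)
      then have "dist z w < e / 2" using w'(1) by (simp add: dist_commute)
      moreover have "dist z (\<phi> t) < e / 2" using N2[of n t] t by (simp add: \<gamma>_def n_def)
      ultimately have "dist (\<phi> t) w < e" using dist_triangle_half_r by blast
      then show ?thesis using im by blast
    qed
    then show "w \<in> \<phi> ` {0..1}" using closed_approachable[OF cl] by blast
  qed
  moreover have "\<phi> ` {0..1} \<subseteq> J" using \<phi>J by auto
  ultimately have "\<phi> ` {0..1} = J" by blast
  then show ?thesis using cont continuous_on_subset by blast
qed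

end

section \<open>A non-separating point of the Julia set\<close>

lemma connected_subfamily:
  assumes F: "finite \<F>" "\<And>Q. Q \<in> \<F> \<Longrightarrow> connected Q \<and> closed Q \<and> Q \<noteq> {}" and con: "connected (\<Union>\<F>)" and k: "k \<le> card \<F>"
  shows "\<exists>\<G>\<subseteq>\<F>. card \<G> = k \<and> connected (\<Union>\<G>)"
  using k
proof (induction k)
  case 0
  then show ?case by (intro exI[of _ "{}"]) auto
next
  case (Suc k)
  then obtain \<G> where G: "\<G> \<subseteq> \<F>" "card \<G> = k" "connected (\<Union>\<G>)" by auto
  have finG: "finite \<G>" using G(1) F(1) finite_subset by blast
  have ne: "\<F> - \<G> \<noteq> {}" using Suc.prems G(2) finG card_mono[OF finG, of \<F>] by auto
  obtain Q where Q: "Q \<in> \<F> - \<G>" "connected (Q \<union> \<Union>\<G>)"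
  proof (cases "\<G> = {}")
    case True
    obtain Q where "Q \<in> \<F> - \<G>" using ne by blast
    then show ?thesis using that F(2) True by auto
  next
    case False
    have "\<exists>Q\<in>\<F> - \<G>. Q \<inter> \<Union>\<G> \<noteq> {}"
    proof (rule ccontr)
      assume "\<not> ?thesis"
      then have disj: "\<Union>\<G> \<inter> \<Union>(\<F> - \<G>) = {}" by blast
      have "closed (\<Union>\<G>)" "closed (\<Union>(\<F> - \<G>))" using F G(1) finG by (auto intro!: closed_Union)
      moreover have "\<Union>\<F> \<subseteq> \<Union>\<G> \<union> \<Union>(\<F> - \<G>)" by blast
      moreover have "\<Union>\<G> \<inter> \<Union>\<F> \<noteq> {}" "\<Union>(\<F> - \<G>) \<inter> \<Union>\<F> \<noteq> {}" using False ne G(1) F(2) by blast+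
      ultimately show False using con disj unfolding connected_closed by (metis inf_bot_left inf_commute)
    qed
    then obtain Q where "Q \<in> \<F> - \<G>" "Q \<inter> \<Union>\<G> \<noteq> {}" by blast
    then show ?thesis using that[of Q] F(2) G(3) by (auto intro: connected_Un)
  qed
  then show ?case
    using G finG by (intro exI[of _ "insert Q \<G>"]) auto
qed

lemma removable_member:
  assumes "finite \<F>" "\<And>Q. Q \<in> \<F> \<Longrightarrow> connected Q \<and> closed Q \<and> Q \<noteq> {}" "connected (\<Union>\<F>)" "\<F> \<noteq> {}"
  shows "\<exists>Q\<in>\<F>. connected (\<Union>(\<F> - {Q}))"
proof -
  have "card \<F> \<ge> 1" using assms by (simp add: Suc_leI card_gt_0_iff)
  obtain \<G> where G: "\<G> \<subseteq> \<F>" "card \<G> = card \<F> - 1" "connected (\<Union>\<G>)"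
    using connected_subfamily[OF assms(1-3), of "card \<F> - 1"] by auto
  have "card (\<F> - \<G>) = 1"
    using G(1,2) \<open>card \<F> \<ge> 1\<close> assms(1) by (simp add: card_Diff_subset finite_subset)
  then obtain Q where "\<F> - \<G> = {Q}" by (auto simp: card_1_singleton_iff)
  then have "Q \<in> \<F>" "\<F> - {Q} = \<G>" using G(1) by auto
  then show ?thesis using G(3) by auto
qed

lemma minimal_cover:
  assumes "finite \<F>" "\<Union>\<F> = S"
  obtains \<G> where "\<G> \<subseteq> \<F>" "\<Union>\<G> = S" "\<And>Q. Q \<in> \<G> \<Longrightarrow> \<Union>(\<G> - {Q}) \<noteq> S"
proof -
  define \<C> where "\<C> = {\<G>. \<G> \<subseteq> \<F> \<and> \<Union>\<G> = S}"
  have "finite \<C>" using assms(1) by (simp add: \<C>_def)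
  moreover have "\<C> \<noteq> {}" using assms(2) by (auto simp: \<C>_def)
  ultimately have "\<exists>m\<in>\<C>. \<forall>b\<in>\<C>. b \<subseteq> m \<longrightarrow> m = b"
    using finite_has_minimal[of \<C>] by simp
  then obtain \<G> where G: "\<G> \<in> \<C>" and min: "\<And>\<H>. \<H> \<in> \<C> \<Longrightarrow> \<H> \<subseteq> \<G> \<Longrightarrow> \<G> = \<H>"
    by blast
  show ?thesis
  proof (rule that[of \<G>])
    show "\<G> \<subseteq> \<F>" "\<Union>\<G> = S" using G by (auto simp: \<C>_def)
    fix Q assume Q: "Q \<in> \<G>"
    show "\<Union>(\<G> - {Q}) \<noteq> S"
    proof
      assume "\<Union>(\<G> - {Q}) = S"
      then have "\<G> - {Q} \<in> \<C>" using G by (auto simp: \<C>_def)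
      then have "\<G> = \<G> - {Q}" using min by (metis Diff_subset)
      then show False using Q by blast
    qed
  qed
qed

definition piece :: "nat \<Rightarrow> nat \<Rightarrow> real set" where
  "piece M i = {real i / real M..real (Suc i) / real M}"

lemma piece_subset: "i < M \<Longrightarrow> piece M i \<subseteq> {0..1}"
proof -
  assume "i < M"
  then have "real (Suc i) \<le> real M" "real M > 0" by linarith+
  then have "real (Suc i) / real M \<le> 1" by (simp add: divide_le_eq)
  then show ?thesis by (auto simp: piece_def intro: order.trans)
qed

lemma UN_piece:
  assumes M: "M > 0"
  shows "(\<Union>i<M. piece M i) = {0..1}"
proof
  show "{0..1} \<subseteq> (\<Union>i<M. piece M i)"
  proof
    fix t :: real assume t: "t \<in> {0..1}"
    show "t \<in> (\<Union>i<M. piece M i)"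
    proof (cases "t = 1")
      case True
      have "1 \<in> piece M (M - 1)" using M by (auto simp: piece_def of_nat_diff)
      then show ?thesis using True M by (intro UN_I[of "M - 1"]) auto
    next
      case False
      define i where "i = nat \<lfloor>t * real M\<rfloor>"
      have t0: "0 \<le> t * real M" "t * real M < real M" using t False M by auto
      have "real i \<le> t * real M" "t * real M \<le> real (Suc i)" "i < M"
        using t0 by (auto simp: i_def nat_less_iff floor_less_iff) linarith
      then show ?thesis using M by (intro UN_I[of i]) (auto simp: piece_def field_simps)
    qed
  qed
qed (use piece_subset in auto)

lemma small_pieces:
  fixes g :: "real \<Rightarrow> 'a::metric_space"
  assumes "continuous_on {0..1} g" "\<epsilon> > 0"
  obtains M where "M > (0::nat)"
    "\<And>i x y. i < M \<Longrightarrow> x \<in> piece M i \<Longrightarrow> y \<in> piece M i \<Longrightarrow> dist (g x) (g y) < \<epsilon>"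
proof -
  have "uniformly_continuous_on {0..1} g" using assms by (intro compact_uniformly_continuous) auto
  then obtain e where e: "e > 0" "\<And>s t. s \<in> {0..1} \<Longrightarrow> t \<in> {0..1} \<Longrightarrow> dist s t < e \<Longrightarrow> dist (g s) (g t) < \<epsilon>"
    unfolding uniformly_continuous_on_def using assms(2) by metis
  obtain M :: nat where M: "M > 0" "1 / real M < e" using e(1) by (metis nat_approx_posE of_nat_Suc zero_less_Suc)
  show ?thesis
  proof (rule that[OF M(1)])
    fix i x y assume i: "i < M" and xy: "x \<in> piece M i" "y \<in> piece M i"
    have "dist x y \<le> 1 / real M" using xy by (auto simp: piece_def add_divide_distrib dist_real_def abs_le_iff)
    then show "dist (g x) (g y) < \<epsilon>" using xy piece_subset[OF i] M(2) by (intro e(2)) auto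
  qed
qed

context pcf_dynamics
begin

lemma horizontal_exit:
  assumes p: "p \<in> interior K" and dir: "\<sigma> \<noteq> (0::complex)"
  obtains t where "t > 0" "p + of_real t * \<sigma> \<in> J" "closed_segment p (p + of_real t * \<sigma>) \<subseteq> insert (p + of_real t * \<sigma>) (interior K)"
proof -
  obtain t where t: "0 < t" "p + t *\<^sub>R \<sigma> \<in> frontier K" "\<And>e. 0 \<le> e \<Longrightarrow> e < t \<Longrightarrow> p + e *\<^sub>R \<sigma> \<in> interior K"
    using ray_to_frontier[OF compact_imp_bounded[OF compact_K] p dir] by blast
  show ?thesis
  proof (rule that[OF t(1)])
    show "p + of_real t * \<sigma> \<in> J" using t(2) by (simp add: julia_set_def scaleR_conv_of_real)
    show "closed_segment p (p + of_real t * \<sigma>) \<subseteq> insert (p + of_real t * \<sigma>) (interior K)"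
    proof
      fix x assume "x \<in> closed_segment p (p + of_real t * \<sigma>)"
      then obtain u where u: "0 \<le> u" "u \<le> 1" "x = (1 - u) *\<^sub>R p + u *\<^sub>R (p + of_real t * \<sigma>)"
        by (auto simp: closed_segment_def)
      then have x: "x = p + (u * t) *\<^sub>R \<sigma>" by (simp add: algebra_simps scaleR_conv_of_real)
      show "x \<in> insert (p + of_real t * \<sigma>) (interior K)"
      proof (cases "u = 1")
        case False
        then have "u * t < t" using u t(1) by simp
        then show ?thesis using t(3)[of "u * t"] u(1) t(1) x by simp
      qed (simp add: x scaleR_conv_of_real)
    qed
  qed
qed

text \<open>Cover \<open>J\<close> irredundantly by small subarcs of the curve and drop one whose removal leaves the rest
  connected. Each postcritical point reaches the rest inside \<open>K\<close> along one of its two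
  horizontal rays, because the dropped piece is too small to contain both exit points.\<close>

lemma non_separating_point:
  fixes \<phi> :: "real \<Rightarrow> complex"
  assumes \<phi>: "continuous_on {0..1} \<phi>" "\<phi> ` {0..1} = J"
  shows "\<exists>w\<in>J. \<exists>H. compact H \<and> connected H \<and> H \<subseteq> K \<and> P \<subseteq> H \<and> w \<notin> H \<and> H \<inter> J \<noteq> {}"
proof -
  \<comment> \<open>Exit points on opposite horizontal rays from \<open>p\<close> are more than
    \<open>\<eta>\<close> apart, as each is at distance at least \<open>\<eta>\<close> from
    \<open>p\<close>, while the pieces are made smaller than \<open>\<eta>\<close>.\<close>
  have "\<exists>\<eta>>0. \<forall>p\<in>P. \<forall>x\<in>J. \<eta> \<le> dist p x"
  proof (rule separate_compact_closed)
    show "compact P" using finite_P by (rule finite_imp_compact)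
    show "closed J" using compact_J by (rule compact_imp_closed)
    show "P \<inter> J = {}" using P_interior by (auto simp: J_eq)
  qed
  then obtain \<eta> where \<eta>: "\<eta> > 0" "\<And>p x. p \<in> P \<Longrightarrow> x \<in> J \<Longrightarrow> \<eta> \<le> dist p x" by blast
  obtain M :: nat where M: "M > 0"
    and piece: "\<And>i s t. i < M \<Longrightarrow> s \<in> piece M i \<Longrightarrow> t \<in> piece M i \<Longrightarrow> dist (\<phi> s) (\<phi> t) < \<eta>"
    using small_pieces[OF \<phi>(1) \<eta>(1)] by metis
  have small: "dist x y < \<eta>" if "i < M" "x \<in> \<phi> ` piece M i" "y \<in> \<phi> ` piece M i" for i x y
    using that piece by blast
  define \<Q> where "\<Q> = (\<lambda>i. \<phi> ` piece M i) ` {..<M}"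
  have "\<Union>\<Q> = \<phi> ` (\<Union>i<M. piece M i)" by (auto simp: \<Q>_def)
  then have "\<Union>\<Q> = J" using UN_piece[OF M] \<phi>(2) by simp
  have "finite \<Q>" by (simp add: \<Q>_def)
  obtain \<F> where F: "\<F> \<subseteq> \<Q>" "\<Union>\<F> = J" "\<And>Q. Q \<in> \<F> \<Longrightarrow> \<Union>(\<F> - {Q}) \<noteq> J"
    using minimal_cover[OF \<open>finite \<Q>\<close> \<open>\<Union>\<Q> = J\<close>] by metis
  have finF: "finite \<F>" using F(1) \<open>finite \<Q>\<close> finite_subset by blast
  have Qprop: "connected Q \<and> compact Q \<and> Q \<noteq> {}" if Q: "Q \<in> \<Q>" for Q
  proof -
    obtain i where i: "i < M" "Q = \<phi> ` piece M i" using Q by (auto simp: \<Q>_def)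
    have "continuous_on (piece M i) \<phi>" using \<phi>(1) piece_subset[OF i(1)] continuous_on_subset by blast
    then show ?thesis unfolding i(2)
      by (auto intro!: connected_continuous_image compact_continuous_image simp: piece_def divide_right_mono)
  qed
  have conJ: "connected J" unfolding \<phi>(2)[symmetric] using \<phi>(1) by (intro connected_continuous_image) auto
  obtain Q where Q: "Q \<in> \<F>" "connected (\<Union>(\<F> - {Q}))"
    using removable_member[OF finF] Qprop F(1,2) conJ J_nonempty compact_imp_closed
    by (metis Union_empty subsetD)
  define H0 where "H0 = \<Union>(\<F> - {Q})"
  have H0J: "H0 \<subseteq> J" using F(2) by (auto simp: H0_def)
  \<comment> \<open>Irredundance of the cover provides a Julia point that only \<open>Q\<close>
    contains; it becomes \<open>w\<close>.\<close>
  have "H0 \<noteq> J" using F(3)[OF Q(1)] by (simp add: H0_def)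
  then obtain w where w: "w \<in> J" "w \<notin> H0" using H0J by blast
  then have wQ: "w \<in> Q" using F(2) by (auto simp: H0_def)
  have cptH0: "compact H0" unfolding H0_def using finF F(1) Qprop by (intro compact_Union) auto
  obtain i where i: "i < M" "Q = \<phi> ` piece M i" using Q(1) F(1) by (auto simp: \<Q>_def)
  have "\<exists>v\<in>H0. closed_segment p v \<subseteq> insert v (interior K)" if p: "p \<in> P" for p
  proof -
    have pi: "p \<in> interior K" using p P_interior by blast
    obtain s where s: "s > 0" "p + of_real s * 1 \<in> J" "closed_segment p (p + of_real s * 1) \<subseteq> insert (p + of_real s * 1) (interior K)"
      using horizontal_exit[OF pi, of 1] by auto
    obtain t where t: "t > 0" "p + of_real t * (-1) \<in> J" "closed_segment p (p + of_real t * (-1)) \<subseteq> insert (p + of_real t * (-1)) (interior K)"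
      using horizontal_exit[OF pi, of "-1"] by auto
    have "dist p (p + of_real s * 1) = s" using s(1) by (simp add: dist_norm)
    then have "\<eta> \<le> s" using \<eta>(2)[OF p s(2)] by simp
    moreover have "dist (p + of_real s * 1) (p + of_real t * (-1)) = s + t"
    proof -
      have eq: "(p + of_real s * 1) - (p + of_real t * (-1)) = of_real (s + t)" by simp
      show ?thesis unfolding dist_norm eq norm_of_real using s(1) t(1) by simp
    qed
    ultimately have "\<not> (p + of_real s * 1 \<in> Q \<and> p + of_real t * (-1) \<in> Q)"
      using small[OF i(1), of "p + of_real s * 1" "p + of_real t * (-1)"] i(2) t(1) by auto
    moreover have "x \<in> H0" if "x \<in> J" "x \<notin> Q" for x using that F(2) by (auto simp: H0_def)
    ultimately show ?thesis using s t by blast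
  qed
  then obtain v where v: "\<And>p. p \<in> P \<Longrightarrow> v p \<in> H0" "\<And>p. p \<in> P \<Longrightarrow> closed_segment p (v p) \<subseteq> insert (v p) (interior K)"
    by metis
  define H where "H = (\<Union>p\<in>P. H0 \<union> closed_segment p (v p))"
  have "compact H" unfolding H_def using finite_P cptH0 by (intro compact_UN) auto
  moreover have "connected H" unfolding H_def
  proof (rule connected_Union)
    show "connected s" if "s \<in> (\<lambda>p. H0 \<union> closed_segment p (v p)) ` P" for s
      using that v(1) Q(2) by (auto simp: H0_def[symmetric] intro!: connected_Un)
    obtain p where "p \<in> P" using P_nonempty by blast
    then show "\<Inter> ((\<lambda>p. H0 \<union> closed_segment p (v p)) ` P) \<noteq> {}" using v(1)[of p] by blast
  qed
  moreover have "H \<subseteq> K"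
  proof
    fix x assume "x \<in> H"
    then obtain p where p: "p \<in> P" "x \<in> H0 \<or> x \<in> closed_segment p (v p)" unfolding H_def by blast
    then have "x \<in> H0 \<or> x \<in> interior K" using v by blast
    then show "x \<in> K" using H0J J_subset_K interior_subset by blast
  qed
  moreover have "P \<subseteq> H" by (auto simp: H_def)
  moreover have "w \<notin> H"
  proof
    assume "w \<in> H"
    then obtain p where p: "p \<in> P" "w \<in> H0 \<or> w \<in> closed_segment p (v p)" unfolding H_def by blast
    then have "w \<in> H0 \<or> w \<in> interior K" using v by blast
    then show False using w by (simp add: J_eq)
  qed
  moreover have "H \<inter> J \<noteq> {}" using v(1) H0J P_nonempty by (force simp: H_def)
  ultimately show ?thesis using w(1) by blast
qed

end

text \<open>The loop construction needs expansion under the map itself, so it is applied to an iterate of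
  \<open>f\<close>, which has the same Julia set.\<close>

lemma filled_julia_set_iter_poly:
  assumes "monic_dynamics f" "m > 0"
  shows "filled_julia_set (iter_poly f m) = filled_julia_set f"
proof -
  interpret monic_dynamics f by fact
  have it: "(poly (iter_poly f m) ^^ n) z = F (m * n) z" for n z
    by (simp add: poly_iter_poly funpow_mult mult.commute)
  show ?thesis
  proof (intro set_eqI iffI)
    fix z assume "z \<in> K"
    then obtain B where "\<And>n. norm (F n z) \<le> B" by (auto simp: filled_julia_set_def bounded_iff)
    then show "z \<in> filled_julia_set (iter_poly f m)"
      unfolding filled_julia_set_def bounded_iff by (auto simp: it)
  next
    fix z assume "z \<in> filled_julia_set (iter_poly f m)"
    then obtain B where B: "\<And>n. norm (F (m * n) z) \<le> B" by (auto simp: filled_julia_set_def bounded_iff it)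
    show "z \<in> K"
    proof (rule ccontr)
      assume "z \<notin> K"
      then obtain N where N: "\<And>n. n \<ge> N \<Longrightarrow> B + 1 \<le> norm (F n z)" using escape by blast
      have "N \<le> m * N" using assms(2) by simp
      then show False using N[of "m * N"] B[of N] by linarith
    qed
  qed
qed

text \<open>Critical points have finite orbits, so they lie in \<open>K\<close>; they are not in
  \<open>J\<close>, since the derivative of the \<open>m\<close>-th iterate vanishes at them. The
  curve is obtained for \<open>iter_poly f m\<close>, which itself expands on
  \<open>J\<close>.\<close>

lemma hyperbolic_pcf_dynamics:
  assumes "lead_coeff f = 1" "degree f \<ge> 2" "hyperbolic_poly f" "postcritically_finite f"
  shows "pcf_dynamics f \<and> (\<exists>\<phi>::real \<Rightarrow> complex. continuous_on {0..1} \<phi> \<and> \<phi> ` {0..1} = julia_set f)"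
proof -
  interpret monic_dynamics f using assms by unfold_locales auto
  obtain m l where ml: "l > 1" "\<And>z. z \<in> J \<Longrightarrow> l \<le> norm (deriv (F m) z)"
    using assms(3) by (auto simp: hyperbolic_poly_def)
  have m0: "m > 0"
  proof (rule ccontr)
    assume "\<not> m > 0"
    then have "deriv (F m) z = 1" for z by (simp add: id_def)
    then show False using ml J_nonempty by fastforce
  qed
  have dF: "deriv (F m) z = poly (pderiv (iter_poly f m)) z" for z
    using deriv_poly[of "iter_poly f m" z] by (simp add: poly_iter_poly)
  have crit: "c \<in> interior K" if c: "poly (pderiv f) c = 0" for c
  proof -
    have fin: "finite (range (\<lambda>n. F n c))" using assms(4) c by (simp add: postcritically_finite_def)
    then have "c \<in> K" by (simp add: filled_julia_set_def finite_imp_bounded)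
    moreover have "c \<notin> J"
    proof
      assume "c \<in> J"
      moreover have "deriv (F m) c = 0"
        unfolding dF pderiv_iter_poly using c m0 by (intro prod_zero) (auto intro!: bexI[of _ 0])
      ultimately show False using ml by fastforce
    qed
    ultimately show ?thesis by (simp add: J_eq)
  qed
  interpret pcf_dynamics f
    using crit assms(4) by unfold_locales (auto simp: postcritically_finite_def)
  have Kg: "filled_julia_set (iter_poly f m) = K"
    by (rule filled_julia_set_iter_poly[OF monic_dynamics_axioms m0])
  then have Jg: "julia_set (iter_poly f m) = J" by (simp add: julia_set_def)
  interpret g: pcf_dynamics "iter_poly f m"
  proof
    show "lead_coeff (iter_poly f m) = 1" by (rule lead_coeff_iter_poly)
    have "(2::nat) ^ 1 \<le> d ^ m" using degree_ge_2 m0 by (intro power_mono order.trans[OF power_increasing[of 1 m 2]]) auto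
    then show "2 \<le> degree (iter_poly f m)" by (simp add: degree_iter_poly)
    fix c assume "poly (pderiv (iter_poly f m)) c = 0"
    then obtain j where j: "j < m" "poly (pderiv f) (F j c) = 0" by (auto simp: pderiv_iter_poly)
    show "c \<in> interior (filled_julia_set (iter_poly f m))"
      unfolding Kg using crit_interior[OF j(2)] iter_mem_interior_K_iff by blast
    have "finite (range (\<lambda>n. F n (F j c)))" by (rule crit_finite[OF j(2)])
    then have "finite ((\<lambda>n. F n c) ` {..<j} \<union> range (\<lambda>n. F n (F j c)))" by auto
    moreover have "range (\<lambda>n. F n c) \<subseteq> (\<lambda>n. F n c) ` {..<j} \<union> range (\<lambda>n. F n (F j c))"
    proof
      fix y assume "y \<in> range (\<lambda>n. F n c)"
      then obtain n where n: "y = F n c" by blast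
      show "y \<in> (\<lambda>n. F n c) ` {..<j} \<union> range (\<lambda>n. F n (F j c))"
      proof (cases "n < j")
        case False
        then have "y = F (n - j) (F j c)" using n by (simp flip: iter_poly_add)
        then show ?thesis by blast
      qed (use n in auto)
    qed
    ultimately have "finite (range (\<lambda>n. F n c))" using finite_subset by blast
    then show "finite (range (\<lambda>n. (poly (iter_poly f m) ^^ n) c))"
      by (rule finite_subset[rotated]) (auto simp: poly_iter_poly funpow_mult)
  qed
  have "\<exists>\<phi>::real \<Rightarrow> complex. continuous_on {0..1} \<phi> \<and> \<phi> ` {0..1} = julia_set (iter_poly f m)"
    by (rule g.julia_curve[OF ml(1)]) (use ml(2) dF in \<open>simp add: Jg\<close>)
  then show ?thesis using Jg pcf_dynamics_axioms by simp
qed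

section \<open>Connecting points of small height\<close>

context pcf_dynamics
begin

text \<open>The domain is a component of \<open>W N\<close> minus the disc around \<open>w\<close>. Together with the complement
  of a connected set joining the postcritical points to the outside of \<open>W N\<close> it fills the simply
  connected set \<open>W N\<close>, which lets connectedness of the preimages of \<open>W N\<close> pass to those of the
  domain.\<close>

lemma connected_preimage_domain:
  assumes H: "compact H" "connected H" "H \<subseteq> K" "P \<subseteq> H"
    and v: "v \<in> H" "v' \<notin> W N" "closed_segment v v' \<inter> cball w \<rho> = {}" and w: "H \<inter> cball w \<rho> = {}"
  shows "\<exists>A. open A \<and> A \<noteq> {} \<and> P \<subseteq> A \<and> A \<subseteq> W N - cball w \<rho> \<and> (\<forall>n. connected (F n -` A))"
proof -
  have vW: "v \<in> W N" using v(1) H(3) K_subset_W by blast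
  have "v' - v \<noteq> 0" using vW v(2) by auto
  then obtain t where t: "0 < t" "v + t *\<^sub>R (v' - v) \<in> frontier (W N)"
    "\<And>e. 0 \<le> e \<Longrightarrow> e < t \<Longrightarrow> v + e *\<^sub>R (v' - v) \<in> interior (W N)"
    using ray_to_frontier[of "W N" v "v' - v"] W_bounded bounded_ball bounded_subset vW open_W
    by (metis interior_open)
  \<comment> \<open>\<open>a\<close> is the first exit of the segment from \<open>W N\<close>. The
    half-open segment up to \<open>a\<close> lies in \<open>A\<close>, while \<open>M\<close> leaves
    out the closed one.\<close>
  define a where "a = v + t *\<^sub>R (v' - v)"
  define S where "S = W N - cball w \<rho>"
  define A where "A = connected_component_set S v"
  have opS: "open S" unfolding S_def by (intro open_Diff open_W) auto
  have aW: "a \<notin> W N" using t(2) open_W[of N] by (simp add: a_def frontier_def interior_open)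
  have "t \<le> 1"
  proof (rule ccontr)
    assume "\<not> t \<le> 1"
    then have "v + 1 *\<^sub>R (v' - v) \<in> interior (W N)" by (intro t(3)) auto
    then show False using v(2) interior_subset by auto
  qed
  have seg: "v + e *\<^sub>R (v' - v) \<in> S" if "0 \<le> e" "e < t" for e
  proof -
    have "v + e *\<^sub>R (v' - v) \<in> closed_segment v v'"
      using that \<open>t \<le> 1\<close> by (auto simp: closed_segment_def algebra_simps intro!: exI[of _ e])
    then show ?thesis using t(3)[OF that] v(3) interior_subset unfolding S_def by blast
  qed
  have "H \<subseteq> S" using H(3) K_subset_W w unfolding S_def by blast
  then have HA: "H \<subseteq> A" unfolding A_def using H(2) v(1) by (intro connected_component_maximal) auto
  have "(\<lambda>e. v + e *\<^sub>R (v' - v)) ` {0..<t} \<subseteq> A"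
    unfolding A_def
  proof (rule connected_component_maximal)
    show "v \<in> (\<lambda>e. v + e *\<^sub>R (v' - v)) ` {0..<t}" using t(1) by (intro image_eqI[of _ _ 0]) auto
    show "connected ((\<lambda>e. v + e *\<^sub>R (v' - v)) ` {0..<t})"
      by (intro connected_continuous_image continuous_intros) auto
  qed (use seg in auto)
  then have LA: "v + e *\<^sub>R (v' - v) \<in> A" if e: "0 \<le> e" "e < t" for e
    by (rule subsetD) (intro imageI, use e in simp)
  have opA: "open A" unfolding A_def using opS by (rule open_connected_component)
  have conA: "connected A" unfolding A_def by simp
  have AS: "A \<subseteq> S" unfolding A_def by (rule connected_component_subset)
  have A0: "A \<noteq> {}" using HA v(1) by blast
  \<comment> \<open>The closed segment ties \<open>H\<close> to the complement of
    \<open>W N\<close>, making the complement of \<open>M\<close> connected and unbounded; the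
    components of \<open>M\<close> are then simply connected.\<close>
  define M where "M = W N - (H \<union> closed_segment v a)"
  have opM: "open M" unfolding M_def using H(1) by (intro open_Diff open_W closed_Un) (auto simp: compact_imp_closed)
  have eqM: "- M = - W N \<union> (H \<union> closed_segment v a)" by (auto simp: M_def)
  have "connected (- M)" unfolding eqM
  proof (rule connected_Un[OF connected_compl_W])
    show "connected (H \<union> closed_segment v a)" using H(2) v(1) by (intro connected_Un) auto
    show "- W N \<inter> (H \<union> closed_segment v a) \<noteq> {}" using aW by auto
  qed
  moreover have "\<not> bounded (- M)"
  proof
    assume "bounded (- M)"
    then have "bounded (- M \<union> ball 0 (2 * R0))" by (intro bounded_Un[THEN iffD2]) auto
    moreover have "- M \<union> ball 0 (2 * R0) = UNIV" using W_bounded[of N] by (auto simp: M_def)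
    ultimately show False by simp
  qed
  ultimately have scM: "simply_connected C" if "C \<in> components M" for C
    using simply_connected_components opM that by blast
  have AM: "A \<union> M = W N"
  proof
    show "A \<union> M \<subseteq> W N" using AS by (auto simp: S_def M_def)
    show "W N \<subseteq> A \<union> M"
    proof
      fix x assume x: "x \<in> W N"
      show "x \<in> A \<union> M"
      proof (cases "x \<in> closed_segment v a")
        case True
        then obtain u where u: "0 \<le> u" "u \<le> 1" "x = (1 - u) *\<^sub>R v + u *\<^sub>R a" by (auto simp: closed_segment_def)
        then have xe: "x = v + (u * t) *\<^sub>R (v' - v)" by (simp add: a_def algebra_simps)
        have "u \<noteq> 1" using u(3) x aW by auto
        then have "0 \<le> u * t" "u * t < t" using u(1,2) t(1) by auto
        then show ?thesis using LA xe by blast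
      next
        case False
        then show ?thesis using x HA by (auto simp: M_def)
      qed
    qed
  qed
  have MP: "M \<inter> P = {}" using H(4) by (auto simp: M_def)
  have "connected (F n -` A)" for n
  proof -
    have "connected (poly (iter_poly f n) -` A)"
    proof (rule connected_preimage_subset[OF degree_iter_pos opM iter_regular[OF MP] scM opA])
      show "connected (A \<inter> C) \<and> A \<inter> C \<noteq> {}" if "C \<in> components M" for C
        using connected_Int_component[OF opA conA A0 opM _ that] simply_connected_W[of N] by (simp add: AM)
      show "connected (poly (iter_poly f n) -` (A \<union> M))"
        unfolding AM poly_iter_poly W_preimage by (rule connected_W)
    qed
    then show ?thesis by (simp add: poly_iter_poly)
  qed
  then show ?thesis using opA A0 H(4) HA AS unfolding S_def by blast
qed

end

section \<open>Cells around the preimages of the chosen point\<close>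

locale disc_sections = pcf_dynamics +
  fixes w :: complex and \<rho> :: real and s :: "nat \<Rightarrow> complex \<Rightarrow> complex \<Rightarrow> complex"
  assumes \<rho>: "\<rho> > 0" and disc: "ball w (2 * \<rho>) \<inter> P = {}"
    and s_hol: "F n \<zeta> = w \<Longrightarrow> s n \<zeta> holomorphic_on ball w (2 * \<rho>)"
    and s_inv: "F n \<zeta> = w \<Longrightarrow> u \<in> ball w (2 * \<rho>) \<Longrightarrow> F n (s n \<zeta> u) = u"
    and s_centre: "F n \<zeta> = w \<Longrightarrow> s n \<zeta> w = \<zeta>"
begin

definition hits :: "nat \<Rightarrow> complex set \<Rightarrow> complex set" where
  "hits n C = {\<zeta>. F n \<zeta> = w \<and> C \<inter> s n \<zeta> ` cball w \<rho> \<noteq> {}}"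

lemma finite_fibre_w: "finite {\<zeta>. F n \<zeta> = w}"
  using finite_fibre(1)[OF degree_iter_pos, of n w] by (simp add: poly_iter_poly)

lemma finite_hits: "finite (hits n C)"
  by (rule finite_subset[OF _ finite_fibre_w[of n]]) (auto simp: hits_def)

lemma card_fibre_w: "card {\<zeta>. F n \<zeta> = w} = d ^ n"
proof -
  have "w \<in> ball w (2 * \<rho>)" using \<rho> by simp
  then have "card {z. poly (iter_poly f n) z = w} = degree (iter_poly f n)"
    using iter_regular[OF disc, of n] by (intro card_simple_fibre(2) degree_iter_pos) auto
  then show ?thesis by (simp add: poly_iter_poly degree_iter_poly)
qed

lemma cball_subset_disc: "cball w \<rho> \<subseteq> ball w (2 * \<rho>)"
  using \<rho> by auto

lemma continuous_on_s: "F n \<zeta> = w \<Longrightarrow> continuous_on (ball w (2 * \<rho>)) (s n \<zeta>)"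
  using s_hol holomorphic_on_imp_continuous_on by blast

text \<open>If \<open>C\<close> meets a closed cell over radius \<open>\<rho>\<close>, its image
  stays in the disc of radius \<open>2 * \<rho>\<close>, so \<open>C\<close> remains in the larger
  cell by uniqueness of lifts. The larger cells are disjoint for distinct centres.\<close>

lemma hits_small:
  assumes C: "connected C" "\<And>x y. x \<in> C \<Longrightarrow> y \<in> C \<Longrightarrow> dist (F n x) (F n y) < \<rho>"
  shows "card (hits n C) \<le> 1"
proof -
  have reg: "degree (iter_poly f n) > 0" "open (ball w (2 * \<rho>))"
    "\<And>z. poly (iter_poly f n) z \<in> ball w (2 * \<rho>) \<Longrightarrow> poly (pderiv (iter_poly f n)) z \<noteq> 0"
    using degree_iter_pos iter_regular[OF disc] by auto
  have in_cell: "F n y \<in> ball w (2 * \<rho>) \<and> y = s n \<zeta> (F n y)" if z: "\<zeta> \<in> hits n C" and y: "y \<in> C" for \<zeta> y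
  proof -
    obtain x where x: "F n \<zeta> = w" "x \<in> cball w \<rho>" "s n \<zeta> x \<in> C" using z unfolding hits_def by blast
    have Fx: "F n (s n \<zeta> x) = x" using s_inv[OF x(1)] x(2) cball_subset_disc by blast
    have near: "F n y' \<in> ball w (2 * \<rho>)" if "y' \<in> C" for y'
    proof -
      have "dist x (F n y') < \<rho>" using C(2)[OF x(3) that] Fx by simp
      moreover have "dist w x \<le> \<rho>" using x(2) by simp
      ultimately show ?thesis using dist_triangle[of w "F n y'" x] by simp
    qed
    have "y = s n \<zeta> (F n y)"
    proof (rule poly_lift_unique[OF reg C(1), of "\<lambda>y. y" "\<lambda>y. s n \<zeta> (F n y)" "s n \<zeta> x" y])
      show "continuous_on C (\<lambda>y. s n \<zeta> (F n y))"
        using near by (intro continuous_on_compose2[OF continuous_on_s[OF x(1)] continuous_on_iter]) auto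
    qed (use near x y Fx s_inv[OF x(1)] in \<open>auto simp: poly_iter_poly\<close>)
    then show ?thesis using near y by blast
  qed
  have "\<zeta> = \<zeta>'" if z: "\<zeta> \<in> hits n C" "\<zeta>' \<in> hits n C" for \<zeta> \<zeta>'
  proof (rule ccontr)
    assume ne: "\<zeta> \<noteq> \<zeta>'"
    have fib: "F n \<zeta> = w" "F n \<zeta>' = w" using z by (auto simp: hits_def)
    obtain y where y: "y \<in> C" using z(1) by (auto simp: hits_def)
    have "s n \<zeta> ` ball w (2 * \<rho>) \<inter> s n \<zeta>' ` ball w (2 * \<rho>) = {}"
      by (rule sections_disjoint[OF reg, of w])
        (use fib ne s_centre s_inv continuous_on_s \<rho> in \<open>auto simp: poly_iter_poly\<close>)
    moreover have "y \<in> s n \<zeta> ` ball w (2 * \<rho>)" "y \<in> s n \<zeta>' ` ball w (2 * \<rho>)"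
      by (metis in_cell[OF z(1) y] imageI, metis in_cell[OF z(2)] y imageI)
    ultimately show False by blast
  qed
  then show ?thesis using finite_hits by (metis One_nat_def card_le_Suc0_iff_eq)
qed

text \<open>The path is lifted from \<open>z\<close>, and each of its \<open>M\<close> short pieces
  lifts to a set meeting at most one cell. The count \<open>M\<close> is independent of
  \<open>n\<close>.\<close>

lemma hits_lift:
  assumes g: "path g" "path_image g \<subseteq> W N - P"
    and M: "M > 0" "\<And>i x y. i < M \<Longrightarrow> x \<in> piece M i \<Longrightarrow> y \<in> piece M i \<Longrightarrow> dist (g x) (g y) < \<rho>"
    and z: "F n z = pathstart g"
  shows "\<exists>C z'. connected C \<and> z \<in> C \<and> z' \<in> C \<and> F n z' = pathfinish g \<and> C \<subseteq> W (N + n) \<and> card (hits n C) \<le> M"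
proof -
  have opP: "open (- P)" using finite_P finite_imp_closed by blast
  have cov: "covering_space (poly (iter_poly f n) -` (- P)) (poly (iter_poly f n)) (- P)"
    using iter_regular[of "- P" n] by (intro poly_covering_space degree_iter_pos opP) auto
  have "pathstart g \<in> - P" using g(2) by auto
  then obtain h where h: "path h" "pathstart h = z" "\<And>t. t \<in> {0..1} \<Longrightarrow> F n (h t) = g t"
  proof -
    have "z \<in> poly (iter_poly f n) -` (- P)" using z \<open>pathstart g \<in> - P\<close> by (simp add: poly_iter_poly)
    moreover have "path_image g \<subseteq> - P" using g(2) by blast
    moreover have "pathstart g = poly (iter_poly f n) z" using z by (simp add: poly_iter_poly)
    ultimately show ?thesis
      using covering_space_lift_path_strong[OF cov, of z g] g(1) that by (metis poly_iter_poly)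
  qed
  have one: "card (hits n (h ` piece M i)) \<le> 1" if i: "i < M" for i
  proof (rule hits_small)
    have "continuous_on (piece M i) h" using h(1) piece_subset[OF i] continuous_on_subset unfolding path_def by blast
    then show "connected (h ` piece M i)" by (intro connected_continuous_image) (auto simp: piece_def)
    fix x y assume "x \<in> h ` piece M i" "y \<in> h ` piece M i"
    then obtain x' y' where "x' \<in> piece M i" "y' \<in> piece M i" "x = h x'" "y = h y'" by blast
    then show "dist (F n x) (F n y) < \<rho>" using M(2)[OF i] h(3) piece_subset[OF i] by (metis subsetD)
  qed
  have "hits n (path_image h) \<subseteq> (\<Union>i<M. hits n (h ` piece M i))"
  proof
    fix \<zeta> assume "\<zeta> \<in> hits n (path_image h)"
    then obtain t where t: "t \<in> {0..1}" "h t \<in> s n \<zeta> ` cball w \<rho>" and \<zeta>: "F n \<zeta> = w"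
      unfolding hits_def path_image_def by blast
    obtain i where "i < M" "t \<in> piece M i" using t(1) UN_piece[OF M(1)] by blast
    then show "\<zeta> \<in> (\<Union>i<M. hits n (h ` piece M i))" using t(2) \<zeta> unfolding hits_def by blast
  qed
  then have "card (hits n (path_image h)) \<le> card (\<Union>i<M. hits n (h ` piece M i))"
    by (intro card_mono) (auto simp: finite_hits)
  also have "\<dots> \<le> (\<Sum>i<M. card (hits n (h ` piece M i)))" by (intro card_UN_le) auto
  also have "\<dots> \<le> (\<Sum>i<M. 1)" using one by (intro sum_mono) auto
  finally have "card (hits n (path_image h)) \<le> M" by simp
  moreover have "path_image h \<subseteq> F n -` W N"
  proof
    fix x assume "x \<in> path_image h"
    then obtain t where t: "t \<in> {0..1}" "x = h t" by (auto simp: path_image_def)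
    then have "F n x \<in> path_image g" using h(3) by (auto simp: path_image_def)
    then show "x \<in> F n -` W N" using g(2) by blast
  qed
  moreover have "z \<in> path_image h" using h(2) by (metis pathstart_in_path_image)
  moreover have "F n (pathfinish h) = pathfinish g" using h(3)[of 1] by (simp add: pathfinish_def)
  ultimately show ?thesis
    using connected_path_image[OF h(1)] pathfinish_in_path_image W_preimage by metis
qed

text \<open>Near each point of a compact region one fixed path leads to \<open>A\<close> inside
  \<open>W N - P\<close>; its lifts under all iterates meet a number of cells bounded independently
  of \<open>n\<close>. Compactness gives one bound \<open>q\<close> for all points.\<close>

lemma bounded_hits:
  assumes A: "open A" "A \<noteq> {}" "P \<subseteq> A" "A \<subseteq> W N"
  obtains q :: nat where "\<And>n z. norm (F N (F n z)) \<le> R0 \<Longrightarrow>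
     \<exists>C. connected C \<and> z \<in> C \<and> C \<inter> F n -` A \<noteq> {} \<and> C \<subseteq> W (N + n) \<and> card (hits n C) \<le> q"
proof -
  define good where "good n z q \<longleftrightarrow>
    (\<exists>C. connected C \<and> z \<in> C \<and> C \<inter> F n -` A \<noteq> {} \<and> C \<subseteq> W (N + n) \<and> card (hits n C) \<le> q)" for n z q
  define S where "S = F N -` cball 0 R0"
  have SW: "S \<subseteq> W N" using R0(1) by (auto simp: S_def W_def)
  then have "bounded S" using W_bounded bounded_ball bounded_subset by metis
  moreover have "closed S" unfolding S_def by (intro closed_iter_vimage) auto
  ultimately have cptS: "compact S" by (simp add: compact_eq_bounded_closed)
  have local: "\<exists>e q. e > 0 \<and> (\<forall>u'\<in>ball u e. \<forall>n z. F n z = u' \<longrightarrow> good n z q)" if u: "u \<in> S" for u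
  \<comment> \<open>Postcritical points belong to the first case, as \<open>P \<subseteq> A\<close>;
    in the second a path avoiding \<open>P\<close> is available for lifting.\<close>
  proof (cases "u \<in> A")
    case True
    then obtain e where e: "e > 0" "ball u e \<subseteq> A" using A(1) open_contains_ball by blast
    have "good n z 1" if z: "F n z \<in> ball u e" for n z
    proof -
      have "F n z \<in> A" using z e(2) by blast
      moreover have "z \<in> W (N + n)" using \<open>F n z \<in> A\<close> A(4) W_preimage[of n N] by blast
      moreover have "card (hits n {z}) \<le> 1" using \<rho> by (intro hits_small) auto
      ultimately show ?thesis unfolding good_def by (intro exI[of _ "{z}"]) auto
    qed
    then show ?thesis using e(1) by blast
  next
    case False
    have op: "open (W N - P)" using finite_P by (intro open_Diff open_W finite_imp_closed)
    have con: "connected (W N - P)" using finite_P by (intro connected_open_diff_countable connected_W open_W countable_finite) auto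
    have uW: "u \<in> W N - P" using u SW False A(3) by blast
    have "infinite A"
    proof -
      obtain x r where "r > 0" "ball x r \<subseteq> A" using A(1,2) open_contains_ball by blast
      then show ?thesis using uncountable_ball[of r x] by (metis countable_finite finite_subset)
    qed
    then obtain a where a: "a \<in> A" "a \<notin> P" using finite_P by (metis finite_subset subsetI)
    have "path_connected (W N - P)" using op con by (rule connected_open_path_connected)
    then obtain g where g: "path g" "path_image g \<subseteq> W N - P" "pathstart g = u" "pathfinish g = a"
      using uW a A(4) unfolding path_connected_def by blast
    obtain M where M: "M > 0" "\<And>i x y. i < M \<Longrightarrow> x \<in> piece M i \<Longrightarrow> y \<in> piece M i \<Longrightarrow> dist (g x) (g y) < \<rho>"
      using small_pieces[OF g(1)[unfolded path_def] \<rho>] by metis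
    obtain e where e: "e > 0" "ball u e \<subseteq> W N - P" using op uW open_contains_ball by blast
    \<comment> \<open>The lift of a straight segment to the centre \<open>u\<close> meets at most
      one cell; the path from \<open>u\<close> adds its \<open>M\<close> pieces.\<close>
    have "good n z (1 + M)" if z: "F n z \<in> ball u (min e \<rho>)" for n z
    proof -
      define l where "l = linepath (F n z) u"
      have "closed_segment (F n z) u \<subseteq> ball u e" using z e(1) by (intro closed_segment_subset) auto
      then have l: "path l" "path_image l \<subseteq> W N - P" using e(2) by (auto simp: l_def)
      have "dist (l x) (l y) < \<rho>" if "x \<in> {0..1}" "y \<in> {0..1}" for x y
      proof -
        have "l x - l y = (x - y) *\<^sub>R (u - F n z)" by (simp add: l_def linepath_def algebra_simps)
        then have "dist (l x) (l y) = \<bar>x - y\<bar> * dist u (F n z)" by (simp add: dist_norm)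
        also have "\<dots> \<le> 1 * dist u (F n z)" using that by (intro mult_right_mono) auto
        finally show ?thesis using z by simp
      qed
      then have "\<exists>C z'. connected C \<and> z \<in> C \<and> z' \<in> C \<and> F n z' = pathfinish l \<and> C \<subseteq> W (N + n) \<and> card (hits n C) \<le> 1"
        by (intro hits_lift[OF l]) (auto simp: l_def piece_def)
      then obtain C z' where C: "connected C" "z \<in> C" "z' \<in> C" "F n z' = u" "C \<subseteq> W (N + n)" "card (hits n C) \<le> 1"
        by (auto simp: l_def)
      have "\<exists>C' z''. connected C' \<and> z' \<in> C' \<and> z'' \<in> C' \<and> F n z'' = pathfinish g \<and> C' \<subseteq> W (N + n) \<and> card (hits n C') \<le> M"
      proof (rule hits_lift[OF g(1,2) M(1)])
        show "F n z' = pathstart g" by (simp add: C(4) g(3))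
      qed (rule M(2))
      then obtain C' z'' where C': "connected C'" "z' \<in> C'" "z'' \<in> C'" "F n z'' = a" "C' \<subseteq> W (N + n)" "card (hits n C') \<le> M"
        by (auto simp: g(4))
      have eq: "hits n (C \<union> C') = hits n C \<union> hits n C'" by (auto simp: hits_def)
      have "card (hits n (C \<union> C')) \<le> 1 + M" unfolding eq using card_Un_le[of "hits n C" "hits n C'"] C(6) C'(6) by linarith
      moreover have "connected (C \<union> C')" using C C' by (intro connected_Un) auto
      moreover have "z'' \<in> (C \<union> C') \<inter> F n -` A" using C'(3,4) a(1) by blast
      ultimately show ?thesis unfolding good_def using C(2,5) C'(5) by (intro exI[of _ "C \<union> C'"]) blast
    qed
    then show ?thesis using e(1) \<rho> by (intro exI[of _ "min e \<rho>"] exI[of _ "1 + M"]) auto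
  qed
  then obtain e q where eq: "\<And>u. u \<in> S \<Longrightarrow> e u > (0::real)"
    "\<And>u n z. u \<in> S \<Longrightarrow> F n z \<in> ball u (e u) \<Longrightarrow> good n z (q u)" by metis
  have "S \<subseteq> (\<Union>u\<in>S. ball u (e u))" using eq(1) by fastforce
  then obtain S' where S': "S' \<subseteq> S" "finite S'" "S \<subseteq> (\<Union>u\<in>S'. ball u (e u))"
    using compactE_image[OF cptS, of S "\<lambda>u. ball u (e u)"] by blast
  show ?thesis
  proof (rule that[of "\<Sum>u\<in>S'. q u"])
    fix n z assume "norm (F N (F n z)) \<le> R0"
    then have "F n z \<in> S" by (simp add: S_def)
    then obtain u where u: "u \<in> S'" "F n z \<in> ball u (e u)" using S'(3) by blast
    have "q u \<le> (\<Sum>u\<in>S'. q u)" using S'(2) u(1) by (intro member_le_sum) auto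
    moreover have "good n z (q u)" using eq(2) u S'(1) by blast
    ultimately show "\<exists>C. connected C \<and> z \<in> C \<and> C \<inter> F n -` A \<noteq> {} \<and> C \<subseteq> W (N + n) \<and> card (hits n C) \<le> (\<Sum>u\<in>S'. q u)"
      unfolding good_def by (meson order.trans)
  qed
qed

text \<open>The connected preimage of \<open>A\<close> avoids all closed cells and links the
  connecting sets of the points of \<open>Z\<close>. These sets meet at most \<open>q * D\<close>
  cells, at most half of the \<open>d ^ n\<close>, so the others can be removed from
  \<open>W (N + n)\<close> and an arc drawn in the component that contains everything.\<close>

lemma arc_avoiding_cells:
  assumes A: "open A" "A \<noteq> {}" "A \<subseteq> W N - cball w \<rho>" "\<And>n. connected (F n -` A)"
    and q: "\<And>n z. norm (F N (F n z)) \<le> R0 \<Longrightarrow>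
     \<exists>C. connected C \<and> z \<in> C \<and> C \<inter> F n -` A \<noteq> {} \<and> C \<subseteq> W (N + n) \<and> card (hits n C) \<le> q"
    and Z: "finite Z" "Z \<noteq> {}" "card Z \<le> D" "\<And>z. z \<in> Z \<Longrightarrow> norm (F (N + n) z) \<le> R0"
    and n: "2 * q * D \<le> d ^ n"
  shows "\<exists>p I. arc p \<and> Z \<subseteq> path_image p \<and> path_image p \<subseteq> W (N + n) \<and> I \<subseteq> {\<zeta>. F n \<zeta> = w} \<and>
    real d ^ n / 2 \<le> real (card I) \<and> (\<forall>\<zeta>\<in>I. path_image p \<inter> s n \<zeta> ` cball w \<rho> = {})"
proof -
  have "\<exists>C. connected C \<and> z \<in> C \<and> C \<inter> F n -` A \<noteq> {} \<and> C \<subseteq> W (N + n) \<and> card (hits n C) \<le> q" if "z \<in> Z" for z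
    using q[of n z] Z(4)[OF that] by (simp add: iter_poly_add)
  then obtain C where C: "\<And>z. z \<in> Z \<Longrightarrow> connected (C z) \<and> z \<in> C z \<and> C z \<inter> F n -` A \<noteq> {} \<and> C z \<subseteq> W (N + n) \<and> card (hits n (C z)) \<le> q"
    by metis
  define H where "H = (\<Union>z\<in>Z. hits n (C z))"
  define I where "I = {\<zeta>. F n \<zeta> = w} - H"
  have "card H \<le> (\<Sum>z\<in>Z. card (hits n (C z)))" unfolding H_def using Z(1) by (rule card_UN_le)
  also have "\<dots> \<le> card Z * q" using C by (intro sum_bounded_above[of Z _ q, simplified]) auto
  also have "\<dots> \<le> D * q" using Z(3) by simp
  finally have cH: "2 * card H \<le> d ^ n" using n by (simp add: mult.commute mult.left_commute)
  have finH: "finite H" unfolding H_def using Z(1) finite_hits by blast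
  have "d ^ n - card H \<le> card I" unfolding I_def using diff_card_le_card_Diff[OF finH] card_fibre_w by metis
  then have "d ^ n \<le> 2 * card I" using cH by linarith
  then have "real (d ^ n) \<le> real (2 * card I)" by (simp only: of_nat_le_iff)
  then have cI: "real d ^ n / 2 \<le> real (card I)" by simp
  have finI: "finite I" unfolding I_def using finite_fibre_w by blast
  define U where "U = W (N + n) - (\<Union>\<zeta>\<in>I. s n \<zeta> ` cball w \<rho>)"
  have opU: "open U" unfolding U_def
  proof (intro open_Diff open_W closed_UN finI ballI)
    fix \<zeta> assume "\<zeta> \<in> I"
    then have "F n \<zeta> = w" by (simp add: I_def)
    then have "continuous_on (cball w \<rho>) (s n \<zeta>)"
      using continuous_on_s cball_subset_disc continuous_on_subset by blast
    then show "closed (s n \<zeta> ` cball w \<rho>)" by (intro compact_imp_closed compact_continuous_image) auto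
  qed
  have AU: "F n -` A \<subseteq> U"
  proof
    fix x assume x: "x \<in> F n -` A"
    then have "x \<in> W (N + n)" using A(3) W_preimage[of n N] by blast
    moreover have "x \<notin> s n \<zeta> ` cball w \<rho>" if "\<zeta> \<in> I" for \<zeta>
    proof
      assume "x \<in> s n \<zeta> ` cball w \<rho>"
      then obtain y where y: "y \<in> cball w \<rho>" "x = s n \<zeta> y" by blast
      then have "F n x = y" using s_inv cball_subset_disc \<open>\<zeta> \<in> I\<close> by (auto simp: I_def)
      then show False using x y(1) A(3) by blast
    qed
    ultimately show "x \<in> U" by (auto simp: U_def)
  qed
  have CU: "C z \<subseteq> U" if z: "z \<in> Z" for z
  proof -
    have "C z \<inter> s n \<zeta> ` cball w \<rho> = {}" if "\<zeta> \<in> I" for \<zeta>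
      using that z by (auto simp: I_def H_def hits_def)
    then show ?thesis using C[OF z] by (auto simp: U_def)
  qed
  obtain a where a: "a \<in> F n -` A"
    using A(2) poly_surj[OF degree_iter_pos[of n]] by (metis equals0I poly_iter_poly vimageI2)
  define G where "G = connected_component_set U a"
  have AG: "F n -` A \<subseteq> G" unfolding G_def by (rule connected_component_maximal[OF a A(4) AU])
  have "Z \<subseteq> G"
  proof
    fix z assume z: "z \<in> Z"
    have "connected (F n -` A \<union> C z)" using A(4) C[OF z] by (intro connected_Un) auto
    then have "F n -` A \<union> C z \<subseteq> G" unfolding G_def using a AU CU[OF z] by (intro connected_component_maximal) auto
    then show "z \<in> G" using C[OF z] by blast
  qed
  moreover have "open G" "connected G" unfolding G_def using opU by (auto intro: open_connected_component)
  ultimately obtain p where p: "arc p" "Z \<subseteq> path_image p" "path_image p \<subseteq> G"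
    using arc_through_finite_set[of G Z] Z(1,2) by blast
  have "path_image p \<subseteq> U" using p(3) connected_component_subset unfolding G_def by blast
  then have "path_image p \<subseteq> W (N + n)" "\<forall>\<zeta>\<in>I. path_image p \<inter> s n \<zeta> ` cball w \<rho> = {}" by (auto simp: U_def)
  moreover have "I \<subseteq> {\<zeta>. F n \<zeta> = w}" by (auto simp: I_def)
  ultimately show ?thesis using p(1,2) cI by blast
qed

end

section \<open>Choice of the constants\<close>

context pcf_dynamics
begin

lemma disc_sections_exist:
  assumes "\<rho> > 0" "ball w (2 * \<rho>) \<inter> P = {}"
  shows "\<exists>s. disc_sections f w \<rho> s"
proof -
  have "\<exists>s. F n \<zeta> = w \<longrightarrow> s holomorphic_on ball w (2 * \<rho>) \<and> (\<forall>u\<in>ball w (2 * \<rho>). F n (s u) = u) \<and> s w = \<zeta>" for n \<zeta>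
  proof (cases "F n \<zeta> = w")
    case True
    then have "poly (iter_poly f n) \<zeta> \<in> ball w (2 * \<rho>)" using assms(1) by (simp add: poly_iter_poly)
    from poly_section[OF degree_iter_pos open_ball iter_regular[OF assms(2)] convex_imp_simply_connected[OF convex_ball] this]
    obtain s where s: "s holomorphic_on ball w (2 * \<rho>)" "s (poly (iter_poly f n) \<zeta>) = \<zeta>"
      "\<And>u. u \<in> ball w (2 * \<rho>) \<Longrightarrow> poly (iter_poly f n) (s u) = u" by metis
    have "s w = \<zeta>" using s(2) True by (simp add: poly_iter_poly)
    moreover have "\<forall>u\<in>ball w (2 * \<rho>). F n (s u) = u" using s(3) by (simp add: poly_iter_poly)
    ultimately show ?thesis using s(1) by blast
  qed auto
  then obtain s where s: "\<And>n \<zeta>. F n \<zeta> = w \<Longrightarrow> s n \<zeta> holomorphic_on ball w (2 * \<rho>) \<and> (\<forall>u\<in>ball w (2 * \<rho>). F n (s n \<zeta> u) = u) \<and> s n \<zeta> w = \<zeta>"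
    by metis
  have "disc_sections f w \<rho> s" by unfold_locales (use assms s in auto)
  then show ?thesis by blast
qed

lemma tree_of_small_diameter:
  assumes \<phi>: "continuous_on {0..1} \<phi>" "\<phi> ` {0..1::real} = J"
  shows "\<exists>c>0. \<forall>D Z. D \<ge> 1 \<longrightarrow> finite Z \<longrightarrow> Z \<noteq> {} \<longrightarrow> card Z \<le> D \<longrightarrow> (\<forall>z\<in>Z. local_height f z < c / real D) \<longrightarrow>
       (\<exists>T. finite_topological_tree T \<and> Z \<subseteq> T \<and> log_transfinite_diam T \<le> ereal (- (c / real D)))"
proof -
  obtain w H where w: "w \<in> J" and H: "compact H" "connected H" "H \<subseteq> K" "P \<subseteq> H" "w \<notin> H" "H \<inter> J \<noteq> {}"
    using non_separating_point[OF \<phi>] by blast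
  obtain v where v: "v \<in> H" "v \<in> J" using H(6) by blast
  have "open (- H)" using H(1) compact_imp_closed by blast
  then obtain \<rho>2 where \<rho>2: "\<rho>2 > 0" "ball w \<rho>2 \<subseteq> - H" using H(5) open_contains_ball by blast
  define \<rho> where "\<rho> = \<rho>2 / 2"
  have \<rho>: "\<rho> > 0" and discH: "ball w (2 * \<rho>) \<inter> H = {}" using \<rho>2 by (auto simp: \<rho>_def)
  have discP: "ball w (2 * \<rho>) \<inter> P = {}" using discH H(4) by blast
  \<comment> \<open>An escaping point closer to \<open>v\<close> than \<open>\<rho>\<close>, while
    \<open>H\<close> keeps distance \<open>2 * \<rho>\<close> from \<open>w\<close>: the segment to
    it avoids the closed disc.\<close>
  obtain v' where v': "v' \<in> ball v \<rho>" "v' \<notin> K" using J_near_complement[OF v(2) \<rho>] by blast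
  have seg: "closed_segment v v' \<inter> cball w \<rho> = {}"
  proof -
    have "closed_segment v v' \<subseteq> ball v \<rho>" using v'(1) \<rho> by (intro closed_segment_subset) auto
    moreover have "2 * \<rho> \<le> dist w v" using discH v(1) by (auto simp: not_less[symmetric])
    moreover have "dist w v \<le> dist w x + dist v x" for x by (metis dist_commute dist_triangle)
    ultimately show ?thesis by (smt (verit, best) disjoint_iff mem_ball mem_cball subsetD)
  qed
  \<comment> \<open>The radius is \<open>r / 8\<close> for the circle radius
    \<open>r = \<rho> / 2\<close> with which \<open>vdm_upper_bound\<close> is applied.\<close>
  obtain l where l: "\<forall>u. norm u \<le> R0 + 1 \<and> u \<notin> interior K \<longrightarrow> u \<in> F l ` ball w (\<rho> / 2 / 8)"
    using eventually_onto[OF w, of "\<rho> / 2 / 8" "R0 + 1"] \<rho> by auto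
  obtain B where B: "B \<ge> 1" "\<And>j z. norm z \<le> R0 \<Longrightarrow> norm (F j z) \<le> B ^ (d ^ j)"
    using iter_growth_bound by blast
  have d2: "real d \<ge> 2" using degree_ge_2 by linarith
  define c2 where "c2 = ln 3 / (4 * real d ^ (2 * l))"
  have c2: "c2 > 0" using d2 by (auto simp: c2_def intro!: divide_pos_pos mult_pos_pos)
  obtain N1 where N1: "\<And>n. n \<ge> N1 \<Longrightarrow> 2 * R0 \<le> norm (F n v')" using escape[OF v'(2)] by blast
  obtain k where k: "2 * ln B / c2 < real d ^ k" using real_arch_pow[of "real d"] d2 by force
  \<comment> \<open>Large enough for the loss in the energy estimate (\<open>k\<close>) and for
    \<open>v'\<close> to have left the domain (\<open>N1\<close>).\<close>
  define N0 where "N0 = max k N1"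
  have N0: "2 * ln B / real d ^ N0 \<le> c2"
  proof -
    have "real d ^ k \<le> real d ^ N0" using d2 by (intro power_increasing) (auto simp: N0_def)
    then have "2 * ln B / c2 < real d ^ N0" using k by linarith
    moreover have pos: "real d ^ N0 > 0" using d2 by simp
    moreover have "x / y \<le> c" if "x / c < y" "y > 0" "c > 0" for x y c :: real
      using that by (simp add: field_simps)
    ultimately show ?thesis using c2 by blast
  qed
  \<comment> \<open>One more than \<open>N0\<close>: a point of \<open>W (N + n)\<close> then has
    its iterate \<open>n + N0\<close> in the disc of radius \<open>R0\<close>.\<close>
  define N where "N = Suc N0"
  have v'W: "v' \<notin> W N" using N1[of N] by (simp add: W_def N_def N0_def not_less del: funpow.simps)
  obtain s where "disc_sections f w \<rho> s" using disc_sections_exist[OF \<rho> discP] by blast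
  then interpret disc_sections f w \<rho> s .
  have "H \<inter> cball w \<rho> = {}" using discH cball_subset_disc by blast
  then obtain A where A: "open A" "A \<noteq> {}" "P \<subseteq> A" "A \<subseteq> W N - cball w \<rho>" "\<And>n. connected (F n -` A)"
    using connected_preimage_domain[OF H(1-4) v(1) v'W seg] by blast
  have AW: "A \<subseteq> W N" using A(4) by blast
  obtain q' :: nat where q': "\<And>n z. norm (F N (F n z)) \<le> R0 \<Longrightarrow>
     \<exists>C. connected C \<and> z \<in> C \<and> C \<inter> F n -` A \<noteq> {} \<and> C \<subseteq> W (N + n) \<and> card (hits n C) \<le> q'"
    using bounded_hits[OF A(1-3) AW] by blast
  define q where "q = max 1 q'"
  have q: "\<exists>C. connected C \<and> z \<in> C \<and> C \<inter> F n -` A \<noteq> {} \<and> C \<subseteq> W (N + n) \<and> card (hits n C) \<le> q"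
    if "norm (F N (F n z)) \<le> R0" for n z
    using q'[OF that] unfolding q_def by (meson max.coboundedI2)
  have q1: "q \<ge> 1" by (simp add: q_def)
  \<comment> \<open>Two demands share one constant: \<open>c2\<close> comes from the diameter bound,
    and \<open>1 / real d ^ N\<close> turns small height into a long stay in the disc.\<close>
  define b where "b = min c2 (1 / real d ^ N)"
  have b: "b > 0" using c2 d2 by (simp add: b_def)
  \<comment> \<open>The minimal \<open>n\<close> with \<open>2 * q * D \<le> d ^ n\<close> satisfies
    \<open>d ^ n \<le> 2 * q * D * d\<close>, so \<open>c / D\<close> is at most
    \<open>b / d ^ n\<close>.\<close>
  define c where "c = b / (2 * real q * real d)"
  have c: "c > 0" using b q1 d2 by (simp add: c_def)
  have "\<exists>T. finite_topological_tree T \<and> Z \<subseteq> T \<and> log_transfinite_diam T \<le> ereal (- (c / real D))"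
    if D: "D \<ge> 1" and Z: "finite Z" "Z \<noteq> {}" "card Z \<le> D" and ht: "\<forall>z\<in>Z. local_height f z < c / real D"
    for D :: nat and Z
  proof -
    have "\<exists>n. 2 * q * D \<le> d ^ n"
    proof -
      have "2 * q * D < 2 ^ (2 * q * D)" by (rule less_exp)
      also have "\<dots> \<le> d ^ (2 * q * D)" using degree_ge_2 by (intro power_mono) auto
      finally show ?thesis using less_imp_le by blast
    qed
    define n where "n = (LEAST n. 2 * q * D \<le> d ^ n)"
    have n: "2 * q * D \<le> d ^ n" unfolding n_def using \<open>\<exists>n. _\<close> by (rule LeastI_ex)
    have "d ^ n \<le> 2 * q * D * d"
    proof (cases n)
      case 0
      have "1 \<le> 2 * q * D * d" using q1 D degree_ge_2 by (simp add: Suc_le_eq)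
      then show ?thesis using 0 by simp
    next
      case (Suc m)
      then have "\<not> 2 * q * D \<le> d ^ m" unfolding n_def using not_less_Least lessI by metis
      then have "d ^ m * d \<le> 2 * q * D * d" by (intro mult_right_mono) auto
      then show ?thesis using Suc by (simp add: mult.commute)
    qed
    then have "real (d ^ n) \<le> real (2 * q * D * d)" by (simp only: of_nat_le_iff)
    then have dn: "real d ^ n \<le> (2 * real q * real d) * real D" by (simp add: mult.assoc mult.left_commute mult.commute)
    have dn0: "real d ^ n > 0" using d2 by simp
    have "b / ((2 * real q * real d) * real D) \<le> b / real d ^ n"
      using dn dn0 b by (intro divide_left_mono mult_pos_pos) (use q1 d2 D in auto)
    then have cD: "c / real D \<le> b / real d ^ n" by (simp add: c_def)
    have hz: "norm (F (N + n) z) \<le> R0" if "z \<in> Z" for z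
    proof (rule ccontr)
      assume "\<not> norm (F (N + n) z) \<le> R0"
      then have "1 / real d ^ (N + n) \<le> local_height f z" by (intro local_height_escape) auto
      moreover have "b / real d ^ n \<le> 1 / real d ^ N / real d ^ n"
        using dn0 by (intro divide_right_mono) (auto simp: b_def)
      ultimately show False using bspec[OF ht that] cD by (simp add: power_add)
    qed
    from arc_avoiding_cells[OF A(1,2,4,5) q Z hz n]
    obtain p I where p: "arc p" "Z \<subseteq> path_image p" "path_image p \<subseteq> W (N + n)"
      and I: "I \<subseteq> {\<zeta>. F n \<zeta> = w}" "real d ^ n / 2 \<le> real (card I)" "\<forall>\<zeta>\<in>I. path_image p \<inter> s n \<zeta> ` cball w \<rho> = {}"
      by blast
    define T where "T = path_image p"
    have finI: "finite I" using I(1) finite_fibre_w finite_subset by blast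
    have fib: "F n \<zeta> = w" if "\<zeta> \<in> I" for \<zeta> using I(1) that by blast
    have sub: "ball w \<rho> \<subseteq> ball w (2 * \<rho>)" using cball_subset_disc ball_subset_cball by blast
    have Tn: "norm (F (n + N0) x) \<le> R0" if "x \<in> T" for x
    proof (rule ccontr)
      assume *: "\<not> norm (F (n + N0) x) \<le> R0"
      then have "2 * norm (F (n + N0) x) \<le> norm (poly f (F (n + N0) x))" by (intro norm_poly_ge_double) auto
      moreover have "norm (poly f (F (n + N0) x)) = norm (F (N + n) x)" by (simp add: N_def add.commute)
      moreover have "norm (F (N + n) x) < 2 * R0" using that p(3) by (auto simp: T_def W_def)
      ultimately show False using * by linarith
    qed
    have "\<exists>A. \<forall>k X. k \<ge> n + N0 + l \<longrightarrow> X \<subseteq> T \<longrightarrow> finite X \<longrightarrow> card X = d ^ k \<longrightarrow>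
       ln (vdm X) \<le> A * real (k + 1) * real d ^ k - c2 / real d ^ n * (real d ^ k)^2"
      unfolding c2_def
    proof (rule vdm_upper_bound[where r = "\<rho> / 2" and R = \<rho> and w = w and B = B and I = I and s = "s n"])
      show "ball w \<rho> \<inter> P = {}" using sub discP by blast
      show "2 * ln B / real d ^ N0 \<le> ln 3 / (4 * real d ^ (2 * l))" using N0 by (simp add: c2_def)
      show "s n i holomorphic_on ball w \<rho>" if "i \<in> I" for i
        using s_hol[OF fib[OF that]] sub holomorphic_on_subset by blast
      show "F n (s n i u) = u" if "i \<in> I" "u \<in> ball w \<rho>" for i u
        using s_inv[OF fib[OF that(1)]] sub that(2) by blast
      show "s n i w \<noteq> s n j w" if "i \<in> I" "j \<in> I" "i \<noteq> j" for i j
        using that by (simp add: s_centre fib)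
      show "T \<inter> s n i ` ball w \<rho> = {}" if "i \<in> I" for i
        using I(3) that ball_subset_cball unfolding T_def by blast
    qed (use \<rho> l B finI I(2) Tn in auto)
    then obtain A' where A': "\<And>k X. k \<ge> n + N0 + l \<Longrightarrow> X \<subseteq> T \<Longrightarrow> finite X \<Longrightarrow> card X = d ^ k \<Longrightarrow>
       ln (vdm X) \<le> A' * real (k + 1) * real d ^ k - c2 / real d ^ n * (real d ^ k)^2" by blast
    have "log_transfinite_diam T \<le> ereal (- (c2 / real d ^ n))"
      using degree_ge_2 c2 A' by (intro log_transfinite_diam_le[of d _ "n + N0 + l" T A']) auto
    also have "\<dots> \<le> ereal (- (c / real D))"
    proof -
      have "b / real d ^ n \<le> c2 / real d ^ n" using dn0 by (intro divide_right_mono) (auto simp: b_def)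
      then show ?thesis using cD by simp
    qed
    finally show ?thesis using finite_topological_tree_arc[OF p(1)] p(2) unfolding T_def by blast
  qed
  with c show ?thesis by (intro exI[of _ c] conjI allI impI) simp_all
qed

end

theorem corollary4p2:
  fixes f :: "complex poly"
  assumes "lead_coeff f = 1"
    and "degree f \<ge> 2"
    and "hyperbolic_poly f"
    and "postcritically_finite f"
  shows "\<exists>c::real. c > 0 \<and>
    (\<forall>(D::nat) (z :: nat \<Rightarrow> complex). D \<ge> 1 \<longrightarrow>
       Max ((\<lambda>j. local_height f (z j)) ` {1..D}) < c / real D \<longrightarrow>
       (\<exists>T. finite_topological_tree T \<and> z ` {1..D} \<subseteq> T \<and>
            log_transfinite_diam T \<le> ereal (- (c / real D))))"
proof -
  have "pcf_dynamics f \<and> (\<exists>\<phi>::real \<Rightarrow> complex. continuous_on {0..1} \<phi> \<and> \<phi> ` {0..1} = julia_set f)"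
    by (rule hyperbolic_pcf_dynamics[OF assms])
  then obtain \<phi> :: "real \<Rightarrow> complex" where f: "pcf_dynamics f"
    and \<phi>: "continuous_on {0..1} \<phi>" "\<phi> ` {0..1} = julia_set f" by blast
  interpret pcf_dynamics f by (rule f)
  obtain c where c: "c > 0" and
    tree: "\<forall>D Z. D \<ge> 1 \<longrightarrow> finite Z \<longrightarrow> Z \<noteq> {} \<longrightarrow> card Z \<le> D \<longrightarrow> (\<forall>z\<in>Z. local_height f z < c / real D) \<longrightarrow>
       (\<exists>T. finite_topological_tree T \<and> Z \<subseteq> T \<and> log_transfinite_diam T \<le> ereal (- (c / real D)))"
    using tree_of_small_diameter[OF \<phi>] by metis
  show ?thesis
  proof (intro exI[of _ c] conjI allI impI)
    fix D :: nat and z :: "nat \<Rightarrow> complex"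
    assume D: "D \<ge> 1" and "Max ((\<lambda>j. local_height f (z j)) ` {1..D}) < c / real D"
    then have "\<forall>x\<in>z ` {1..D}. local_height f x < c / real D" by (subst (asm) Max_less_iff) auto
    \<comment> \<open>Repetitions among the points are allowed, so the set may have fewer than
      \<open>D\<close> elements.\<close>
    moreover have "card (z ` {1..D}) \<le> D" using card_image_le[of "{1..D}" z] by simp
    moreover have "z ` {1..D} \<noteq> {}" using D by simp
    ultimately show "\<exists>T. finite_topological_tree T \<and> z ` {1..D} \<subseteq> T \<and> log_transfinite_diam T \<le> ereal (- (c / real D))"
      using tree D by blast
  qed (rule c)
qed

end
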